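(* Let $R$ be a smooth, finitely generated commutative $V$-algebra of relative dimension $1$, equipped with the fine bornology. Then $R$ admits a connection of finite degree, that is, there is a connection $\nabla\colon\Omega^1(R)\to\Omega^2(R)$ of finite degree.
   Context: $V$ is a complete discrete valuation ring. Tensor products are over $V$. The fine bornology on a $V$-module $M$ has as bounded subsets those contained in a finitely generated $V$-submodule. $R^+=R\oplus V$ is the unitalisation of $R$ (formally adjoining a new unit). $\Omega^0(R)=R$ and, for $n\ge1$, $\Omega^n(R)=R^+\otimes R^{\otimes n}$ is the module of noncommutative differential $n$-forms, with $x_0\otimes x_1\otimes\dots\otimes x_n$ written $x_0\,\mathrm dx_1\dots\mathrm dx_n$; products of forms (in particular the $R$-bimodule structure) are determined by the Leibniz rule $\mathrm d(xy)=x\,\mathrm dy+(\mathrm dx)y$. (For the fine bornology these are already complete, so $\Omega^n(R)=\widehat\Omega^n(R)$.) A connection is a $V$-linear map $\nabla\colon\Omega^1(R)\to\Omega^2(R)$ with $\nabla(a\omega)=a\nabla(\omega)$ and $\nabla(\omega a)=\nabla(\omega)a+\omega\,\mathrm da$ for all $a\in R$, $\omega\in\Omega^1(R)$. For a $V$-submodule $M\subseteq R$, let $M^i$ be the $V$-span of $i$-fold products of elements of $M$, $M^{(n)}=\sum_{i=1}^nM^i$, and $$\mathcal F^M_r\Omega^jR=\sum_{i_0+\dots+i_j\le r}M^{(i_0)}\,\mathrm dM^{(i_1)}\dots\mathrm dM^{(i_j)}\oplus\sum_{i_1+\dots+i_j\le r}\mathrm dM^{(i_1)}\dots\mathrm dM^{(i_j)}$$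 (submodules generated by such forms). The connection $\nabla$ has finite degree on a bounded submodule $M$ if there is $a\in\mathbb N$ with $\nabla(\mathcal F^M_n\Omega^1R)\subseteq\mathcal F^M_{n+a}\Omega^2R$ for all $n\in\mathbb N$. It has finite degree if every bounded subset of $R$ is contained in a bounded submodule on which $\nabla$ has finite degree. *)

theory Defs
  imports Complex_Main "HOL-Library.Poly_Mapping" "HOL-Library.Product_Plus" "HOL-Library.FuncSet"
begin

definition (in comm_ring) ring_ideal :: "'a set \<Rightarrow> bool" where
  "ring_ideal I \<longleftrightarrow> 0 \<in> I \<and> (\<forall>x\<in>I. \<forall>y\<in>I. x + y \<in> I) \<and> (\<forall>a. \<forall>x\<in>I. a * x \<in> I)"

definition ring_prime_ideal :: "'a::{comm_ring,comm_monoid_mult} set \<Rightarrow> bool" where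
  "ring_prime_ideal P \<longleftrightarrow>
     ring_ideal P \<and> 1 \<notin> P \<and> (\<forall>a b. a * b \<in> P \<longrightarrow> a \<in> P \<or> b \<in> P)"

text \<open>
  A discrete valuation ring is a local principal ideal domain that is not a field. Its maximal
  ideal consists of the nonunits; if \<open>p\<close> generates it, the \<open>n\<close>-th power of the maximal ideal is the
  set of multiples of \<open>p ^ n\<close>. Completeness is convergence of Cauchy sequences in the topology
  defined by these powers; that this topology is separated is automatic.
\<close>

class complete_dvr = idom +
  assumes ideal_principal: "ring_ideal I \<Longrightarrow> \<exists>x. I = {x * y | y. True}"
    and nonunit_add: "\<not> x dvd 1 \<Longrightarrow> \<not> y dvd 1 \<Longrightarrow> \<not> (x + y) dvd 1"
    and not_field: "\<exists>x. x \<noteq> 0 \<and> \<not> x dvd 1"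
    and adic_complete:
      "(\<forall>x. \<not> x dvd 1 \<longleftrightarrow> p dvd x) \<Longrightarrow> (\<forall>n. p ^ n dvd s (Suc n) - s n) \<Longrightarrow>
        \<exists>l. \<forall>n. p ^ n dvd l - s n"

text \<open>Polynomials in variables indexed by the natural numbers; \<open>polys_in n\<close> is the polynomial ring
  in the variables with index below \<open>n\<close>.\<close>

type_synonym 'v mpoly = "(nat \<Rightarrow>\<^sub>0 nat) \<Rightarrow>\<^sub>0 'v"

definition polys_in :: "nat \<Rightarrow> 'v::zero mpoly set" where
  "polys_in n = {p. \<forall>m\<in>Poly_Mapping.keys p. Poly_Mapping.keys m \<subseteq> {..<n}}"

definition partial_deriv :: "nat \<Rightarrow> 'v::comm_ring_1 mpoly \<Rightarrow> 'v mpoly" where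
  "partial_deriv k p = (\<Sum>m\<in>Poly_Mapping.keys p.
     Poly_Mapping.single (m - Poly_Mapping.single k 1)
       (of_nat (Poly_Mapping.lookup m k) * Poly_Mapping.lookup p m))"

text \<open>The sort \<open>{comm_ring,comm_monoid_mult}\<close> is that of commutative unital rings, the zero ring
  included; \<open>comm_ring_1\<close> would exclude it.\<close>

locale comm_algebra = module scale
  for scale :: "'v::comm_ring_1 \<Rightarrow> 'r::{comm_ring,comm_monoid_mult} \<Rightarrow> 'r" (infixr \<open>*s\<close> 75) +
  assumes scale_mult: "(a *s x) * y = a *s (x * y)"
begin

lemma mult_scale: "x * (a *s y) = a *s (x * y)"
  using scale_mult[of a y x] by (simp add: mult.commute)

definition peval :: "(nat \<Rightarrow> 'r) \<Rightarrow> 'v mpoly \<Rightarrow> 'r" where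
  "peval x p = (\<Sum>m\<in>Poly_Mapping.keys p.
     Poly_Mapping.lookup p m *s (\<Prod>i\<in>Poly_Mapping.keys m. x i ^ Poly_Mapping.lookup m i))"

definition generates :: "nat \<Rightarrow> (nat \<Rightarrow> 'r) \<Rightarrow> bool" where
  "generates n x \<longleftrightarrow> peval x ` polys_in n = UNIV"

definition finitely_generated :: bool where
  "finitely_generated \<longleftrightarrow> (\<exists>n x. generates n x)"

text \<open>
  Smoothness of relative dimension \<open>d\<close> at a point, following Bosch--Luetkebohmert--Raynaud, Neron
  Models, Section 2.2, for closed embeddings of the spectrum into affine \<open>n\<close>-space, \<open>n = c + d\<close>:
  near the prime \<open>q\<close>, the ideal of the embedding is generated by \<open>c = n - d\<close> polynomials whose
  differentials are linearly independent in the fibre of the module of differentials of affine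
  space over the residue field at \<open>q\<close>. Generation after localisation at the preimage of \<open>q\<close> and
  linear independence over the fraction field of the quotient by \<open>q\<close> are written with
  denominators cleared.
\<close>

definition smooth_at :: "nat \<Rightarrow> 'r set \<Rightarrow> bool" where
  "smooth_at d q \<longleftrightarrow> (\<exists>c x (g :: nat \<Rightarrow> 'v mpoly).
     generates (c + d) x \<and>
     (\<forall>j<c. g j \<in> polys_in (c + d) \<and> peval x (g j) = 0) \<and>
     (\<forall>h\<in>polys_in (c + d). peval x h = 0 \<longrightarrow>
        (\<exists>s\<in>polys_in (c + d). peval x s \<notin> q \<and>
          (\<exists>b. (\<forall>j<c. b j \<in> polys_in (c + d)) \<and> s * h = (\<Sum>j<c. b j * g j)))) \<and>
     (\<forall>r. (\<forall>k<c + d. (\<Sum>j<c. r j * peval x (partial_deriv k (g j))) \<in> q) \<longrightarrow>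
        (\<forall>j<c. r j \<in> q)))"

definition smooth_of_relative_dimension :: "nat \<Rightarrow> bool" where
  "smooth_of_relative_dimension d \<longleftrightarrow> (\<forall>q. ring_prime_ideal q \<longrightarrow> smooth_at d q)"

definition fine_bounded :: "'r set \<Rightarrow> bool" where
  "fine_bounded S \<longleftrightarrow> (\<exists>F. finite F \<and> S \<subseteq> span F)"

end

text \<open>
  Elements of the unitalisation are pairs \<open>(x, a)\<close> of an element of the algebra and a scalar.
  A preform is an element of the free module on the pairs \<open>(z, [x1, ..., xn])\<close>, with \<open>z\<close> in the
  unitalisation; the basis element \<open>bas z [x1, ..., xn]\<close> represents \<open>z dx1 ... dxn\<close>.
\<close>

type_synonym ('v, 'r) preform = "(('r \<times> 'v) \<times> 'r list) \<Rightarrow>\<^sub>0 'v"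

definition fscale :: "'v::comm_ring_1 \<Rightarrow> ('k \<Rightarrow>\<^sub>0 'v) \<Rightarrow> ('k \<Rightarrow>\<^sub>0 'v)" where
  "fscale a f = Poly_Mapping.map ((*) a) f"

lemma lookup_fscale [simp]: "Poly_Mapping.lookup (fscale a f) k = a * Poly_Mapping.lookup f k"
  unfolding fscale_def by (transfer; auto simp: when_def)

interpretation free: module fscale
  by unfold_locales (auto intro!: poly_mapping_eqI simp: lookup_add algebra_simps)

definition lin_ext :: "('k \<Rightarrow> ('l \<Rightarrow>\<^sub>0 'v)) \<Rightarrow> ('k \<Rightarrow>\<^sub>0 'v::comm_ring_1) \<Rightarrow> ('l \<Rightarrow>\<^sub>0 'v)" where
  "lin_ext h f = (\<Sum>k\<in>Poly_Mapping.keys f. fscale (Poly_Mapping.lookup f k) (h k))"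

definition bas :: "'r \<times> 'v::comm_ring_1 \<Rightarrow> 'r list \<Rightarrow> ('v, 'r) preform" where
  "bas z xs = Poly_Mapping.single (z, xs) 1"

lemma lin_ext_superset:
  assumes "finite A" "Poly_Mapping.keys f \<subseteq> A"
  shows "lin_ext h f = (\<Sum>k\<in>A. fscale (Poly_Mapping.lookup f k) (h k))"
  unfolding lin_ext_def
  using assms by (intro sum.mono_neutral_left) (auto simp: in_keys_iff)

lemma lin_ext_hom:
  fixes h :: "'k \<Rightarrow> ('l \<Rightarrow>\<^sub>0 'v::comm_ring_1)"
  shows "module_hom fscale fscale (lin_ext h)"
proof unfold_locales
  fix f g :: "'k \<Rightarrow>\<^sub>0 'v"
  let ?A = "Poly_Mapping.keys f \<union> Poly_Mapping.keys g"
  have "lin_ext h e = (\<Sum>k\<in>?A. fscale (Poly_Mapping.lookup e k) (h k))"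
    if "e \<in> {f, g, f + g}" for e
    using that by (intro lin_ext_superset) (auto dest: subsetD[OF keys_add])
  then show "lin_ext h (f + g) = lin_ext h f + lin_ext h g"
    by (simp add: lookup_add free.scale_left_distrib sum.distrib)
next
  fix c :: 'v and f :: "'k \<Rightarrow>\<^sub>0 'v"
  have "lin_ext h (fscale c f) =
      (\<Sum>k\<in>Poly_Mapping.keys f. fscale (Poly_Mapping.lookup (fscale c f) k) (h k))"
    by (rule lin_ext_superset) (auto simp: in_keys_iff)
  then show "lin_ext h (fscale c f) = fscale c (lin_ext h f)"
    by (simp add: lin_ext_def free.scale_sum_right)
qed

lemma lin_ext_bas [simp]: "lin_ext h (bas z xs) = h (z, xs)"
  by (simp add: lin_ext_def bas_def)

context comm_algebra
begin

definition unital_mult :: "'r \<times> 'v \<Rightarrow> 'r \<times> 'v \<Rightarrow> 'r \<times> 'v" where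
  "unital_mult z w = (fst z * fst w + snd z *s fst w + snd w *s fst z, snd z * snd w)"

definition unital_scale :: "'v \<Rightarrow> 'r \<times> 'v \<Rightarrow> 'r \<times> 'v" where
  "unital_scale a z = (a *s fst z, a * snd z)"

text \<open>The relations defining the tensor products over the base ring, in all degrees at once.\<close>

inductive_set tensor_relations :: "('v, 'r) preform set" where
  add0: "bas (z + w) xs - bas z xs - bas w xs \<in> tensor_relations"
| scale0: "bas (unital_scale a z) xs - fscale a (bas z xs) \<in> tensor_relations"
| add: "bas z (us @ (x + y) # vs) - bas z (us @ x # vs) - bas z (us @ y # vs) \<in> tensor_relations"
| scale: "bas z (us @ (a *s x) # vs) - fscale a (bas z (us @ x # vs)) \<in> tensor_relations"

definition null_forms :: "('v, 'r) preform set" where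
  "null_forms = free.span tensor_relations"

text \<open>A form is a coset of preforms. For \<open>n \<ge> 1\<close>, \<open>Omega n\<close> is the module of \<open>n\<close>-forms.\<close>

definition cls :: "('v, 'r) preform \<Rightarrow> ('v, 'r) preform set" where
  "cls f = {g. g - f \<in> null_forms}"

definition Omega :: "nat \<Rightarrow> ('v, 'r) preform set set" where
  "Omega n = cls ` {f. \<forall>(z, xs)\<in>Poly_Mapping.keys f. length xs = n}"

definition lift_form ::
  "(('v, 'r) preform \<Rightarrow> ('v, 'r) preform) \<Rightarrow> ('v, 'r) preform set \<Rightarrow> ('v, 'r) preform set" where
  "lift_form h A = (\<Union>f\<in>A. cls (h f))"

definition form_add ::
  "('v, 'r) preform set \<Rightarrow> ('v, 'r) preform set \<Rightarrow> ('v, 'r) preform set" (infixl \<open>\<oplus>\<close> 65) where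
  "A \<oplus> B = (\<Union>f\<in>A. \<Union>g\<in>B. cls (f + g))"

definition form_scale :: "'v \<Rightarrow> ('v, 'r) preform set \<Rightarrow> ('v, 'r) preform set" where
  "form_scale a = lift_form (fscale a)"

definition pre_lmul :: "'r \<Rightarrow> ('v, 'r) preform \<Rightarrow> ('v, 'r) preform" where
  "pre_lmul a = lin_ext (\<lambda>(z, xs). bas (unital_mult (a, 0) z) xs)"

text \<open>Multiplication by \<open>da\<close> from the right.\<close>

definition pre_mul_d :: "'r \<Rightarrow> ('v, 'r) preform \<Rightarrow> ('v, 'r) preform" where
  "pre_mul_d a = lin_ext (\<lambda>(z, xs). bas z (xs @ [a]))"

text \<open>
  Right multiplication by \<open>a\<close>, by recursion with the Leibniz rule:
  \<open>(\<omega> dx) a = \<omega> d(x a) - (\<omega> x) da\<close>. The list in \<open>rmul_rev z [xn, ..., x1] a\<close> is reversed: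
  this is \<open>(z dx1 ... dxn) a\<close>.
\<close>

primrec rmul_rev :: "'r \<times> 'v \<Rightarrow> 'r list \<Rightarrow> 'r \<Rightarrow> ('v, 'r) preform" where
  "rmul_rev z [] a = bas (unital_mult z (a, 0)) []"
| "rmul_rev z (x # xs) a = bas z (rev xs @ [x * a]) - pre_mul_d a (rmul_rev z xs x)"

definition pre_rmul :: "'r \<Rightarrow> ('v, 'r) preform \<Rightarrow> ('v, 'r) preform" where
  "pre_rmul a = lin_ext (\<lambda>(z, xs). rmul_rev z (rev xs) a)"

definition form_lmul :: "'r \<Rightarrow> ('v, 'r) preform set \<Rightarrow> ('v, 'r) preform set" where
  "form_lmul a = lift_form (pre_lmul a)"

definition form_rmul :: "('v, 'r) preform set \<Rightarrow> 'r \<Rightarrow> ('v, 'r) preform set" where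
  "form_rmul A a = lift_form (pre_rmul a) A"

definition form_mul_d :: "('v, 'r) preform set \<Rightarrow> 'r \<Rightarrow> ('v, 'r) preform set" where
  "form_mul_d A a = lift_form (pre_mul_d a) A"

text \<open>The operations on cosets are computed on representatives.\<close>

lemma null_forms_subspace: "free.subspace null_forms"
  by (simp add: null_forms_def)

lemma null_forms_base: "f \<in> tensor_relations \<Longrightarrow> f \<in> null_forms"
  by (simp add: null_forms_def free.span_base)

lemma cls_self: "f \<in> cls f"
  using null_forms_subspace by (simp add: cls_def free.subspace_0)

lemma cls_eq_iff: "cls f = cls g \<longleftrightarrow> f - g \<in> null_forms"
proof
  assume "cls f = cls g"
  then have "f \<in> cls g" using cls_self[of f] by simp
  then show "f - g \<in> null_forms" by (simp add: cls_def)
next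
  assume fg: "f - g \<in> null_forms"
  have "h - g \<in> null_forms \<longleftrightarrow> h - f \<in> null_forms" for h
  proof
    assume "h - g \<in> null_forms"
    from free.subspace_diff[OF null_forms_subspace this fg] show "h - f \<in> null_forms" by simp
  next
    assume "h - f \<in> null_forms"
    from free.subspace_add[OF null_forms_subspace this fg] show "h - g \<in> null_forms" by simp
  qed
  then show "cls f = cls g" by (simp add: cls_def)
qed

lemma form_add_cls: "cls f \<oplus> cls g = cls (f + g)"
proof -
  have "cls (f' + g') = cls (f + g)" if "f' \<in> cls f" "g' \<in> cls g" for f' g'
  proof -
    have "(f' - f) + (g' - g) \<in> null_forms"
      using that by (intro free.subspace_add[OF null_forms_subspace]) (auto simp: cls_def)
    then show ?thesis by (simp add: cls_eq_iff algebra_simps)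
  qed
  moreover have "cls f \<noteq> {}" "cls g \<noteq> {}" using cls_self by blast+
  ultimately show ?thesis by (simp add: form_add_def)
qed

lemma hom_null_forms:
  assumes "module_hom fscale fscale h"
    and rel: "\<And>f. f \<in> tensor_relations \<Longrightarrow> h f \<in> null_forms"
    and f: "f \<in> null_forms"
  shows "h f \<in> null_forms"
proof -
  interpret h: module_hom fscale fscale h by fact
  have "f \<in> free.span tensor_relations" using f by (simp add: null_forms_def)
  then show ?thesis
  proof (induction rule: free.span_induct_alt)
    case base
    then show ?case by (simp add: h.zero free.subspace_0[OF null_forms_subspace])
  next
    case (step c x y)
    then show ?case
      by (simp add: h.add h.scale rel free.subspace_add[OF null_forms_subspace]
          free.subspace_scale[OF null_forms_subspace])
  qed
qed

lemma lift_form_cls: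
  assumes "module_hom fscale fscale h"
    and "\<And>f. f \<in> tensor_relations \<Longrightarrow> h f \<in> null_forms"
  shows "lift_form h (cls f) = cls (h f)"
proof -
  interpret h: module_hom fscale fscale h by fact
  have "cls (h g) = cls (h f)" if "g \<in> cls f" for g
    unfolding cls_eq_iff h.diff[symmetric]
    by (rule hom_null_forms[OF assms]) (use that in \<open>auto simp: cls_def\<close>)
  moreover have "cls f \<noteq> {}" using cls_self by blast
  ultimately show ?thesis by (simp add: lift_form_def)
qed

lemma form_scale_cls: "form_scale a (cls f) = cls (fscale a f)"
proof -
  have "module_hom fscale fscale (fscale a)"
    by unfold_locales (auto intro!: poly_mapping_eqI simp: lookup_add algebra_simps)
  then show ?thesis unfolding form_scale_def
    by (rule lift_form_cls) (simp add: null_forms_base free.subspace_scale[OF null_forms_subspace])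
qed

lemma pre_mul_d_null:
  assumes "f \<in> null_forms"
  shows "pre_mul_d a f \<in> null_forms"
proof -
  interpret h: module_hom fscale fscale "pre_mul_d a"
    unfolding pre_mul_d_def by (rule lin_ext_hom)
  have [simp]: "pre_mul_d a (bas z xs) = bas z (xs @ [a])" for z xs
    by (simp add: pre_mul_d_def)
  show ?thesis
  proof (rule hom_null_forms[OF h.module_hom_axioms _ assms])
    fix f assume "f \<in> tensor_relations"
    then show "pre_mul_d a f \<in> null_forms"
      by cases (auto simp: h.diff h.scale intro!: null_forms_base tensor_relations.intros)
  qed
qed

lemma form_mul_d_cls: "form_mul_d (cls f) a = cls (pre_mul_d a f)"
proof -
  have "module_hom fscale fscale (pre_mul_d a)"
    unfolding pre_mul_d_def by (rule lin_ext_hom)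
  then show ?thesis unfolding form_mul_d_def
    by (rule lift_form_cls) (simp add: pre_mul_d_null null_forms_base)
qed

lemma form_lmul_cls: "form_lmul a (cls f) = cls (pre_lmul a f)"
proof -
  interpret h: module_hom fscale fscale "pre_lmul a"
    unfolding pre_lmul_def by (rule lin_ext_hom)
  have [simp]: "pre_lmul a (bas z xs) = bas (unital_mult (a, 0) z) xs" for z xs
    by (simp add: pre_lmul_def)
  have [simp]: "unital_mult (a, 0) (z + w) = unital_mult (a, 0) z + unital_mult (a, 0) w"
    "unital_mult (a, 0) (unital_scale c z) = unital_scale c (unital_mult (a, 0) z)" for z w c
    by (simp_all add: unital_mult_def unital_scale_def algebra_simps scale_mult mult_scale)
  show ?thesis unfolding form_lmul_def
  proof (rule lift_form_cls[OF h.module_hom_axioms])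
    fix f assume "f \<in> tensor_relations"
    then show "pre_lmul a f \<in> null_forms"
      by cases (auto simp: h.diff h.scale intro!: null_forms_base tensor_relations.intros)
  qed
qed

lemma unital_mult_linear:
  "unital_mult (z + w) (a, 0) = unital_mult z (a, 0) + unital_mult w (a, 0)"
  "unital_mult (unital_scale c z) (a, 0) = unital_scale c (unital_mult z (a, 0))"
  "unital_mult z (a + b, 0) = unital_mult z (a, 0) + unital_mult z (b, 0)"
  "unital_mult z (c *s a, 0) = unital_scale c (unital_mult z (a, 0))"
  by (simp_all add: unital_mult_def unital_scale_def algebra_simps scale_mult mult_scale)

lemma pre_mul_d_linear:
  "pre_mul_d (a + b) f - pre_mul_d a f - pre_mul_d b f \<in> null_forms"
  "pre_mul_d (c *s a) f - fscale c (pre_mul_d a f) \<in> null_forms"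
proof -
  have "pre_mul_d (a + b) f - pre_mul_d a f - pre_mul_d b f =
    (\<Sum>k\<in>Poly_Mapping.keys f. fscale (Poly_Mapping.lookup f k)
       (bas (fst k) (snd k @ (a + b) # []) - bas (fst k) (snd k @ a # []) -
        bas (fst k) (snd k @ b # [])))"
    by (simp add: pre_mul_d_def lin_ext_def case_prod_beta free.scale_right_diff_distrib
        sum_subtractf)
  also have "\<dots> \<in> null_forms"
    by (intro free.subspace_sum[OF null_forms_subspace] free.subspace_scale[OF null_forms_subspace]
        null_forms_base tensor_relations.add)
  finally show "pre_mul_d (a + b) f - pre_mul_d a f - pre_mul_d b f \<in> null_forms" .
  have "pre_mul_d (c *s a) f - fscale c (pre_mul_d a f) =
    (\<Sum>k\<in>Poly_Mapping.keys f. fscale (Poly_Mapping.lookup f k)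
       (bas (fst k) (snd k @ (c *s a) # []) - fscale c (bas (fst k) (snd k @ a # []))))"
    by (simp add: pre_mul_d_def lin_ext_def case_prod_beta free.scale_right_diff_distrib
        sum_subtractf free.scale_sum_right mult.commute)
  also have "\<dots> \<in> null_forms"
    by (intro free.subspace_sum[OF null_forms_subspace] free.subspace_scale[OF null_forms_subspace]
        null_forms_base tensor_relations.scale)
  finally show "pre_mul_d (c *s a) f - fscale c (pre_mul_d a f) \<in> null_forms" .
qed

lemma rmul_rev_add_scale:
  "rmul_rev (z + w) xs a - rmul_rev z xs a - rmul_rev w xs a \<in> null_forms"
  "rmul_rev (unital_scale c z) xs a - fscale c (rmul_rev z xs a) \<in> null_forms"
  "rmul_rev z xs (a + b) - rmul_rev z xs a - rmul_rev z xs b \<in> null_forms"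
  "rmul_rev z xs (c *s a) - fscale c (rmul_rev z xs a) \<in> null_forms"
proof -
  interpret h: module_hom fscale fscale "pre_mul_d a" for a
    unfolding pre_mul_d_def by (rule lin_ext_hom)
  note sub = free.subspace_diff[OF null_forms_subspace] null_forms_base
  show "rmul_rev (z + w) xs a - rmul_rev z xs a - rmul_rev w xs a \<in> null_forms"
  proof (induction xs arbitrary: a)
    case Nil
    show ?case by (simp add: unital_mult_linear null_forms_base tensor_relations.add0)
  next
    case (Cons x xs)
    from sub(1)[OF sub(2)[OF tensor_relations.add0[of z w "rev xs @ [x * a]"]]
      pre_mul_d_null[OF Cons.IH[of x], of a]]
    show ?case by (simp add: h.diff h.add algebra_simps)
  qed
  show "rmul_rev (unital_scale c z) xs a - fscale c (rmul_rev z xs a) \<in> null_forms"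
  proof (induction xs arbitrary: a)
    case Nil
    show ?case by (simp add: unital_mult_linear null_forms_base tensor_relations.scale0)
  next
    case (Cons x xs)
    from sub(1)[OF sub(2)[OF tensor_relations.scale0[of c z "rev xs @ [x * a]"]]
      pre_mul_d_null[OF Cons.IH[of x], of a]]
    show ?case by (simp add: h.diff h.add h.scale free.scale_right_diff_distrib algebra_simps)
  qed
  show "rmul_rev z xs (a + b) - rmul_rev z xs a - rmul_rev z xs b \<in> null_forms"
  proof (cases xs)
    case Nil
    then show ?thesis by (simp add: unital_mult_linear null_forms_base tensor_relations.add0)
  next
    case (Cons x ys)
    from sub(1)[OF sub(2)[OF tensor_relations.add[of z "rev ys" "x * a" "x * b" "[]"]]
      pre_mul_d_linear(1)[of a b "rmul_rev z ys x"]]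
    show ?thesis by (simp add: Cons algebra_simps)
  qed
  show "rmul_rev z xs (c *s a) - fscale c (rmul_rev z xs a) \<in> null_forms"
  proof (cases xs)
    case Nil
    then show ?thesis by (simp add: unital_mult_linear null_forms_base tensor_relations.scale0)
  next
    case (Cons x ys)
    from sub(1)[OF sub(2)[OF tensor_relations.scale[of z "rev ys" c "x * a" "[]"]]
      pre_mul_d_linear(2)[of c a "rmul_rev z ys x"]]
    show ?thesis by (simp add: Cons mult_scale free.scale_right_diff_distrib algebra_simps)
  qed
qed

lemma rmul_rev_slot:
  "rmul_rev z (us @ (x + y) # vs) a - rmul_rev z (us @ x # vs) a - rmul_rev z (us @ y # vs) a
     \<in> null_forms"
  "rmul_rev z (us @ (c *s x) # vs) a - fscale c (rmul_rev z (us @ x # vs) a) \<in> null_forms"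
proof -
  interpret h: module_hom fscale fscale "pre_mul_d a" for a
    unfolding pre_mul_d_def by (rule lin_ext_hom)
  note sub = free.subspace_diff[OF null_forms_subspace] null_forms_base
  show "rmul_rev z (us @ (x + y) # vs) a - rmul_rev z (us @ x # vs) a - rmul_rev z (us @ y # vs) a
     \<in> null_forms"
  proof (induction us arbitrary: a)
    case Nil
    from sub(1)[OF sub(2)[OF tensor_relations.add[of z "rev vs" "x * a" "y * a" "[]"]]
      pre_mul_d_null[OF rmul_rev_add_scale(3)[of z vs x y], of a]]
    show ?case by (simp add: h.diff h.add algebra_simps)
  next
    case (Cons u us)
    from sub(1)[OF sub(2)[OF tensor_relations.add[of z "rev vs" x y "rev us @ [u * a]"]]
      pre_mul_d_null[OF Cons.IH[of u], of a]]
    show ?case by (simp add: h.diff h.add algebra_simps)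
  qed
  show "rmul_rev z (us @ (c *s x) # vs) a - fscale c (rmul_rev z (us @ x # vs) a) \<in> null_forms"
  proof (induction us arbitrary: a)
    case Nil
    from sub(1)[OF sub(2)[OF tensor_relations.scale[of z "rev vs" c "x * a" "[]"]]
      pre_mul_d_null[OF rmul_rev_add_scale(4)[of z vs c x], of a]]
    show ?case
      by (simp add: h.diff h.add h.scale scale_mult mult_scale free.scale_right_diff_distrib algebra_simps)
  next
    case (Cons u us)
    from sub(1)[OF sub(2)[OF tensor_relations.scale[of z "rev vs" c x "rev us @ [u * a]"]]
      pre_mul_d_null[OF Cons.IH[of u], of a]]
    show ?case by (simp add: h.diff h.add h.scale free.scale_right_diff_distrib algebra_simps)
  qed
qed

lemma form_rmul_cls: "form_rmul (cls f) a = cls (pre_rmul a f)"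
proof -
  interpret h: module_hom fscale fscale "pre_rmul a"
    unfolding pre_rmul_def by (rule lin_ext_hom)
  have [simp]: "pre_rmul a (bas z xs) = rmul_rev z (rev xs) a" for z xs
    by (simp add: pre_rmul_def)
  show ?thesis unfolding form_rmul_def
  proof (rule lift_form_cls[OF h.module_hom_axioms])
    fix f assume "f \<in> tensor_relations"
    then show "pre_rmul a f \<in> null_forms"
      by cases (simp_all add: h.diff h.scale rmul_rev_add_scale rmul_rev_slot)
  qed
qed

definition connection :: "(('v, 'r) preform set \<Rightarrow> ('v, 'r) preform set) \<Rightarrow> bool" where
  "connection D \<longleftrightarrow> D \<in> Omega 1 \<rightarrow> Omega 2 \<and>
     (\<forall>A\<in>Omega 1. \<forall>B\<in>Omega 1. D (A \<oplus> B) = D A \<oplus> D B) \<and>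
     (\<forall>a. \<forall>A\<in>Omega 1. D (form_scale a A) = form_scale a (D A)) \<and>
     (\<forall>a. \<forall>A\<in>Omega 1. D (form_lmul a A) = form_lmul a (D A)) \<and>
     (\<forall>a. \<forall>A\<in>Omega 1. D (form_rmul A a) = form_rmul (D A) a \<oplus> form_mul_d A a)"

definition prod_span :: "'r set \<Rightarrow> nat \<Rightarrow> 'r set" where
  "prod_span M i = span {prod_list xs | xs. length xs = i \<and> set xs \<subseteq> M}"

definition prod_filt :: "'r set \<Rightarrow> nat \<Rightarrow> 'r set" where
  "prod_filt M n = span (\<Union>i\<in>{1..n}. prod_span M i)"

definition form_filt :: "'r set \<Rightarrow> nat \<Rightarrow> nat \<Rightarrow> ('v, 'r) preform set set" where
  "form_filt M r j = cls ` free.span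
     ({bas (m, 0) ms | m ms. length ms = j \<and>
         (\<exists>i. (\<Sum>k\<le>j. i k) \<le> r \<and> m \<in> prod_filt M (i 0) \<and>
              (\<forall>k<j. ms ! k \<in> prod_filt M (i (Suc k))))} \<union>
      {bas (0, 1) ms | ms. length ms = j \<and>
         (\<exists>i. (\<Sum>k<j. i k) \<le> r \<and> (\<forall>k<j. ms ! k \<in> prod_filt M (i k)))})"

definition finite_degree_on ::
  "'r set \<Rightarrow> (('v, 'r) preform set \<Rightarrow> ('v, 'r) preform set) \<Rightarrow> bool" where
  "finite_degree_on M D \<longleftrightarrow> (\<exists>a. \<forall>n. D ` form_filt M n 1 \<subseteq> form_filt M (n + a) 2)"

definition finite_degree :: "(('v, 'r) preform set \<Rightarrow> ('v, 'r) preform set) \<Rightarrow> bool" where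
  "finite_degree D \<longleftrightarrow> (\<forall>S. fine_bounded S \<longrightarrow>
     (\<exists>M. S \<subseteq> M \<and> subspace M \<and> fine_bounded M \<and> finite_degree_on M D))"

end

end

(*
  Let A be the tensor square of R and I the kernel of the multiplication A -> R. A connection
  amounts to a linear map ph from R to the 2-forms with ph(xy) = x ph(y) + ph(x) y + dx dy. Such a
  map is obtained from finitely many derivations G_i from R to the bimodule A and elements z_i of R
  with sum_i G_i(x) Dz_i = Dx, where Dx = 1 (x) x - x (x) 1 in I; that is, from a dual basis
  showing that the A-module I is projective.

  Projectivity is local on the diagonal. At a prime q, smoothness of relative dimension 1 expresses
  the ideal of the diagonal in affine space over R by c relations and one Dx_k. The differences of
  the coordinates form a regular sequence, so all relations between them are Koszul, and this
  property passes through the matrix that is invertible at q: hence Dx_k generates I at q and is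
  not a zero divisor there. Hilbert's basis theorem provides one denominator for all relations.
  The elements f of A such that f times the inclusion of I factors through a free module form an
  ideal that contains I and whose image in R lies in no prime ideal, so it contains 1.

  The degree of the connection on a finitely generated module M that generates R is finite because
  ph(y_1 ... y_n) is determined by the ph(y_i) through the above product rule.
*)
theory Submission
  imports Defs
begin

section \<open>Monoid algebras\<close>

text \<open>Neither the tensor square nor the polynomial ring over R is available as a type. The
  first depends on \<open>scale\<close>; it is handled as the monoid algebra \<open>tens\<close>
  with congruence modulo \<open>tensor_null\<close>. The second is not of class
  \<open>comm_ring_1\<close>, because R may be the zero ring; it is replaced by polynomials over the
  monoid algebra of the multiplicative monoid of R, modulo those whose coefficients
  \<open>ka\<close> sends to 0. Derivations and inverse maps therefore obey their laws only up to
  congruence.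

  A dual basis yields \<open>ph\<close> by replacing each a (x) b in G_i(x) by a Dz_i Db. Left
  multiplication passes through this; right multiplication by y leaves a defect, and the identity
  sum_i G_i(x) Dz_i = Dx makes the defects add up to Dx Dy. The obstacle is that the unit e of R is
  not the unit of the unitalisation: de need not vanish and Dx Dy differs from dx dy, so an explicit
  extra term is added.

  That I itself consists of admissible factors f is what reduces the question from primes of the
  tensor square to primes of R.\<close>

lemma poly_mapping_add_induct [case_names zero single add]:
  assumes "P 0" and "\<And>k c. P (Poly_Mapping.single k c)" and "\<And>f g. P f \<Longrightarrow> P g \<Longrightarrow> P (f + g)"
  shows "P (f :: 'k \<Rightarrow>\<^sub>0 'v::comm_monoid_add)"
proof -
  have f: "f = (\<Sum>k\<in>Poly_Mapping.keys f. Poly_Mapping.single k (Poly_Mapping.lookup f k))"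
    by (rule poly_mapping_eqI) (auto simp: lookup_sum lookup_single when_def in_keys_iff)
  have "P (\<Sum>k\<in>A. Poly_Mapping.single k (Poly_Mapping.lookup f k))" if "finite A" for A
    using that by induction (use assms in auto)
  then show ?thesis by (subst f) simp
qed

locale ring_map =
  fixes h :: "'a::{comm_ring,comm_monoid_mult} \<Rightarrow> 'b::{comm_ring,comm_monoid_mult}"
  assumes add: "h (a + b) = h a + h b"
    and mult: "h (a * b) = h a * h b"
    and one: "h 1 = 1"
begin

sublocale additive h
  by standard (rule add)

end

lemma ring_map_comp: "ring_map g \<Longrightarrow> ring_map h \<Longrightarrow> ring_map (\<lambda>x. g (h x))"
  by (simp add: ring_map_def)

text \<open>Extension along \<open>f\<close> of an arbitrary map \<open>u\<close> on basis elements.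
  It is multiplicative as soon as \<open>u\<close> is a monoid homomorphism; for other
  \<open>u\<close> additivity remains, which is how \<open>sect\<close> uses it.\<close>

definition alg_ext ::
  "('v::zero \<Rightarrow> 's) \<Rightarrow> ('k \<Rightarrow> 's) \<Rightarrow> ('k \<Rightarrow>\<^sub>0 'v) \<Rightarrow> 's::{comm_ring,comm_monoid_mult}" where
  "alg_ext f u p = (\<Sum>k\<in>Poly_Mapping.keys p. f (Poly_Mapping.lookup p k) * u k)"

context
  fixes f :: "'v::comm_ring_1 \<Rightarrow> 's::{comm_ring,comm_monoid_mult}"
  assumes f: "ring_map f"
begin

interpretation ring_map f by (rule f)

lemma alg_ext_superset:
  assumes "finite A" "Poly_Mapping.keys p \<subseteq> A"
  shows "alg_ext f u p = (\<Sum>k\<in>A. f (Poly_Mapping.lookup p k) * u k)"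
  unfolding alg_ext_def
  using assms by (intro sum.mono_neutral_left) (auto simp: in_keys_iff zero)

lemma alg_ext_add: "alg_ext f u (p + q) = alg_ext f u p + alg_ext f u q"
proof -
  let ?A = "Poly_Mapping.keys p \<union> Poly_Mapping.keys q"
  have "alg_ext f u e = (\<Sum>k\<in>?A. f (Poly_Mapping.lookup e k) * u k)"
    if "e \<in> {p, q, p + q}" for e
    using that by (intro alg_ext_superset) (auto dest: subsetD[OF keys_add])
  then show ?thesis by (simp add: lookup_add add distrib_right sum.distrib)
qed

lemma additive_alg_ext: "additive (alg_ext f u)"
  by standard (rule alg_ext_add)

lemma alg_ext_single: "alg_ext f u (Poly_Mapping.single k c) = f c * u k"
  by (subst alg_ext_superset[of "{k}"]) auto

lemma ring_map_alg_ext: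
  fixes u :: "'k::comm_monoid_add \<Rightarrow> 's"
  assumes "u 0 = 1" "\<And>k l. u (k + l) = u k * u l"
  shows "ring_map (alg_ext f u)"
proof
  interpret e: additive "alg_ext f u" by (rule additive_alg_ext)
  fix p q
  show "alg_ext f u (p * q) = alg_ext f u p * alg_ext f u q"
  proof (induction p rule: poly_mapping_add_induct)
    case (single k c)
    show ?case
      by (induction q rule: poly_mapping_add_induct)
        (simp_all add: e.zero e.add distrib_left mult_single alg_ext_single mult assms mult.left_commute mult.assoc)
  qed (simp_all add: e.zero e.add distrib_right)
  show "alg_ext f u 1 = 1"
    by (simp flip: single_one add: alg_ext_single one assms)
qed (rule alg_ext_add)

end

section \<open>Evaluation of polynomials\<close>

definition monom_val :: "('x \<Rightarrow> 's) \<Rightarrow> ('x \<Rightarrow>\<^sub>0 nat) \<Rightarrow> 's::comm_monoid_mult" where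
  "monom_val y m = (\<Prod>i\<in>Poly_Mapping.keys m. y i ^ Poly_Mapping.lookup m i)"

lemma monom_val_superset:
  assumes "finite A" "Poly_Mapping.keys m \<subseteq> A"
  shows "monom_val y m = (\<Prod>i\<in>A. y i ^ Poly_Mapping.lookup m i)"
  unfolding monom_val_def
  using assms by (intro prod.mono_neutral_left) (auto simp: in_keys_iff)

lemma monom_val_zero [simp]: "monom_val y 0 = 1"
  by (simp add: monom_val_def)

lemma monom_val_add: "monom_val y (m + l) = monom_val y m * monom_val y l"
proof -
  let ?A = "Poly_Mapping.keys m \<union> Poly_Mapping.keys l"
  have "monom_val y e = (\<Prod>k\<in>?A. y k ^ Poly_Mapping.lookup e k)" if "e \<in> {m, l, m + l}" for e
    using that by (intro monom_val_superset) (auto dest: subsetD[OF keys_add])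
  then show ?thesis by (simp add: lookup_add power_add prod.distrib)
qed

lemma monom_val_single [simp]: "monom_val y (Poly_Mapping.single i d) = y i ^ d"
  by (subst monom_val_superset[of "{i}"]) auto

lemma ring_map_eval:
  "ring_map f \<Longrightarrow> ring_map (alg_ext (f :: 'v::comm_ring_1 \<Rightarrow> _) (monom_val y))"
  by (intro ring_map_alg_ext monom_val_add monom_val_zero)

definition Var :: "nat \<Rightarrow> (nat \<Rightarrow>\<^sub>0 nat) \<Rightarrow>\<^sub>0 'v::comm_ring_1" where
  "Var i = Poly_Mapping.single (Poly_Mapping.single i 1) 1"

abbreviation Const :: "'v \<Rightarrow> 'k::zero \<Rightarrow>\<^sub>0 'v::comm_ring_1" where
  "Const c \<equiv> Poly_Mapping.single 0 c"

lemma ring_map_Const: "ring_map (Const :: 'v::comm_ring_1 \<Rightarrow> 'k::comm_monoid_add \<Rightarrow>\<^sub>0 'v)"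
  by standard (simp_all add: single_add mult_single)

lemma Const_mult: "Const (a * b) = Const a * (Const b :: 'k::comm_monoid_add \<Rightarrow>\<^sub>0 'v::comm_ring_1)"
  by (simp add: mult_single)

lemma fscale_eq_mult: "fscale a f = Const a * (f :: 'k::comm_monoid_add \<Rightarrow>\<^sub>0 'v::comm_ring_1)"
  unfolding fscale_def by (rule mult_map_scale_conv_mult)

lemma eval_Var:
  assumes "ring_map f"
  shows "alg_ext f (monom_val y) (Var i) = y i"
proof -
  interpret ring_map f by fact
  show ?thesis by (simp add: Var_def alg_ext_single[OF assms] one)
qed

lemma eval_Const:
  assumes "ring_map f"
  shows "alg_ext f (monom_val y) (Const c) = f c"
  by (simp add: alg_ext_single[OF assms])

text \<open>A copy of a multiplicative monoid, written additively, so that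
  \<open>'r mult_mon \<Rightarrow>\<^sub>0 'v\<close> is its monoid algebra.\<close>

typedef 'a mult_mon = "UNIV :: 'a set" morphisms of_mm to_mm ..

lemmas mm_inverse [simp] = of_mm_inverse to_mm_inverse[OF UNIV_I]

instantiation mult_mon :: (comm_monoid_mult) comm_monoid_add
begin

definition "0 = to_mm 1"
definition "x + y = to_mm (of_mm x * of_mm y)"

instance
  by standard (simp_all add: plus_mult_mon_def zero_mult_mon_def mult.assoc, simp add: mult.commute)

end

lemma of_mm_zero [simp]: "of_mm 0 = 1"
  and of_mm_add [simp]: "of_mm (x + y) = of_mm x * of_mm y"
  and to_mm_one [simp]: "to_mm 1 = 0"
  and to_mm_mult: "to_mm (a * b) = to_mm a + to_mm b"
  by (simp_all add: plus_mult_mon_def zero_mult_mon_def)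

section \<open>Ideals\<close>

interpretation ri: module "(*) :: 'a::comm_ring_1 \<Rightarrow> 'a \<Rightarrow> 'a"
  by standard (simp_all add: algebra_simps)

declare ri.scale_scale [simp del]

text \<open>By Zorn's lemma there is an ideal maximal among those that contain \<open>I\<close> and
  omit 1, and such an ideal is prime. The premise \<open>1 \<notin> I\<close> also excludes the zero
  ring.\<close>

lemma prime_ideal_supset:
  fixes I :: "'r::{comm_ring,comm_monoid_mult} set"
  assumes I: "ring_ideal I" "1 \<notin> I"
  obtains q where "ring_prime_ideal q" "I \<subseteq> q"
proof -
  define A where "A = {K. ring_ideal K \<and> 1 \<notin> K \<and> I \<subseteq> K}"
  have "\<exists>M\<in>A. \<forall>X\<in>A. M \<subseteq> X \<longrightarrow> X = M"
  proof (rule subset_Zorn_nonempty)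
    show "A \<noteq> {}" using I by (auto simp: A_def)
    fix C assume C: "C \<noteq> {}" "subset.chain A C"
    have "x + y \<in> \<Union>C" if xy: "x \<in> \<Union>C" "y \<in> \<Union>C" for x y
    proof -
      from xy obtain K L where KL: "K \<in> C" "L \<in> C" "x \<in> K" "y \<in> L" by auto
      then have "K \<subseteq> L \<or> L \<subseteq> K" using C unfolding subset.chain_def by blast
      then obtain H where "H \<in> C" "x \<in> H" "y \<in> H" using KL by blast
      moreover have "ring_ideal H" using C(2) \<open>H \<in> C\<close> by (auto simp: A_def subset.chain_def)
      ultimately show ?thesis unfolding ring_ideal_def by blast
    qed
    moreover have C': "\<forall>K\<in>C. ring_ideal K \<and> 1 \<notin> K \<and> I \<subseteq> K"
      using C(2) by (auto simp: A_def subset.chain_def)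
    moreover from C' C(1) have "0 \<in> \<Union>C"
      unfolding ring_ideal_def by blast
    moreover from C' have "a * x \<in> \<Union>C" if x: "x \<in> \<Union>C" for a x
    proof -
      from x obtain K where K: "K \<in> C" "x \<in> K" by auto
      then have "ring_ideal K" using C' by simp
      then have "a * x \<in> K" using K(2) by (simp add: ring_ideal_def)
      then show ?thesis using K(1) by auto
    qed
    ultimately have "ring_ideal (\<Union>C)"
      unfolding ring_ideal_def by simp
    moreover from C' C(1) have "1 \<notin> \<Union>C" "I \<subseteq> \<Union>C" by blast+
    ultimately show "\<Union>C \<in> A" unfolding A_def by simp
  qed
  then obtain M where M: "M \<in> A" and max: "\<And>X. X \<in> A \<Longrightarrow> M \<subseteq> X \<Longrightarrow> X = M" by blast
  from M have id: "ring_ideal M" and M1: "1 \<notin> M" and IM: "I \<subseteq> M" by (auto simp: A_def)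
  note idD = id[unfolded ring_ideal_def]
  \<comment> \<open>Maximality in usable form: otherwise the ideal generated by \<open>M\<close> and
    \<open>a\<close> would be a larger member of \<open>A\<close>.\<close>
  have unit: "\<exists>x\<in>M. \<exists>r. 1 = x + r * a" if "a \<notin> M" for a
  proof (rule ccontr)
    assume no: "\<not> ?thesis"
    define X where "X = {x + r * a | x r. x \<in> M}"
    have "ring_ideal X"
      unfolding ring_ideal_def
    proof (intro conjI ballI allI)
      show "0 \<in> X" unfolding X_def using idD by (auto intro!: exI[of _ 0])
      show "u + v \<in> X" if uv: "u \<in> X" "v \<in> X" for u v
      proof -
        from uv obtain x r y s where "u = x + r * a" "v = y + s * a" "x \<in> M" "y \<in> M"
          unfolding X_def by blast
        then have "u + v = (x + y) + (r + s) * a" "x + y \<in> M"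
          using idD by (auto simp: algebra_simps)
        then show ?thesis unfolding X_def by blast
      qed
      show "b * u \<in> X" if u: "u \<in> X" for b u
      proof -
        from u obtain x r where "u = x + r * a" "x \<in> M" unfolding X_def by blast
        then have "b * u = b * x + (b * r) * a" "b * x \<in> M"
          using idD by (auto simp: algebra_simps)
        then show ?thesis unfolding X_def by blast
      qed
    qed
    moreover have MX: "M \<subseteq> X"
    proof
      fix x assume "x \<in> M"
      moreover have "x = x + 0 * a" by simp
      ultimately show "x \<in> X" unfolding X_def by blast
    qed
    moreover have "1 \<notin> X" using no unfolding X_def by auto
    ultimately have "X = M" using max IM unfolding A_def by blast
    moreover have "a \<in> X"
    proof -
      have "a = 0 + 1 * a" by simp
      then show ?thesis using idD unfolding X_def by blast
    qed
    ultimately show False using that by blast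
  qed
  have "a \<in> M \<or> b \<in> M" if ab: "a * b \<in> M" for a b
  proof (rule ccontr)
    assume "\<not> ?thesis"
    then obtain x r y s where *: "x \<in> M" "y \<in> M" "1 = x + r * a" "1 = y + s * b"
      using unit by metis
    \<comment> \<open>In the product of the two expressions for 1 every term contains
      \<open>x\<close>, \<open>y\<close> or \<open>a * b\<close>.\<close>
    have "(1::'r) = (x + r * a) * (y + s * b)" using *(3,4) by (metis mult_1)
    also have "\<dots> = (y + s * b) * x + (r * a) * y + (r * s) * (a * b)"
      by (simp add: algebra_simps)
    also have "\<dots> \<in> M" using idD * ab by blast
    finally show False using M1 by blast
  qed
  then have "ring_prime_ideal M" using id M1 unfolding ring_prime_ideal_def by blast
  then show thesis using IM that by blast
qed

text \<open>Steinitz exchange. Since \<open>Q\<close> is only a prime ideal of a ring, \<open>W\<close> keeps an inverse \<open>L\<close> up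
  to a factor outside \<open>Q\<close>.\<close>

lemma exchange_rows:
  fixes v :: "nat \<Rightarrow> nat \<Rightarrow> 'a::comm_ring_1"
  assumes Q: "ri.subspace Q" "1 \<notin> Q" "\<And>a b. a * b \<in> Q \<Longrightarrow> a \<in> Q \<or> b \<in> Q"
    and indep: "\<forall>r. (\<forall>k<n. (\<Sum>j<m. r j * v j k) \<in> Q) \<longrightarrow> (\<forall>j<m. r j \<in> Q)"
  shows "\<exists>p W L d. inj_on p {..<m} \<and> p ` {..<m} \<subseteq> {..<n} \<and> d \<notin> Q \<and>
     (\<forall>j<m. W (p j) = v j) \<and>
     (\<forall>i<n. i \<notin> p ` {..<m} \<longrightarrow> W i = (\<lambda>k. if i = k then 1 else 0)) \<and>
     (\<forall>i<n. \<forall>k<n. (\<Sum>l<n. W i l * L l k) = (if i = k then d else 0)) \<and>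
     (\<forall>i<n. \<forall>k<n. (\<Sum>l<n. L i l * W l k) = (if i = k then d else 0))"
  using indep
proof (induction m)
  case 0
  show ?case
    by (rule exI[of _ "\<lambda>_. 0"], rule exI[of _ "\<lambda>i k. if i = k then 1 else 0"],
        rule exI[of _ "\<lambda>i k. if i = k then 1 else 0"], rule exI[of _ 1])
      (use Q(2) in \<open>auto simp: if_distrib[of "\<lambda>x. x * _"] cong: if_cong\<close>)
next
  case (Suc m)
  have "\<forall>r. (\<forall>k<n. (\<Sum>j<m. r j * v j k) \<in> Q) \<longrightarrow> (\<forall>j<m. r j \<in> Q)"
  proof (intro allI impI)
    fix r j
    assume r: "\<forall>k<n. (\<Sum>j<m. r j * v j k) \<in> Q" and j: "j < m"
    have "(\<Sum>j<Suc m. (r(m := 0)) j * v j k) = (\<Sum>j<m. r j * v j k)" for k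
      by simp
    with r have "\<forall>k<n. (\<Sum>j<Suc m. (r(m := 0)) j * v j k) \<in> Q"
      by (simp del: fun_upd_apply sum.lessThan_Suc)
    with Suc.prems have "\<forall>j<Suc m. (r(m := 0)) j \<in> Q" by blast
    then have "(r(m := 0)) j \<in> Q" using j less_SucI by blast
    then show "r j \<in> Q" using j by simp
  qed
  from Suc.IH[OF this] obtain p W L d where p: "inj_on p {..<m}" "p ` {..<m} \<subseteq> {..<n}"
    and d: "d \<notin> Q" and Wp: "\<forall>j<m. W (p j) = v j"
    and We: "\<forall>i<n. i \<notin> p ` {..<m} \<longrightarrow> W i = (\<lambda>k. if i = k then 1 else 0)"
    and WL': "\<forall>i<n. \<forall>k<n. (\<Sum>l<n. W i l * L l k) = (if i = k then d else 0)"
    and LW': "\<forall>i<n. \<forall>k<n. (\<Sum>l<n. L i l * W l k) = (if i = k then d else 0)"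
    by (elim exE conjE) (rule that)
  note WL = WL'[rule_format] and LW = LW'[rule_format]
  \<comment> \<open>The coordinates of \<open>d\<close> times the new row with respect to the rows
    of \<open>W\<close>.\<close>
  define c where "c l = (\<Sum>a<n. v m a * L a l)" for l
  have cW: "(\<Sum>l<n. c l * W l k) = d * v m k" if k: "k < n" for k
  proof -
    have "(\<Sum>l<n. c l * W l k) = (\<Sum>l<n. \<Sum>a<n. v m a * L a l * W l k)"
      by (simp add: c_def sum_distrib_right)
    also have "\<dots> = (\<Sum>a<n. \<Sum>l<n. v m a * L a l * W l k)" by (rule sum.swap)
    also have "\<dots> = (\<Sum>a<n. v m a * (\<Sum>l<n. L a l * W l k))"
      by (simp add: sum_distrib_left mult.assoc)
    also have "\<dots> = (\<Sum>a<n. v m a * (if a = k then d else 0))"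
      by (intro sum.cong refl) (simp add: LW k)
    also have "\<dots> = d * v m k" using k by (simp add: if_distrib mult.commute cong: if_cong)
    finally show ?thesis .
  qed
  have "\<exists>i<n. i \<notin> p ` {..<m} \<and> c i \<notin> Q"
  proof (rule ccontr)
    assume neg: "\<not> ?thesis"
    \<comment> \<open>If all coordinates at the remaining unit rows lay in \<open>Q\<close>, then
      \<open>d * v m\<close> would be a combination of the earlier rows modulo \<open>Q\<close>;
      independence would force its coefficient \<open>d\<close> into \<open>Q\<close>.\<close>
    define r where "r = (\<lambda>j. if j = m then d else - c (p j))"
    have "(\<Sum>j<Suc m. r j * v j k) \<in> Q" if k: "k < n" for k
    proof -
      have "(\<Sum>j<m. r j * v j k) = - (\<Sum>j<m. c (p j) * W (p j) k)"
        by (simp add: r_def Wp sum_negf)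
      also have "\<dots> = - (\<Sum>l\<in>p ` {..<m}. c l * W l k)"
        by (simp add: sum.reindex[OF p(1)])
      finally have "(\<Sum>j<Suc m. r j * v j k) =
          (\<Sum>l<n. c l * W l k) - (\<Sum>l\<in>p ` {..<m}. c l * W l k)"
        by (simp add: r_def cW k)
      also have "\<dots> = (\<Sum>l\<in>{..<n} - p ` {..<m}. c l * W l k)"
        using p(2) by (simp add: sum_diff)
      also have "\<dots> \<in> Q"
      proof (rule ri.subspace_sum[OF Q(1)])
        fix l assume "l \<in> {..<n} - p ` {..<m}"
        then have "c l \<in> Q" using neg by auto
        then show "c l * W l k \<in> Q"
          using ri.subspace_scale[OF Q(1), of "c l" "W l k"] by (simp add: mult.commute)
      qed
      finally show ?thesis .
    qed
    with Suc.prems have "r m \<in> Q" by blast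
    then show False using d by (simp add: r_def)
  qed
  then obtain i where i: "i < n" "i \<notin> p ` {..<m}" "c i \<notin> Q" by auto
  define p' where "p' = p(m := i)"
  define W' where "W' = W(i := v m)"
  \<comment> \<open>\<open>c\<close> is the new row times \<open>L\<close>, so subtracting multiples
    of column \<open>i\<close> clears the product outside \<open>i\<close>. The factors
    \<open>c i\<close> and \<open>d\<close> make all diagonal entries equal to
    \<open>d * c i\<close>.\<close>
  define L' where "L' = (\<lambda>a l. if l = i then d * L a i else c i * L a l - c l * L a i)"
  have im: "p' ` {..<Suc m} = insert i (p ` {..<m})"
    by (auto simp: p'_def lessThan_Suc)
  have "inj_on p' {..<Suc m}"
    using p(1) i(2) by (auto simp: p'_def lessThan_Suc inj_on_def)
  moreover have "p' ` {..<Suc m} \<subseteq> {..<n}" using im i(1) p(2) by simp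
  moreover have "d * c i \<notin> Q" using Q(3) d i(3) by blast
  moreover have "\<forall>j<Suc m. W' (p' j) = v j"
    using Wp i(2) by (auto simp: less_Suc_eq p'_def W'_def)
  moreover have "\<forall>l<n. l \<notin> p' ` {..<Suc m} \<longrightarrow> W' l = (\<lambda>k. if l = k then 1 else 0)"
    using We by (simp add: im W'_def)
  moreover have "(\<Sum>l<n. W' a l * L' l k) = (if a = k then d * c i else 0)"
    if a: "a < n" and k: "k < n" for a k
  proof -
    have W'L: "(\<Sum>l<n. W' a l * L l b) = (if a = i then c b else if a = b then d else 0)"
      if "b < n" for b
      using WL[OF a that] by (simp add: W'_def c_def)
    show ?thesis
    proof (cases "k = i")
      case True
      then have "(\<Sum>l<n. W' a l * L' l k) = d * (\<Sum>l<n. W' a l * L l i)"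
        by (simp add: L'_def sum_distrib_left ac_simps)
      then show ?thesis using W'L[OF i(1)] True by (simp add: mult.commute)
    next
      case False
      then have "(\<Sum>l<n. W' a l * L' l k) =
          c i * (\<Sum>l<n. W' a l * L l k) - c k * (\<Sum>l<n. W' a l * L l i)"
        by (simp add: L'_def sum_distrib_left ac_simps right_diff_distrib sum_subtractf)
      then show ?thesis using W'L[OF i(1)] W'L[OF k] False by (simp add: mult.commute)
    qed
  qed
  \<comment> \<open>The product in the other order needs its own computation, since \<open>d\<close>
    may be a zero divisor.\<close>
  moreover have "(\<Sum>l<n. L' a l * W' l k) = (if a = k then d * c i else 0)"
    if a: "a < n" and k: "k < n" for a k
  proof -
    let ?R = "{..<n} - {i}"
    have split: "(\<Sum>l<n. f l) = f i + (\<Sum>l\<in>?R. f l)" for f :: "nat \<Rightarrow> 'a"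
      using i(1) by (simp add: sum.remove)
    have "(\<Sum>l<n. L' a l * W' l k) =
        d * L a i * v m k + (\<Sum>l\<in>?R. (c i * L a l - c l * L a i) * W l k)"
      by (simp add: split L'_def W'_def)
    also have "(\<Sum>l\<in>?R. (c i * L a l - c l * L a i) * W l k) =
        c i * (\<Sum>l\<in>?R. L a l * W l k) - L a i * (\<Sum>l\<in>?R. c l * W l k)"
      by (simp add: sum_distrib_left sum_subtractf algebra_simps)
    also have "(\<Sum>l\<in>?R. L a l * W l k) = (\<Sum>l<n. L a l * W l k) - L a i * W i k"
      by (simp add: split)
    also have "(\<Sum>l\<in>?R. c l * W l k) = (\<Sum>l<n. c l * W l k) - c i * W i k"
      by (simp add: split)
    finally show ?thesis using LW[OF a k] cW[OF k] by (simp add: algebra_simps)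
  qed
  ultimately show ?case
    by (intro exI[of _ p'] exI[of _ W'] exI[of _ L'] exI[of _ "d * c i"] conjI) simp_all
qed

section \<open>Hilbert's basis theorem\<close>

text \<open>Hilbert's theorem is developed for subsets of one ring, so that the rings
  \<open>polys_in n\<close> are nested inside one type and induction on \<open>n\<close> makes
  sense.\<close>

definition subring :: "'a::comm_ring_1 set \<Rightarrow> bool" where
  "subring S \<longleftrightarrow> 1 \<in> S \<and> (\<forall>a\<in>S. \<forall>b\<in>S. a + b \<in> S \<and> a * b \<in> S) \<and> (\<forall>a\<in>S. - a \<in> S)"

lemma subringD:
  assumes "subring S"
  shows "1 \<in> S" "0 \<in> S" "a \<in> S \<Longrightarrow> b \<in> S \<Longrightarrow> a + b \<in> S" "a \<in> S \<Longrightarrow> b \<in> S \<Longrightarrow> a * b \<in> S"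
    "a \<in> S \<Longrightarrow> - a \<in> S" "a \<in> S \<Longrightarrow> a ^ n \<in> S"
proof -
  show *: "1 \<in> S" "a \<in> S \<Longrightarrow> b \<in> S \<Longrightarrow> a + b \<in> S" "a \<in> S \<Longrightarrow> b \<in> S \<Longrightarrow> a * b \<in> S"
    "a \<in> S \<Longrightarrow> - a \<in> S" for a b
    using assms by (auto simp: subring_def)
  show "0 \<in> S" using *(2)[OF *(1) *(4)[OF *(1)]] by simp
  show "a ^ n \<in> S" if "a \<in> S" by (induction n) (use * that in auto)
qed

definition ideal_of :: "'a::comm_ring_1 set \<Rightarrow> 'a set \<Rightarrow> bool" where
  "ideal_of S K \<longleftrightarrow> K \<subseteq> S \<and> 0 \<in> K \<and> (\<forall>a\<in>K. \<forall>b\<in>K. a + b \<in> K) \<and> (\<forall>s\<in>S. \<forall>a\<in>K. s * a \<in> K)"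

text \<open>\<open>ri.span\<close> would allow coefficients from the whole ring; here they must come
  from \<open>S\<close>.\<close>

inductive_set lcomb :: "'a::comm_ring_1 set \<Rightarrow> 'a set \<Rightarrow> 'a set" for S G where
  zero: "0 \<in> lcomb S G"
| step: "s \<in> S \<Longrightarrow> g \<in> G \<Longrightarrow> h \<in> lcomb S G \<Longrightarrow> s * g + h \<in> lcomb S G"

lemma lcomb_add: "a \<in> lcomb S G \<Longrightarrow> b \<in> lcomb S G \<Longrightarrow> a + b \<in> lcomb S G"
  by (induction rule: lcomb.induct) (auto simp: add.assoc intro: lcomb.step)

lemma lcomb_scale: "a \<in> lcomb S G \<Longrightarrow> subring S \<Longrightarrow> s \<in> S \<Longrightarrow> s * a \<in> lcomb S G"
  by (induction rule: lcomb.induct)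
    (auto simp: distrib_left simp flip: mult.assoc intro!: lcomb.intros subringD(4))

lemma lcomb_subset: "a \<in> lcomb S G \<Longrightarrow> ideal_of S K \<Longrightarrow> G \<subseteq> K \<Longrightarrow> a \<in> K"
  by (induction rule: lcomb.induct) (auto simp: ideal_of_def)

definition noetherian :: "'a::comm_ring_1 set \<Rightarrow> bool" where
  "noetherian S \<longleftrightarrow> (\<forall>K. ideal_of S K \<longrightarrow> (\<exists>G. finite G \<and> G \<subseteq> K \<and> K \<subseteq> lcomb S G))"

text \<open>Polynomial expressions in \<open>x\<close> of degree below \<open>d\<close>. An element
  can have several such expressions, because \<open>x\<close> may satisfy relations over
  \<open>S\<close>.\<close>

primrec poly_below :: "'a::comm_ring_1 set \<Rightarrow> 'a \<Rightarrow> nat \<Rightarrow> 'a set" where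
  "poly_below S x 0 = {0}"
| "poly_below S x (Suc d) = {p + s * x ^ d | p s. p \<in> poly_below S x d \<and> s \<in> S}"

lemma poly_below_SucI:
  "p \<in> poly_below S x d \<Longrightarrow> s \<in> S \<Longrightarrow> q = p + s * x ^ d \<Longrightarrow> q \<in> poly_below S x (Suc d)"
  by auto

lemma poly_below_closed:
  assumes S: "subring S"
  shows "p \<in> poly_below S x d \<Longrightarrow> q \<in> poly_below S x d \<Longrightarrow> p + q \<in> poly_below S x d"
    and "s \<in> S \<Longrightarrow> p \<in> poly_below S x d \<Longrightarrow> s * p \<in> poly_below S x d"
    and "p \<in> poly_below S x d \<Longrightarrow> x * p \<in> poly_below S x (Suc d)"
    and "0 \<in> poly_below S x d"
proof -
  show *: "0 \<in> poly_below S x d" for d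
    by (induction d) (use subringD(2)[OF S] in force)+
  show "p + q \<in> poly_below S x d" if "p \<in> poly_below S x d" "q \<in> poly_below S x d"
    using that
  proof (induction d arbitrary: p q)
    case (Suc d)
    then obtain a s b t where ab: "p = a + s * x ^ d" "q = b + t * x ^ d" "s \<in> S" "t \<in> S"
      "a \<in> poly_below S x d" "b \<in> poly_below S x d" by auto
    then have "p + q = (a + b) + (s + t) * x ^ d" by (simp add: algebra_simps)
    then show ?case by (intro poly_below_SucI[OF Suc.IH[OF ab(5,6)] subringD(3)[OF S ab(3,4)]])
  qed simp
  show "s * p \<in> poly_below S x d" if "s \<in> S" "p \<in> poly_below S x d"
    using that(2)
  proof (induction d arbitrary: p)
    case (Suc d)
    then obtain a t where at: "p = a + t * x ^ d" "t \<in> S" "a \<in> poly_below S x d" by auto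
    then have "s * p = s * a + (s * t) * x ^ d" by (simp add: algebra_simps)
    then show ?case
      by (intro poly_below_SucI[OF Suc.IH[OF at(3)] subringD(4)[OF S that(1) at(2)]])
  qed simp
  show "x * p \<in> poly_below S x (Suc d)" if "p \<in> poly_below S x d"
    using that
  proof (induction d arbitrary: p)
    case 0
    then show ?case using *[of 1] by simp
  next
    case (Suc d)
    then obtain a t where at: "p = a + t * x ^ d" "t \<in> S" "a \<in> poly_below S x d" by auto
    then have "x * p = x * a + t * x ^ Suc d" by (simp add: algebra_simps)
    then show ?case by (intro poly_below_SucI[OF Suc.IH[OF at(3)] at(2)])
  qed
qed

lemma poly_below_mono:
  assumes S: "subring S" and "d \<le> e"
  shows "poly_below S x d \<subseteq> poly_below S x e"
  using assms(2)
proof (induction rule: dec_induct)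
  case (step e)
  have "p = p + 0 * x ^ e" for p by simp
  then have "poly_below S x e \<subseteq> poly_below S x (Suc e)"
    using subringD(2)[OF S] unfolding poly_below.simps by blast
  with step.IH show ?case by blast
qed simp

lemma noetherian_poly:
  assumes S: "subring S" "noetherian S"
    and P: "subring P" "S \<subseteq> P" "x \<in> P" "P \<subseteq> (\<Union>d. poly_below S x d)"
  shows "noetherian P"
  unfolding noetherian_def
proof (intro allI impI)
  fix K assume K: "ideal_of P K"
  note KD = K[unfolded ideal_of_def]
  note low = poly_below_closed[OF S(1)]
  \<comment> \<open>All coefficients that can lead, at \<open>x ^ d\<close>, some expression of an
    element of \<open>K\<close>. Multiplication by \<open>x\<close> makes these ideals increase with
    \<open>d\<close>.\<close>
  define L where "L d = {s\<in>S. \<exists>p\<in>poly_below S x d. p + s * x ^ d \<in> K}" for d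
  have L: "ideal_of S (L d)" for d
    unfolding ideal_of_def
  proof (intro conjI ballI)
    show "L d \<subseteq> S" by (auto simp: L_def)
    show "0 \<in> L d" using low(4) KD subringD[OF S(1)] by (auto simp: L_def intro: bexI[of _ 0])
    fix a assume "a \<in> L d"
    then obtain p where p: "a \<in> S" "p \<in> poly_below S x d" "p + a * x ^ d \<in> K"
      by (auto simp: L_def)
    show "a + b \<in> L d" if "b \<in> L d" for b
    proof -
      from that obtain q where q: "b \<in> S" "q \<in> poly_below S x d" "q + b * x ^ d \<in> K"
        by (auto simp: L_def)
      have "(p + q) + (a + b) * x ^ d = (p + a * x ^ d) + (q + b * x ^ d)"
        by (simp add: algebra_simps)
      also have "\<dots> \<in> K" using KD p q by blast
      finally show ?thesis using low(1)[OF p(2) q(2)] subringD(3)[OF S(1) p(1) q(1)]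
        by (auto simp: L_def)
    qed
    show "s * a \<in> L d" if s: "s \<in> S" for s
    proof -
      have "s * p + (s * a) * x ^ d = s * (p + a * x ^ d)"
        by (simp add: algebra_simps)
      also have "\<dots> \<in> K" using KD p s P by blast
      finally show ?thesis using low(2)[OF s p(2)] subringD(4)[OF S(1) s p(1)]
        by (auto simp: L_def)
    qed
  qed
  have L_Suc: "L d \<subseteq> L (Suc d)" for d
  proof
    fix a assume "a \<in> L d"
    then obtain p where p: "a \<in> S" "p \<in> poly_below S x d" "p + a * x ^ d \<in> K"
      by (auto simp: L_def)
    have "x * p + a * x ^ Suc d = x * (p + a * x ^ d)" by (simp add: algebra_simps)
    also have "\<dots> \<in> K" using KD p P by blast
    finally show "a \<in> L (Suc d)" using low(3)[OF p(2)] p(1) by (auto simp: L_def)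
  qed
  have L_mono: "L d \<subseteq> L e" if "d \<le> e" for d e
    using L_Suc that by (rule lift_Suc_mono_le)
  have "ideal_of S (\<Union>d. L d)"
    unfolding ideal_of_def
  proof (intro conjI ballI)
    show "(\<Union>d. L d) \<subseteq> S" by (auto simp: L_def)
    show "0 \<in> (\<Union>d. L d)" using L[of 0] by (auto simp: ideal_of_def)
    fix a assume "a \<in> (\<Union>d. L d)"
    then obtain d where d: "a \<in> L d" by auto
    show "s * a \<in> (\<Union>d. L d)" if "s \<in> S" for s
      using L[of d, unfolded ideal_of_def] d that by blast
    show "a + b \<in> (\<Union>d. L d)" if b: "b \<in> (\<Union>d. L d)" for b
    proof -
      from b obtain e where "b \<in> L e" by auto
      then have "a \<in> L (max d e)" "b \<in> L (max d e)"
        using d L_mono[of d "max d e"] L_mono[of e "max d e"] by auto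
      then show ?thesis using L[of "max d e", unfolded ideal_of_def] by blast
    qed
  qed
  with S(2) obtain G0 where G0: "finite G0" "G0 \<subseteq> (\<Union>d. L d)" "(\<Union>d. L d) \<subseteq> lcomb S G0"
    unfolding noetherian_def by blast
  have "\<exists>D. G0 \<subseteq> L D"
    using G0(1,2)
  proof induction
    case (insert g G)
    then obtain D e where De: "G \<subseteq> L D" "g \<in> L e" by auto
    then have "insert g G \<subseteq> L (max D e)"
      using L_mono[of D "max D e"] L_mono[of e "max D e"] by auto
    then show ?case by blast
  qed simp
  then obtain D where D: "G0 \<subseteq> L D" by blast
  \<comment> \<open>From \<open>D\<close> on the ideals of leading coefficients no longer grow, so
    degrees up to \<open>D\<close> suffice.\<close>
  have LD: "L d \<subseteq> L (min d D)" for d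
  proof (cases "d \<le> D")
    case False
    have "L d \<subseteq> L D"
    proof
      fix a assume "a \<in> L d"
      then have "a \<in> lcomb S G0" using G0(3) by blast
      then show "a \<in> L D" using L D by (rule lcomb_subset)
    qed
    then show ?thesis using False by simp
  qed simp
  have "\<forall>d. \<exists>G. finite G \<and> G \<subseteq> L d \<and> L d \<subseteq> lcomb S G"
    using S(2) L unfolding noetherian_def by blast
  then obtain G where G: "\<And>d. finite (G d)" "\<And>d. G d \<subseteq> L d" "\<And>d. L d \<subseteq> lcomb S (G d)"
    by metis
  have "\<forall>d s. \<exists>k. s \<in> L d \<longrightarrow> k \<in> K \<and> (\<exists>p\<in>poly_below S x d. k = p + s * x ^ d)"
    by (auto simp: L_def)
  then obtain k where k: "\<And>d s. s \<in> L d \<Longrightarrow> k d s \<in> K"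
    "\<And>d s. s \<in> L d \<Longrightarrow> \<exists>p\<in>poly_below S x d. k d s = p + s * x ^ d"
    by metis
  \<comment> \<open>One element of \<open>K\<close> for each of the finitely many generators of
    \<open>L 0\<close>, ..., \<open>L D\<close>.\<close>
  define H where "H = (\<Union>d\<le>D. k d ` G d)"
  have HK: "H \<subseteq> K" using k(1) G(2) by (auto simp: H_def)
  have lead: "\<exists>p\<in>poly_below S x e. p + s * x ^ e \<in> lcomb P H"
    if e: "e \<le> D" and s: "s \<in> lcomb S (G e)" for e s
    using s
  proof (induction rule: lcomb.induct)
    case zero
    then show ?case using low(4) lcomb.zero by (auto intro!: bexI[of _ 0])
  next
    case (step t g h)
    then obtain p where p: "p \<in> poly_below S x e" "p + h * x ^ e \<in> lcomb P H" by blast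
    from step G(2) obtain q where q: "q \<in> poly_below S x e" "k e g = q + g * x ^ e"
      using k(2) by blast
    have "(t * q + p) + (t * g + h) * x ^ e = t * k e g + (p + h * x ^ e)"
      by (simp add: q algebra_simps)
    also have "\<dots> \<in> lcomb P H"
      using step.hyps P(2) e by (intro lcomb.step p(2)) (auto simp: H_def)
    finally show ?case using low(1)[OF low(2)[OF step.hyps(1) q(1)] p(1)] by blast
  qed
  have shift: "x ^ j * p \<in> poly_below S x (j + e)" if "p \<in> poly_below S x e" for j p e
    using that by (induction j) (simp_all add: mult.assoc low(3) del: poly_below.simps)
  have neg: "- p \<in> poly_below S x e" if "p \<in> poly_below S x e" for p e
    using low(2)[OF subringD(5)[OF S(1) subringD(1)[OF S(1)]] that] by simp
  \<comment> \<open>Descent on the degree: a combination of \<open>H\<close> with the same leading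
    coefficient is subtracted, after multiplication by the power \<open>x ^ j\<close> that makes up
    for the cut-off at \<open>D\<close>.\<close>
  have fP: "f \<in> lcomb P H" if "f \<in> K" "f \<in> poly_below S x d" for f d
    using that
  proof (induction d arbitrary: f)
    case 0
    then show ?case by (simp add: lcomb.zero)
  next
    case (Suc d)
    then obtain p s where f: "f = p + s * x ^ d" "p \<in> poly_below S x d" "s \<in> S" by auto
    with Suc.prems have "s \<in> L d" by (auto simp: L_def)
    then have "s \<in> lcomb S (G (min d D))" using LD G(3) by blast
    from lead[OF _ this] obtain q where q: "q \<in> poly_below S x (min d D)"
      "q + s * x ^ min d D \<in> lcomb P H" by auto
    define j where "j = d - min d D"
    have j: "j + min d D = d" by (simp add: j_def)
    have xj: "x ^ j \<in> P" by (rule subringD(6)[OF P(1) P(3)])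
    let ?y = "x ^ j * (q + s * x ^ min d D)"
    have y: "?y \<in> lcomb P H" by (rule lcomb_scale[OF q(2) P(1) xj])
    have "?y = x ^ j * q + s * x ^ (j + min d D)"
      by (simp add: algebra_simps power_add)
    then have fy: "f - ?y = p + - (x ^ j * q)" using f(1) j by simp
    have "f - ?y \<in> poly_below S x d"
      unfolding fy using shift[OF q(1), of j] j by (intro low(1) f(2) neg) simp
    moreover have "f - ?y \<in> K"
    proof -
      have "?y \<in> K" using y K HK by (rule lcomb_subset)
      moreover have "- 1 \<in> P" by (rule subringD(5)[OF P(1) subringD(1)[OF P(1)]])
      ultimately have "(- 1) * ?y \<in> K" using KD by blast
      then have "f + (- 1) * ?y \<in> K" using KD Suc.prems(1) by blast
      then show ?thesis by simp
    qed
    ultimately have "f - ?y \<in> lcomb P H" by (rule Suc.IH[rotated])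
    from lcomb_add[OF this y] show ?case by simp
  qed
  have "K \<subseteq> lcomb P H"
  proof
    fix f assume "f \<in> K"
    moreover from this KD P(4) obtain d where "f \<in> poly_below S x d" by fast
    ultimately show "f \<in> lcomb P H" by (rule fP)
  qed
  moreover have "finite H" by (simp add: H_def G(1))
  ultimately show "\<exists>G. finite G \<and> G \<subseteq> K \<and> K \<subseteq> lcomb P G" using HK by blast
qed

section \<open>Polynomial rings in finitely many variables are noetherian\<close>

lemma polys_in_intros:
  "1 \<in> polys_in n" "0 \<in> polys_in n" "Const c \<in> polys_in n"
  "p \<in> polys_in n \<Longrightarrow> q \<in> polys_in n \<Longrightarrow> p + q \<in> polys_in n"
  "p \<in> polys_in n \<Longrightarrow> q \<in> polys_in n \<Longrightarrow> p * q \<in> polys_in n"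
  "p \<in> polys_in n \<Longrightarrow> - p \<in> polys_in n"
  "p \<in> polys_in n \<Longrightarrow> q \<in> polys_in n \<Longrightarrow> p - q \<in> polys_in n"
  "i < n \<Longrightarrow> Var i \<in> polys_in n"
  "n \<le> n' \<Longrightarrow> p \<in> polys_in n \<Longrightarrow> p \<in> polys_in n'"
  for p q :: "'v::comm_ring_1 mpoly"
proof -
  show "Const c \<in> polys_in n" "i < n \<Longrightarrow> Var i \<in> polys_in n" "1 \<in> polys_in n" "0 \<in> polys_in n"
    "p \<in> polys_in n \<Longrightarrow> - p \<in> polys_in n"
    by (auto simp: polys_in_def in_keys_iff Var_def lookup_single when_def lookup_one split: if_splits)
  show add: "p + q \<in> polys_in n" if "p \<in> polys_in n" "q \<in> polys_in n" for p q
    using that keys_add[of p q] unfolding polys_in_def by blast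
  show "p - q \<in> polys_in n" if "p \<in> polys_in n" "q \<in> polys_in n"
    using add[of p "- q"] that by (auto simp: polys_in_def in_keys_iff)
  show "p * q \<in> polys_in n" if "p \<in> polys_in n" "q \<in> polys_in n"
  proof -
    have "Poly_Mapping.keys m \<subseteq> {..<n}" if m: "m \<in> Poly_Mapping.keys (p * q)" for m
    proof -
      from m keys_mult[of p q] obtain a b where ab: "m = a + b"
        "a \<in> Poly_Mapping.keys p" "b \<in> Poly_Mapping.keys q" by blast
      then have "Poly_Mapping.keys a \<subseteq> {..<n}" "Poly_Mapping.keys b \<subseteq> {..<n}"
        using \<open>p \<in> _\<close> \<open>q \<in> _\<close> by (auto simp: polys_in_def)
      then show ?thesis unfolding ab using keys_add[of a b] by blast
    qed
    then show ?thesis by (auto simp: polys_in_def)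
  qed
  show "n \<le> n' \<Longrightarrow> p \<in> polys_in n \<Longrightarrow> p \<in> polys_in n'"
    unfolding polys_in_def by fastforce
qed

lemma subring_polys_in: "subring (polys_in n :: 'v::comm_ring_1 mpoly set)"
  by (auto simp: subring_def intro: polys_in_intros)

lemma Var_power: "Var i ^ d = Poly_Mapping.single (Poly_Mapping.single i d) (1 :: 'v::comm_ring_1)"
  by (induction d) (simp_all add: Var_def mult_single flip: single_add)

text \<open>The constants inherit principal ideals from the valuation ring, and each further
  variable is one application of the basis theorem.\<close>

lemma noetherian_polys_in: "noetherian (polys_in n :: 'v::complete_dvr mpoly set)"
proof (induction n)
  case 0
  have const: "p = Const (Poly_Mapping.lookup p 0)" if "p \<in> polys_in 0" for p :: "'v mpoly"
  proof (rule poly_mapping_eqI)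
    fix m
    have "Poly_Mapping.lookup p m = 0" if "m \<noteq> 0"
      using that \<open>p \<in> _\<close> by (auto simp: polys_in_def simp flip: not_in_keys_iff_lookup_eq_zero)
    then show "Poly_Mapping.lookup p m = Poly_Mapping.lookup (Const (Poly_Mapping.lookup p 0)) m"
      by (cases "m = 0") (auto simp: lookup_single when_def)
  qed
  show ?case
    unfolding noetherian_def
  proof (intro allI impI)
    fix K :: "'v mpoly set" assume "ideal_of (polys_in 0) K"
    note K = this[unfolded ideal_of_def]
    have "ring_ideal {c. Const c \<in> K}"
      unfolding ring_ideal_def mem_Collect_eq
    proof (intro conjI ballI allI)
      show "Const 0 \<in> K" using K by simp
      show "Const (a + b) \<in> K" if "a \<in> {c. Const c \<in> K}" "b \<in> {c. Const c \<in> K}" for a b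
        using K that by (simp add: single_add)
      show "Const (a * b) \<in> K" if "b \<in> {c. Const c \<in> K}" for a b
      proof -
        have "Const a * Const b \<in> K" using K that polys_in_intros(3)[of a 0] by blast
        then show ?thesis by (simp add: mult_single)
      qed
    qed
    from ideal_principal[OF this] obtain x where x: "{c. Const c \<in> K} = {x * y |y. True}" by blast
    have "K \<subseteq> lcomb (polys_in 0) {Const x}"
    proof
      fix p assume p: "p \<in> K"
      then have c: "p = Const (Poly_Mapping.lookup p 0)" using K const by blast
      with p have "Poly_Mapping.lookup p 0 \<in> {c. Const c \<in> K}" by simp
      then obtain y where "Poly_Mapping.lookup p 0 = x * y" unfolding x by blast
      with c have "p = Const y * Const x + 0" by (simp add: mult_single mult.commute)
      also have "\<dots> \<in> lcomb (polys_in 0) {Const x}"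
        by (intro lcomb.intros polys_in_intros) simp
      finally show "p \<in> lcomb (polys_in 0) {Const x}" .
    qed
    moreover have "Const x \<in> K"
    proof -
      have "x * 1 \<in> {c. Const c \<in> K}" unfolding x by blast
      then show ?thesis by simp
    qed
    ultimately show "\<exists>G. finite G \<and> G \<subseteq> K \<and> K \<subseteq> lcomb (polys_in 0) G"
      by (intro exI[of _ "{Const x}"]) auto
  qed
next
  case (Suc n)
  let ?U = "\<Union>d. poly_below (polys_in n) (Var n) d :: 'v mpoly set"
  have "p \<in> ?U" if p: "p \<in> polys_in (Suc n)" for p
  proof -
    note low = poly_below_closed[OF subring_polys_in] and mono = poly_below_mono[OF subring_polys_in]
    have single: "Poly_Mapping.single m c \<in> ?U" if m: "Poly_Mapping.keys m \<subseteq> {..<Suc n}" for m c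
    proof -
      let ?d = "Poly_Mapping.lookup m n"
      \<comment> \<open>The power of the last variable is split off, which leaves a coefficient in
        the first \<open>n\<close> variables.\<close>
      define m' where "m' = m - Poly_Mapping.single n ?d"
      have m': "m' + Poly_Mapping.single n ?d = m"
        by (rule poly_mapping_eqI) (auto simp: m'_def lookup_add lookup_minus lookup_single when_def)
      have "Poly_Mapping.keys m' \<subseteq> {..<n}"
      proof
        fix i assume "i \<in> Poly_Mapping.keys m'"
        then have "i \<noteq> n" "i \<in> Poly_Mapping.keys m"
          by (auto simp: m'_def in_keys_iff lookup_minus lookup_single when_def split: if_splits)
        with m show "i \<in> {..<n}" by auto
      qed
      then have "Poly_Mapping.single m' c \<in> polys_in n" by (simp add: polys_in_def)
      then have "0 + Poly_Mapping.single m' c * Var n ^ ?d \<in> poly_below (polys_in n) (Var n) (Suc ?d)"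
        unfolding poly_below.simps using low(4) by blast
      also have "0 + Poly_Mapping.single m' c * Var n ^ ?d = Poly_Mapping.single m c"
        by (simp only: Var_power mult_single m') simp
      finally show ?thesis by blast
    qed
    have add: "f + g \<in> ?U" if "f \<in> ?U" "g \<in> ?U" for f g
    proof -
      from that obtain d e where "f \<in> poly_below (polys_in n) (Var n) d"
        "g \<in> poly_below (polys_in n) (Var n) e" by auto
      then have "f + g \<in> poly_below (polys_in n) (Var n) (max d e)"
        using mono[of d "max d e" n "Var n"] mono[of e "max d e" n "Var n"] by (intro low(1)) auto
      then show ?thesis by blast
    qed
    have "(\<Sum>m\<in>A. Poly_Mapping.single m (Poly_Mapping.lookup p m)) \<in> ?U"
      if "finite A" "A \<subseteq> Poly_Mapping.keys p" for A
      using that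
    proof induction
      case empty
      show ?case using low(4) by auto
    next
      case (insert m A)
      then show ?case using add single p by (simp add: polys_in_def)
    qed
    also have "(\<Sum>m\<in>Poly_Mapping.keys p. Poly_Mapping.single m (Poly_Mapping.lookup p m)) = p"
      by (rule poly_mapping_eqI) (auto simp: lookup_sum lookup_single when_def in_keys_iff)
    finally show ?thesis by simp
  qed
  then have "polys_in (Suc n) \<subseteq> ?U" by blast
  moreover have "(polys_in n :: 'v mpoly set) \<subseteq> polys_in (Suc n)"
    using polys_in_intros(9)[of n "Suc n"] by auto
  ultimately show ?case
    using polys_in_intros(8)[of n "Suc n"]
    by (intro noetherian_poly[OF subring_polys_in Suc.IH subring_polys_in]) auto
qed

section \<open>Congruences modulo ideals\<close>

definition eqmod :: "'a::comm_ring_1 set \<Rightarrow> 'a \<Rightarrow> 'a \<Rightarrow> bool" where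
  "eqmod I a b \<longleftrightarrow> a - b \<in> I"

lemma
  assumes I: "ri.subspace I"
  shows eqmod_refl: "eqmod I a a"
    and eqmod_sym: "eqmod I a b \<Longrightarrow> eqmod I b a"
    and eqmod_trans: "eqmod I a b \<Longrightarrow> eqmod I b c \<Longrightarrow> eqmod I a c"
    and eqmod_add: "eqmod I a b \<Longrightarrow> eqmod I a' b' \<Longrightarrow> eqmod I (a + a') (b + b')"
    and eqmod_diff: "eqmod I a b \<Longrightarrow> eqmod I a' b' \<Longrightarrow> eqmod I (a - a') (b - b')"
    and eqmod_mult: "eqmod I a b \<Longrightarrow> eqmod I a' b' \<Longrightarrow> eqmod I (a * a') (b * b')"
    and eqmod_sum: "(\<And>i. i \<in> A \<Longrightarrow> eqmod I (f i) (g i)) \<Longrightarrow> eqmod I (sum f A) (sum g A)"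
    and eqmod_mem: "eqmod I a b \<Longrightarrow> b \<in> I \<longleftrightarrow> a \<in> I"
proof -
  note add = ri.subspace_add[OF I] and scale = ri.subspace_scale[OF I]
    and neg = ri.subspace_neg[OF I]
  show refl: "eqmod I a a" for a by (simp add: eqmod_def ri.subspace_0[OF I])
  show sym: "eqmod I b a" if "eqmod I a b" for a b
    using neg[of "a - b"] that by (simp add: eqmod_def)
  show "eqmod I a c" if "eqmod I a b" "eqmod I b c"
    using add[of "a - b" "b - c"] that by (simp add: eqmod_def)
  show add': "eqmod I (a + a') (b + b')" if "eqmod I a b" "eqmod I a' b'" for a a' b b'
    using add[of "a - b" "a' - b'"] that by (simp add: eqmod_def algebra_simps)
  show "eqmod I (a - a') (b - b')" if "eqmod I a b" "eqmod I a' b'"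
    using add[of "a - b" "- (a' - b')"] neg[of "a' - b'"] that by (simp add: eqmod_def algebra_simps)
  show "eqmod I (a * a') (b * b')" if "eqmod I a b" "eqmod I a' b'"
    using add[of "a' * (a - b)" "b * (a' - b')"] scale[of "a - b" a'] scale[of "a' - b'" b] that
    by (simp add: eqmod_def algebra_simps)
  show "eqmod I (sum f A) (sum g A)" if "\<And>i. i \<in> A \<Longrightarrow> eqmod I (f i) (g i)"
    using that by (induction A rule: infinite_finite_induct) (simp_all add: refl add')
  show "b \<in> I \<longleftrightarrow> a \<in> I" if "eqmod I a b"
    using add[of "a - b" b] add[of "b - a" a] that sym[OF that] by (auto simp: eqmod_def)
qed

lemma (in ring_map) power: "h (a ^ d) = h a ^ d"
  by (induction d) (simp_all add: one mult)

lemma (in ring_map) monom_val: "h (monom_val y m) = monom_val (\<lambda>i. h (y i)) m"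
proof -
  have "h (\<Prod>i\<in>A. g i) = (\<Prod>i\<in>A. h (g i))" if "finite A" for A and g :: "'c \<Rightarrow> 'a"
    using that by induction (simp_all add: one mult)
  then show ?thesis by (simp add: monom_val_def power)
qed

lemma ring_map_eval_comp:
  assumes "ring_map f" "ring_map h"
  shows "h (alg_ext f (monom_val y) p) = alg_ext (\<lambda>v. h (f v)) (monom_val (\<lambda>i. h (y i))) p"
proof -
  interpret h: ring_map h by fact
  show ?thesis by (simp add: alg_ext_def h.sum h.mult h.monom_val)
qed

lemma ring_map_alg_ext_comp:
  assumes "ring_map f" "ring_map h"
  shows "h (alg_ext f u p) = alg_ext (\<lambda>v. h (f v)) (\<lambda>k. h (u k)) p"
proof -
  interpret h: ring_map h by fact
  show ?thesis by (simp add: alg_ext_def h.sum h.mult)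
qed

section \<open>The tensor square of an algebra\<close>

type_synonym ('v, 'r) tens = "('r mult_mon \<times> 'r mult_mon) \<Rightarrow>\<^sub>0 'v"

definition tn :: "'r \<Rightarrow> 'r \<Rightarrow> ('v::comm_ring_1, 'r::comm_monoid_mult) tens" where
  "tn a b = Poly_Mapping.single (to_mm a, to_mm b) 1"

definition br :: "'r \<Rightarrow> 'r mult_mon \<Rightarrow>\<^sub>0 'v::comm_ring_1" where
  "br a = Poly_Mapping.single (to_mm a) 1"

lemma tn_mult: "tn a b * tn c d = tn (a * c) (b * d)"
  by (simp add: tn_def mult_single to_mm_mult)

lemma tn_one: "tn 1 1 = 1"
  by (simp add: tn_def flip: zero_prod_def)

lemma br_mult: "br a * br b = br (a * b)"
  by (simp add: br_def mult_single to_mm_mult)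

lemma br_one: "br 1 = 1"
  by (simp add: br_def)

lemma monom_val_tn:
  fixes x :: "'a \<Rightarrow> 'b::comm_monoid_mult"
  shows "monom_val (\<lambda>i. tn (x i) 1) m = (tn (monom_val x m) 1 :: ('v::comm_ring_1, _) tens)"
  "monom_val (\<lambda>i. tn 1 (x i)) m = (tn 1 (monom_val x m) :: ('v::comm_ring_1, _) tens)"
proof -
  have "tn a 1 ^ k = (tn (a ^ k) 1 :: ('v, 'b) tens)" "tn 1 a ^ k = (tn 1 (a ^ k) :: ('v, 'b) tens)"
    for a k by (induction k) (simp_all add: tn_one tn_mult)
  moreover have "(\<Prod>i\<in>A. tn (g i) 1) = (tn (\<Prod>i\<in>A. g i) 1 :: ('v, 'b) tens)"
    "(\<Prod>i\<in>A. tn 1 (g i)) = (tn 1 (\<Prod>i\<in>A. g i) :: ('v, 'b) tens)"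
    if "finite A" for A and g :: "'a \<Rightarrow> 'b"
    using that by (induction; simp add: tn_one tn_mult)+
  ultimately show "monom_val (\<lambda>i. tn (x i) 1) m = (tn (monom_val x m) 1 :: ('v, _) tens)"
    "monom_val (\<lambda>i. tn 1 (x i)) m = (tn 1 (monom_val x m) :: ('v, _) tens)"
    by (simp_all add: monom_val_def)
qed

lemma single_eq_tn: "Poly_Mapping.single k c = Const c * tn (of_mm (fst k)) (of_mm (snd k))"
  by (simp add: tn_def mult_single)

text \<open>The universal derivation of R into the tensor square; its values generate the diagonal
  ideal.\<close>

definition Delta :: "'r \<Rightarrow> ('v::comm_ring_1, 'r::comm_monoid_mult) tens" where
  "Delta a = tn 1 a - tn a 1"

text \<open>An equality and not just a congruence, because only products of pure tensors are
  involved.\<close>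

lemma Delta_mult: "Delta (a * b) = tn a 1 * Delta b + tn 1 b * Delta a"
  by (simp add: Delta_def right_diff_distrib tn_mult mult.commute)

context comm_algebra
begin

text \<open>Bilinearity alone has to be imposed: pure tensors are already multiplied correctly in
  the monoid algebra.\<close>

definition tensor_rel :: "('v, 'r) tens set" where
  "tensor_rel = {tn (a + b) c - tn a c - tn b c | a b c. True} \<union>
     {tn a (b + c) - tn a b - tn a c | a b c. True} \<union>
     {tn (v *s a) b - Const v * tn a b | v a b. True} \<union>
     {tn a (v *s b) - Const v * tn a b | v a b. True}"

definition tensor_null :: "('v, 'r) tens set" where
  "tensor_null = ri.span tensor_rel"

abbreviation eqt :: "('v, 'r) tens \<Rightarrow> ('v, 'r) tens \<Rightarrow> bool" (infix \<open>\<simeq>\<close> 50) where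
  "a \<simeq> b \<equiv> eqmod tensor_null a b"

lemma tensor_null_ideal: "ri.subspace tensor_null"
  by (simp add: tensor_null_def)

lemmas eqt_refl [simp] = eqmod_refl[OF tensor_null_ideal]
  and eqt_sym = eqmod_sym[OF tensor_null_ideal]
  and eqt_trans [trans] = eqmod_trans[OF tensor_null_ideal]
  and eqt_add = eqmod_add[OF tensor_null_ideal]
  and eqt_diff = eqmod_diff[OF tensor_null_ideal]
  and eqt_mult = eqmod_mult[OF tensor_null_ideal]
  and eqt_sum = eqmod_sum[OF tensor_null_ideal]
  and eqt_mem = eqmod_mem[OF tensor_null_ideal]

lemma tn_linear:
  "tn (a + b) c \<simeq> tn a c + tn b c" "tn a (b + c) \<simeq> tn a b + tn a c"
  "tn (v *s a) b \<simeq> Const v * tn a b" "tn a (v *s b) \<simeq> Const v * tn a b"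
proof -
  have "tn (a + b) c - tn a c - tn b c \<in> tensor_rel" "tn a (b + c) - tn a b - tn a c \<in> tensor_rel"
    "tn (v *s a) b - Const v * tn a b \<in> tensor_rel" "tn a (v *s b) - Const v * tn a b \<in> tensor_rel"
    unfolding tensor_rel_def by blast+
  then show "tn (a + b) c \<simeq> tn a c + tn b c" "tn a (b + c) \<simeq> tn a b + tn a c"
    "tn (v *s a) b \<simeq> Const v * tn a b" "tn a (v *s b) \<simeq> Const v * tn a b"
    unfolding eqmod_def tensor_null_def by (simp_all add: ri.span_base diff_diff_eq)
qed

lemma tn_zero: "tn 0 b \<simeq> 0" "tn b 0 \<simeq> 0"
  using tn_linear(3)[of 0 0 b] tn_linear(4)[of b 0 0] by simp_all

lemma tensor_rel_tn:
  assumes "r \<in> tensor_rel"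
  shows "tn a b * r \<in> tensor_rel"
proof -
  have tn_rel: "tn (c + d) e - tn c e - tn d e \<in> tensor_rel" "tn c (d + e) - tn c d - tn c e \<in> tensor_rel"
    "tn (v *s c) d - Const v * tn c d \<in> tensor_rel" "tn c (v *s d) - Const v * tn c d \<in> tensor_rel"
    for c d e v
    unfolding tensor_rel_def by blast+
  have eqs: "tn a b * (tn (c + d) e - tn c e - tn d e) =
      tn (a * c + a * d) (b * e) - tn (a * c) (b * e) - tn (a * d) (b * e)"
    "tn a b * (tn c (d + e) - tn c d - tn c e) =
      tn (a * c) (b * d + b * e) - tn (a * c) (b * d) - tn (a * c) (b * e)"
    "tn a b * (tn (v *s c) d - Const v * tn c d) =
      tn (v *s (a * c)) (b * d) - Const v * tn (a * c) (b * d)"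
    "tn a b * (tn c (v *s d) - Const v * tn c d) =
      tn (a * c) (v *s (b * d)) - Const v * tn (a * c) (b * d)"
    for c d e v
    by (simp_all add: right_diff_distrib tn_mult distrib_left mult_scale
        mult.left_commute[of "tn a b" "Const v"])
  from assms consider c d e where "r = tn (c + d) e - tn c e - tn d e"
    | c d e where "r = tn c (d + e) - tn c d - tn c e"
    | v c d where "r = tn (v *s c) d - Const v * tn c d"
    | v c d where "r = tn c (v *s d) - Const v * tn c d"
    unfolding tensor_rel_def by (elim UnE CollectE exE conjE) (erule that)+
  then show ?thesis by cases (simp_all only: eqs tn_rel)
qed

text \<open>It suffices to take the \<open>'v\<close>-span of the relations, since they are stable under
  multiplication by pure tensors.\<close>

lemma tensor_null_induct [consumes 1, case_names zero add rel]:
  assumes "f \<in> tensor_null" and "P 0" and "\<And>f g. P f \<Longrightarrow> P g \<Longrightarrow> P (f + g)"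
    and rel: "\<And>v r. r \<in> tensor_rel \<Longrightarrow> P (Const v * r)"
  shows "P f"
proof -
  have mult: "P (c * r)" if "r \<in> tensor_rel" for c r
  proof (induction c rule: poly_mapping_add_induct)
    case (single k c)
    show ?case
      using rel[OF tensor_rel_tn[OF that]] by (subst single_eq_tn) (simp only: mult.assoc)
  qed (simp_all add: assms distrib_right)
  from assms(1) show ?thesis
    unfolding tensor_null_def
    by (induction rule: ri.span_induct_alt) (use assms(2,3) mult in auto)
qed

definition sc :: "'v \<Rightarrow> 'r" where "sc v = v *s 1"

lemma sc_mult: "sc v * a = v *s a"
  by (simp add: sc_def scale_mult)

lemma ring_map_sc: "ring_map sc"
  by standard (simp_all add: sc_def scale_left_distrib scale_mult)

lemma peval_eq: "peval x p = alg_ext sc (monom_val x) p"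
  by (simp add: peval_def alg_ext_def monom_val_def sc_mult)

lemma ring_map_peval: "ring_map (peval x)"
  unfolding peval_eq by (rule ring_map_eval[OF ring_map_sc])

definition mu :: "('v, 'r) tens \<Rightarrow> 'r" where
  "mu = alg_ext sc (\<lambda>k. of_mm (fst k) * of_mm (snd k))"

lemma ring_map_mu: "ring_map mu"
  unfolding mu_def by (rule ring_map_alg_ext[OF ring_map_sc]) (simp_all add: ac_simps)

sublocale mu: ring_map mu by (rule ring_map_mu)

lemma mu_tn [simp]: "mu (tn a b) = a * b"
  by (simp add: mu_def tn_def alg_ext_single[OF ring_map_sc] sc_mult)

lemma mu_Const [simp]: "mu (Const v) = sc v"
  by (simp add: mu_def alg_ext_single[OF ring_map_sc])

lemma mu_Delta [simp]: "mu (Delta a) = 0"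
  by (simp add: Delta_def mu.diff)

text \<open>The canonical map from the monoid algebra onto R. Its kernel is what separates
  coefficients in the monoid algebra from coefficients in R.\<close>

definition ka :: "('r mult_mon \<Rightarrow>\<^sub>0 'v) \<Rightarrow> 'r" where
  "ka = alg_ext sc of_mm"

lemma ring_map_ka: "ring_map ka"
  unfolding ka_def by (rule ring_map_alg_ext[OF ring_map_sc]) simp_all

sublocale ka: ring_map ka by (rule ring_map_ka)

lemma ka_br [simp]: "ka (br a) = a"
  by (simp add: ka_def br_def alg_ext_single[OF ring_map_sc] sc_mult)

lemma ka_Const [simp]: "ka (Const v) = sc v"
  by (simp add: ka_def alg_ext_single[OF ring_map_sc])

text \<open>The inclusion of R as left tensor factor, lifted to the monoid algebras, where it is a
  ring map without any congruence.\<close>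

definition emb :: "('r mult_mon \<Rightarrow>\<^sub>0 'v) \<Rightarrow> ('v, 'r) tens" where
  "emb = alg_ext Const (\<lambda>k. Poly_Mapping.single (k, 0) 1)"

lemma ring_map_emb: "ring_map emb"
  unfolding emb_def
  by (rule ring_map_alg_ext[OF ring_map_Const]) (simp_all add: mult_single flip: zero_prod_def)

sublocale emb: ring_map emb by (rule ring_map_emb)

lemma emb_br [simp]: "emb (br a) = tn a 1"
  by (simp add: emb_def br_def tn_def alg_ext_single[OF ring_map_Const])

lemma emb_Const [simp]: "emb (Const v) = Const v"
  by (simp add: emb_def alg_ext_single[OF ring_map_Const] mult_single flip: zero_prod_def)

lemma emb_ka: "emb q \<simeq> tn (ka q) 1"
proof (induction q rule: poly_mapping_add_induct)
  case zero
  show ?case using eqt_sym[OF tn_zero(1)] by (simp add: emb.zero ka.zero)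
next
  case (single k c)
  have "Poly_Mapping.single k c = Const c * br (of_mm k)"
    by (simp add: br_def mult_single)
  then show ?case
    using eqt_sym[OF tn_linear(3)[of c "of_mm k" 1]] by (simp add: emb.mult ka.mult sc_mult)
next
  case (add f g)
  then show ?case
    using eqt_trans[OF eqt_add[OF add] eqt_sym[OF tn_linear(1)]] by (simp add: emb.add ka.add)
qed

lemma mu_emb: "mu (emb q) = ka q"
  unfolding emb_def ring_map_alg_ext_comp[OF ring_map_Const ring_map_mu]
  by (simp add: ka_def mu_def alg_ext_single[OF ring_map_sc] sc_mult)

lemma eval_tn:
  "alg_ext Const (monom_val (\<lambda>i. tn (x i) 1)) p \<simeq> tn (peval x p) 1"
  "alg_ext Const (monom_val (\<lambda>i. tn 1 (x i))) p \<simeq> tn 1 (peval x p)"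
proof -
  interpret l: ring_map "alg_ext Const (monom_val (\<lambda>i. tn (x i) 1)) :: 'v mpoly \<Rightarrow> ('v, 'r) tens"
    by (rule ring_map_eval[OF ring_map_Const])
  interpret r: ring_map "alg_ext Const (monom_val (\<lambda>i. tn 1 (x i))) :: 'v mpoly \<Rightarrow> ('v, 'r) tens"
    by (rule ring_map_eval[OF ring_map_Const])
  interpret p: ring_map "peval x" by (rule ring_map_peval)
  have peval_single: "peval x (Poly_Mapping.single m c) = c *s monom_val x m" for m c
    by (simp add: peval_eq alg_ext_single[OF ring_map_sc] sc_mult)
  show "alg_ext Const (monom_val (\<lambda>i. tn (x i) 1)) p \<simeq> tn (peval x p) 1"
  proof (induction p rule: poly_mapping_add_induct)
    case zero
    show ?case using eqt_sym[OF tn_zero(1)] by (simp add: l.zero p.zero)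
  next
    case (single m c)
    show ?case
      using eqt_sym[OF tn_linear(3)[of c "monom_val x m" 1]]
      by (simp add: alg_ext_single[OF ring_map_Const] monom_val_tn peval_single)
  next
    case (add f g)
    then show ?case
      using eqt_trans[OF eqt_add[OF add] eqt_sym[OF tn_linear(1)]] by (simp add: l.add p.add)
  qed
  show "alg_ext Const (monom_val (\<lambda>i. tn 1 (x i))) p \<simeq> tn 1 (peval x p)"
  proof (induction p rule: poly_mapping_add_induct)
    case zero
    show ?case using eqt_sym[OF tn_zero(2)] by (simp add: r.zero p.zero)
  next
    case (single m c)
    show ?case
      using eqt_sym[OF tn_linear(4)[of 1 c "monom_val x m"]]
      by (simp add: alg_ext_single[OF ring_map_Const] monom_val_tn peval_single)
  next
    case (add f g)
    then show ?case
      using eqt_trans[OF eqt_add[OF add] eqt_sym[OF tn_linear(2)]] by (simp add: r.add p.add)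
  qed
qed

end

section \<open>Relations between the variables of a polynomial ring\<close>

text \<open>Subtraction of exponents is truncated, so \<open>l - m + m = l\<close> says that the
  monomial \<open>m\<close> divides \<open>l\<close>.\<close>

lemma lookup_single_mult:
  fixes f :: "('x \<Rightarrow>\<^sub>0 nat) \<Rightarrow>\<^sub>0 'a::comm_ring_1"
  shows "Poly_Mapping.lookup (Poly_Mapping.single m c * f) l =
    (if l - m + m = l then c * Poly_Mapping.lookup f (l - m) else 0)"
proof (induction f rule: poly_mapping_add_induct)
  case (single k d)
  have "m + k = l \<longleftrightarrow> l - m + m = l \<and> k = l - m"
    by (metis add.commute add_diff_cancel_left')
  then show ?case by (auto simp: mult_single lookup_single when_def)
qed (simp_all add: lookup_add distrib_left)

lemma lookup_Var_mult:
  "Poly_Mapping.lookup (Var i * f) m =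
    (if Poly_Mapping.lookup m i = 0 then 0
     else Poly_Mapping.lookup f (m - Poly_Mapping.single i 1))"
proof -
  have "m - Poly_Mapping.single i 1 + Poly_Mapping.single i 1 = m \<longleftrightarrow> Poly_Mapping.lookup m i \<noteq> 0"
    by (auto simp: poly_mapping_eq_iff fun_eq_iff lookup_add lookup_minus lookup_single when_def
        split: if_splits dest: spec[of _ i])
  then show ?thesis by (simp add: Var_def lookup_single_mult del: One_nat_def)
qed

text \<open>Over the image of \<open>h\<close>, this is the ideal generated by the first \<open>n\<close> variables.\<close>

definition vars_null :: "('q::comm_ring_1 \<Rightarrow> 'r::zero) \<Rightarrow> nat \<Rightarrow> ((nat \<Rightarrow>\<^sub>0 nat) \<Rightarrow>\<^sub>0 'q) set" where
  "vars_null h n = {f. \<forall>m. (\<forall>i<n. Poly_Mapping.lookup m i = 0) \<longrightarrow> h (Poly_Mapping.lookup f m) = 0}"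

lemma vars_null_mono: "vars_null h 0 \<subseteq> vars_null h n"
  by (auto simp: vars_null_def)

context
  fixes h :: "'q::comm_ring_1 \<Rightarrow> 'r::{comm_ring,comm_monoid_mult}"
  assumes h: "ring_map h"
begin

interpretation h: ring_map h by (rule h)

lemma vars_null_ideal: "ri.subspace (vars_null h n)"
proof (rule ri.subspaceI)
  show "0 \<in> vars_null h n" by (simp add: vars_null_def h.zero)
  show add: "f + g \<in> vars_null h n" if "f \<in> vars_null h n" "g \<in> vars_null h n" for f g
    using that by (simp add: vars_null_def lookup_add h.add)
  show "c * f \<in> vars_null h n" if f: "f \<in> vars_null h n" for c f
  proof (induction c rule: poly_mapping_add_induct)
    case (single k c)
    show ?case
      using f by (auto simp: vars_null_def lookup_single_mult h.zero h.mult lookup_minus)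
  qed (simp_all add: distrib_right add, simp add: vars_null_def h.zero)
qed

lemma Var_vars_null: "i < n \<Longrightarrow> Var i \<in> vars_null h n"
  using lookup_Var_mult[of i "1 :: (nat \<Rightarrow>\<^sub>0 nat) \<Rightarrow>\<^sub>0 'q"] by (auto simp: vars_null_def h.zero simp del: One_nat_def)

lemma Const_vars_null: "h c = 0 \<Longrightarrow> Const c \<in> vars_null h n"
  by (auto simp: vars_null_def lookup_single when_def h.zero)

text \<open>This is regularity of the sequence of variables: the coefficient of \<open>f\<close> at
  \<open>m\<close> reappears in \<open>Var n * f\<close> at an exponent that agrees with
  \<open>m\<close> below \<open>n\<close>.\<close>

lemma Var_mult_vars_null:
  assumes "Var n * f \<in> vars_null h n"
  shows "f \<in> vars_null h n"
  unfolding vars_null_def mem_Collect_eq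
proof (intro allI impI)
  fix m :: "nat \<Rightarrow>\<^sub>0 nat" assume m: "\<forall>i<n. Poly_Mapping.lookup m i = 0"
  define m' where "m' = m + Poly_Mapping.single n 1"
  have "h (Poly_Mapping.lookup (Var n * f) m') = 0"
    using assms m unfolding vars_null_def by (simp add: m'_def lookup_add lookup_single)
  moreover have "Poly_Mapping.lookup m' n \<noteq> 0" "m' - Poly_Mapping.single n 1 = m"
    by (simp_all add: m'_def lookup_add)
  ultimately show "h (Poly_Mapping.lookup f m) = 0"
    by (simp only: lookup_Var_mult if_False)
qed

lemma split_Var:
  fixes f :: "(nat \<Rightarrow>\<^sub>0 nat) \<Rightarrow>\<^sub>0 'q"
  shows "\<exists>b c. f = b + c * Var n \<and> (\<forall>m. Poly_Mapping.lookup m n \<noteq> 0 \<longrightarrow> Poly_Mapping.lookup b m = 0)"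
proof (induction f rule: poly_mapping_add_induct)
  case zero
  show ?case by (rule exI[of _ 0], rule exI[of _ 0]) simp
next
  case (single k a)
  show ?case
  proof (cases "Poly_Mapping.lookup k n = 0")
    case True
    then show ?thesis
      by (intro exI[of _ "Poly_Mapping.single k a"] exI[of _ 0]) (auto simp: lookup_single when_def)
  next
    case False
    have "k - Poly_Mapping.single n 1 + Poly_Mapping.single n 1 = k"
      using False by (auto simp: poly_mapping_eq_iff fun_eq_iff lookup_add lookup_minus lookup_single when_def)
    then have "Poly_Mapping.single k a = 0 + Poly_Mapping.single (k - Poly_Mapping.single n 1) a * Var n"
      by (simp add: Var_def mult_single)
    then show ?thesis
      by (intro exI[of _ 0] exI[of _ "Poly_Mapping.single (k - Poly_Mapping.single n 1) a"] conjI) simp_all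
  qed
next
  case (add f g)
  then obtain b c b' c' where "f = b + c * Var n" "g = b' + c' * Var n"
    "\<forall>m. Poly_Mapping.lookup m n \<noteq> 0 \<longrightarrow> Poly_Mapping.lookup b m = 0"
    "\<forall>m. Poly_Mapping.lookup m n \<noteq> 0 \<longrightarrow> Poly_Mapping.lookup b' m = 0" by blast
  then show ?case
    by (intro exI[of _ "b + b'"] exI[of _ "c + c'"]) (simp add: lookup_add algebra_simps)
qed

text \<open>The last variable is peeled off. The part \<open>b\<close> of \<open>f\<close> that is
  free of \<open>Var n\<close> lies in the ideal of the earlier variables, because its nonzero
  coefficients are coefficients of \<open>f\<close>.\<close>

lemma vars_null_combination:
  "f \<in> vars_null h n \<Longrightarrow> \<exists>c. f - (\<Sum>i<n. c i * Var i) \<in> vars_null h 0"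
proof (induction n arbitrary: f)
  case (Suc n)
  obtain b c where bc: "f = b + c * Var n"
    "\<forall>m. Poly_Mapping.lookup m n \<noteq> 0 \<longrightarrow> Poly_Mapping.lookup b m = 0"
    using split_Var by blast
  have "b \<in> vars_null h n"
    unfolding vars_null_def mem_Collect_eq
  proof (intro allI impI)
    fix m :: "nat \<Rightarrow>\<^sub>0 nat" assume m: "\<forall>i<n. Poly_Mapping.lookup m i = 0"
    show "h (Poly_Mapping.lookup b m) = 0"
    proof (cases "Poly_Mapping.lookup m n = 0")
      case True
      then have "Poly_Mapping.lookup b m = Poly_Mapping.lookup f m"
        using lookup_Var_mult[of n c m] by (simp add: bc lookup_add mult.commute)
      moreover have "\<forall>i<Suc n. Poly_Mapping.lookup m i = 0"
        using m True by (simp add: less_Suc_eq)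
      ultimately show ?thesis using Suc.prems by (simp add: vars_null_def)
    qed (use bc(2) in \<open>simp add: h.zero\<close>)
  qed
  from Suc.IH[OF this] obtain c' where c': "b - (\<Sum>i<n. c' i * Var i) \<in> vars_null h 0" by blast
  have "f - (\<Sum>i<Suc n. (c'(n := c)) i * Var i) = b - (\<Sum>i<n. c' i * Var i)"
    by (simp add: bc(1))
  with c' show ?case by (intro exI[of _ "c'(n := c)"]) (simp only:)
qed simp

text \<open>First exactness of the Koszul complex of a regular sequence. By regularity
  \<open>a n\<close> is a combination of the earlier variables with coefficients \<open>c\<close>;
  moving \<open>c i * Var n\<close> into \<open>a i\<close> removes the last variable from the
  relation. The zero diagonal is stated separately because 2 need not be cancellable.\<close>

lemma koszul:
  assumes "(\<Sum>i<n. a i * Var i) \<in> vars_null h 0"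
  shows "\<exists>S. (\<forall>i j. S i j = - S j i) \<and> (\<forall>i. S i i = 0) \<and>
    (\<forall>i<n. a i - (\<Sum>j<n. S i j * Var j) \<in> vars_null h 0)"
  using assms
proof (induction n arbitrary: a)
  case 0
  show ?case by (intro exI[of _ "\<lambda>_ _. 0"]) simp
next
  case (Suc n)
  note Z = vars_null_ideal
  have "Var n * a n = (\<Sum>i<Suc n. a i * Var i) - (\<Sum>i<n. a i * Var i)"
    by (simp add: mult.commute)
  also have "\<dots> \<in> vars_null h n"
  proof (rule ri.subspace_diff[OF Z])
    show "(\<Sum>i<Suc n. a i * Var i) \<in> vars_null h n"
      using Suc.prems vars_null_mono by blast
    show "(\<Sum>i<n. a i * Var i) \<in> vars_null h n"
      by (intro ri.subspace_sum[OF Z] ri.subspace_scale[OF Z] Var_vars_null) simp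
  qed
  finally obtain c where c: "a n - (\<Sum>i<n. c i * Var i) \<in> vars_null h 0"
    using vars_null_combination Var_mult_vars_null by blast
  have "(\<Sum>i<n. (a i + c i * Var n) * Var i) = (\<Sum>i<n. a i * Var i) + Var n * (\<Sum>i<n. c i * Var i)"
    unfolding sum_distrib_left sum.distrib[symmetric]
    by (intro sum.cong refl) (simp add: algebra_simps)
  then have "(\<Sum>i<n. (a i + c i * Var n) * Var i) =
      (\<Sum>i<Suc n. a i * Var i) - Var n * (a n - (\<Sum>i<n. c i * Var i))"
    by (simp add: right_diff_distrib mult.commute)
  also have "\<dots> \<in> vars_null h 0"
    by (intro ri.subspace_diff[OF Z] ri.subspace_scale[OF Z] Suc.prems c)
  finally have aug: "(\<Sum>i<n. (a i + c i * Var n) * Var i) \<in> vars_null h 0" .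
  from Suc.IH[OF aug] obtain S where S: "\<forall>i j. S i j = - S j i" "\<forall>i. S i i = 0"
    "\<forall>i<n. (a i + c i * Var n) - (\<Sum>j<n. S i j * Var j) \<in> vars_null h 0"
    by (elim exE conjE) (rule that)
  \<comment> \<open>\<open>c\<close> becomes the new last row and, negated, the new last column.
    Entries out of range are 0, so that antisymmetry holds for all indices.\<close>
  define S' where "S' i j =
    (if i < n \<and> j < n then S i j else if i < n \<and> j = n then - c i
     else if i = n \<and> j < n then c j else 0)" for i j
  have S'1: "S' i j = - S' j i" for i j
  proof -
    consider "i < n \<and> j < n" | "i < n" "\<not> j < n" | "\<not> i < n" "j < n" | "\<not> i < n" "\<not> j < n"
      by blast
    then show ?thesis
    proof cases
      case 1
      then have eq: "S' i j = S i j" "S' j i = S j i" by (simp_all add: S'_def)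
      show ?thesis unfolding eq by (rule S(1)[rule_format])
    qed (simp_all add: S'_def)
  qed
  have S'2: "S' i i = 0" for i
    by (simp add: S'_def S(2))
  have S'3: "a i - (\<Sum>j<Suc n. S' i j * Var j) \<in> vars_null h 0" if "i < Suc n" for i
  proof (cases "i = n")
    case True
    then show ?thesis using c by (simp add: S'_def)
  next
    case False
    with that have "i < n" by simp
    then have "a i - (\<Sum>j<Suc n. S' i j * Var j) = (a i + c i * Var n) - (\<Sum>j<n. S i j * Var j)"
      by (simp add: S'_def)
    with S(3)[rule_format, OF \<open>i < n\<close>] show ?thesis by (simp only:)
  qed
  show ?case by (rule exI[of _ S']) (intro conjI allI impI S'1 S'2 S'3)
qed

end

lemma sum_alternating:
  fixes f :: "nat \<Rightarrow> nat \<Rightarrow> 'a::ab_group_add"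
  assumes "\<And>i j. f i j = - f j i" "\<And>i. f i i = 0"
  shows "(\<Sum>i<n. \<Sum>j<n. f i j) = 0"
proof (induction n)
  case (Suc n)
  have "(\<Sum>i<Suc n. \<Sum>j<Suc n. f i j) = (\<Sum>i<n. \<Sum>j<n. f i j) + ((\<Sum>i<n. f i n) + (\<Sum>j<n. f n j))"
    by (simp add: sum.distrib assms(2))
  also have "(\<Sum>i<n. f i n) = (\<Sum>i<n. - f n i)"
    by (rule sum.cong[OF refl]) (rule assms(1))
  finally show ?case by (simp add: Suc.IH sum_negf)
qed simp

section \<open>The diagonal ideal of a presented algebra\<close>

locale presentation = comm_algebra scale
  for scale :: "'v::comm_ring_1 \<Rightarrow> 'r::{comm_ring,comm_monoid_mult} \<Rightarrow> 'r" (infixr \<open>*s\<close> 75) +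
  fixes n :: nat and x :: "nat \<Rightarrow> 'r"
  assumes gen: "generates n x"
begin

definition relations :: "'v mpoly set" where
  "relations = {p \<in> polys_in n. peval x p = 0}"

sublocale ev: ring_map "peval x" by (rule ring_map_peval)

definition cc :: "'v \<Rightarrow> (nat \<Rightarrow>\<^sub>0 nat) \<Rightarrow>\<^sub>0 'r mult_mon \<Rightarrow>\<^sub>0 'v" where
  "cc v = Const (Const v)"

lemma ring_map_cc: "ring_map cc"
  using ring_map_comp[OF ring_map_Const ring_map_Const] by (simp add: cc_def[abs_def])

text \<open>\<open>p(X)\<close> is mapped to \<open>p(x + U)\<close>, where \<open>U\<close> are the variables of the polynomial ring over
  the monoid algebra of \<open>R\<close>; \<open>U\<close> stands for the differences of the two copies of \<open>x\<close>.\<close>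

definition shift :: "'v mpoly \<Rightarrow> (nat \<Rightarrow>\<^sub>0 nat) \<Rightarrow>\<^sub>0 'r mult_mon \<Rightarrow>\<^sub>0 'v" where
  "shift = alg_ext cc (monom_val (\<lambda>i. Const (br (x i)) + Var i))"

text \<open>The value \<open>p(x)\<close> kept in the monoid algebra, to serve as the constant term
  of \<open>shift p\<close>; only \<open>ka (evq p)\<close> is the value in R.\<close>

definition evq :: "'v mpoly \<Rightarrow> 'r mult_mon \<Rightarrow>\<^sub>0 'v" where
  "evq = alg_ext Const (monom_val (\<lambda>i. br (x i)))"

text \<open>R goes to the left factor and \<open>U\<close> to the differences, so
  \<open>x + U\<close> goes to the right-hand copy of \<open>x\<close>. This is why
  \<open>spec (shift p)\<close> represents \<open>tn 1 (peval x p)\<close>.\<close>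

definition spec :: "((nat \<Rightarrow>\<^sub>0 nat) \<Rightarrow>\<^sub>0 'r mult_mon \<Rightarrow>\<^sub>0 'v) \<Rightarrow> ('v, 'r) tens" where
  "spec = alg_ext emb (monom_val (\<lambda>i. Delta (x i)))"

lemma ring_map_shift: "ring_map shift"
  unfolding shift_def by (rule ring_map_eval[OF ring_map_cc])

lemma ring_map_evq: "ring_map evq"
  unfolding evq_def by (rule ring_map_eval[OF ring_map_Const])

lemma ring_map_spec: "ring_map spec"
  unfolding spec_def by (rule ring_map_eval[OF ring_map_emb])

sublocale cc: ring_map cc by (rule ring_map_cc)
sublocale shift: ring_map shift by (rule ring_map_shift)
sublocale evq: ring_map evq by (rule ring_map_evq)
sublocale spec: ring_map spec by (rule ring_map_spec)

text \<open>Evaluation at \<open>U = 0\<close>, that is, restriction to the diagonal.\<close>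

definition eps :: "((nat \<Rightarrow>\<^sub>0 nat) \<Rightarrow>\<^sub>0 'r mult_mon \<Rightarrow>\<^sub>0 'v) \<Rightarrow> 'r" where
  "eps f = mu (spec f)"

lemma ring_map_eps: "ring_map eps"
  using ring_map_comp[OF ring_map_mu ring_map_spec] by (simp add: eps_def[abs_def])

sublocale eps: ring_map eps by (rule ring_map_eps)

lemma spec_simps [simp]: "spec (Const q) = emb q" "spec (Var i) = Delta (x i)"
  by (simp_all add: spec_def eval_Var[OF ring_map_emb] eval_Const[OF ring_map_emb])

lemma shift_simps [simp]: "shift (Const v) = cc v" "shift (Var i) = Const (br (x i)) + Var i"
  by (simp_all add: shift_def eval_Var[OF ring_map_cc] eval_Const[OF ring_map_cc])

lemma evq_simps [simp]: "evq (Const v) = Const v" "evq (Var i) = br (x i)"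
  by (simp_all add: evq_def eval_Var[OF ring_map_Const] eval_Const[OF ring_map_Const])

lemma eps_simps [simp]: "eps (Const q) = ka q" "eps (Var i) = 0"
  by (simp_all add: eps_def mu_emb)

lemma spec_cc: "spec (cc v) = Const v"
  by (simp add: cc_def)

lemma spec_shift: "spec (shift p) = alg_ext Const (monom_val (\<lambda>i. tn 1 (x i))) p"
  unfolding shift_def ring_map_eval_comp[OF ring_map_cc ring_map_spec]
  by (simp add: spec_cc spec.add Delta_def)

lemma spec_shift_eqt: "spec (shift p) \<simeq> tn 1 (peval x p)"
  unfolding spec_shift by (rule eval_tn)

lemma ka_evq: "ka (evq p) = peval x p"
  unfolding evq_def ring_map_eval_comp[OF ring_map_Const ring_map_ka] by (simp add: peval_eq)

lemma eps_shift: "eps (shift p) = peval x p"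
  unfolding eps_def shift_def ring_map_eval_comp[OF ring_map_cc ring_map_spec]
    ring_map_eval_comp[OF ring_map_comp[OF ring_map_spec ring_map_cc] ring_map_mu]
  by (simp add: spec_cc spec.add mu.add peval_eq)

lemma spec_vars_null:
  assumes "f \<in> vars_null ka 0"
  shows "spec f \<in> tensor_null"
proof -
  have "emb (Poly_Mapping.lookup f m) \<simeq> 0" for m
    using assms emb_ka[of "Poly_Mapping.lookup f m"] eqt_trans[OF _ tn_zero(1)]
    by (auto simp: vars_null_def)
  then have "emb (Poly_Mapping.lookup f m) \<in> tensor_null" for m
    by (simp add: eqmod_def)
  then show ?thesis
    unfolding spec_def alg_ext_def mult.commute[of "emb _"]
    by (intro ri.subspace_sum[OF tensor_null_ideal] ri.subspace_scale[OF tensor_null_ideal])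
qed

section \<open>Partial derivatives and Taylor expansion to first order\<close>

lemma partial_deriv_superset:
  assumes "finite A" "Poly_Mapping.keys p \<subseteq> A"
  shows "partial_deriv k p = (\<Sum>m\<in>A. Poly_Mapping.single (m - Poly_Mapping.single k 1)
    (of_nat (Poly_Mapping.lookup m k) * Poly_Mapping.lookup p m))"
  unfolding partial_deriv_def
  using assms by (intro sum.mono_neutral_left) (auto simp: in_keys_iff)

lemma partial_deriv_add: "partial_deriv k (p + q :: 'v mpoly) = partial_deriv k p + partial_deriv k q"
proof -
  let ?A = "Poly_Mapping.keys p \<union> Poly_Mapping.keys q"
  have "partial_deriv k e = (\<Sum>m\<in>?A. Poly_Mapping.single (m - Poly_Mapping.single k 1)
      (of_nat (Poly_Mapping.lookup m k) * Poly_Mapping.lookup e m))"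
    if "e \<in> {p, q, p + q}" for e
    using that by (intro partial_deriv_superset) (auto dest: subsetD[OF keys_add])
  then show ?thesis by (simp add: lookup_add distrib_left single_add sum.distrib)
qed

lemma partial_deriv_single:
  "partial_deriv k (Poly_Mapping.single m c :: 'v mpoly) =
    Poly_Mapping.single (m - Poly_Mapping.single k 1) (of_nat (Poly_Mapping.lookup m k) * c)"
  by (subst partial_deriv_superset[of "{m}"]) auto

text \<open>The product rule. If \<open>k\<close> does not occur in \<open>m\<close>, the truncated
  exponent \<open>m - single k 1\<close> has no meaning, but then its coefficient
  \<open>of_nat 0\<close> vanishes; hence the case distinction.\<close>

lemma partial_deriv_Var_mult:
  "partial_deriv k (Var i * Poly_Mapping.single m c :: 'v mpoly) =
    Var i * partial_deriv k (Poly_Mapping.single m c) +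
    (if i = k then Poly_Mapping.single m c else 0)"
proof -
  let ?e = "\<lambda>i. Poly_Mapping.single i (1::nat)"
  have m: "?e i + (m - ?e k) = ?e i + m - ?e k" if "Poly_Mapping.lookup m k \<noteq> 0"
    using that by (auto simp: poly_mapping_eq_iff fun_eq_iff lookup_add lookup_minus lookup_single when_def)
  have lhs: "partial_deriv k (Var i * Poly_Mapping.single m c :: 'v mpoly) =
      Poly_Mapping.single (?e i + m - ?e k) (of_nat (Poly_Mapping.lookup (?e i + m) k) * c)"
    by (simp only: Var_def mult_single partial_deriv_single mult_1)
  show ?thesis
  proof (cases "Poly_Mapping.lookup m k = 0")
    case True
    then show ?thesis
      unfolding lhs
      by (cases "i = k") (simp_all add: lookup_add lookup_single partial_deriv_single del: One_nat_def)
  next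
    case False
    show ?thesis
    proof (cases "i = k")
      case True
      then show ?thesis
        using m[OF False]
        unfolding lhs
        by (simp add: lookup_add partial_deriv_single Var_def mult_single single_add distrib_right
            del: One_nat_def)
    next
      case ik: False
      then show ?thesis
        using m[OF False]
        unfolding lhs
        by (simp add: lookup_add lookup_single partial_deriv_single Var_def mult_single
            del: One_nat_def)
    qed
  qed
qed

text \<open>Polynomials with such an expansion are closed under sums and under multiplication by a
  variable. The coefficients \<open>M k\<close> live over the monoid algebra; the derivatives appear
  after \<open>eps\<close>.\<close>

lemma taylor:
  assumes "p \<in> polys_in n"
  shows "\<exists>M. shift p = Const (evq p) + (\<Sum>i<n. M i * Var i) \<and>
    (\<forall>k<n. eps (M k) = peval x (partial_deriv k p))"
proof -
  define T where "T p \<longleftrightarrow> (\<exists>M. shift p = Const (evq p) + (\<Sum>i<n. M i * Var i) \<and>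
    (\<forall>k<n. eps (M k) = peval x (partial_deriv k p)))" for p
  have T_add: "T (p + q)" if "T p" "T q" for p q
  proof -
    from that obtain M M' where
      "shift p = Const (evq p) + (\<Sum>i<n. M i * Var i)" "\<forall>k<n. eps (M k) = peval x (partial_deriv k p)"
      "shift q = Const (evq q) + (\<Sum>i<n. M' i * Var i)" "\<forall>k<n. eps (M' k) = peval x (partial_deriv k q)"
      unfolding T_def by blast
    then show ?thesis
      unfolding T_def
      by (intro exI[of _ "\<lambda>k. M k + M' k"])
        (simp add: shift.add evq.add single_add eps.add partial_deriv_add ev.add distrib_right sum.distrib)
  qed
  have T_Var: "T (Var i * Poly_Mapping.single l c)" if "T (Poly_Mapping.single l c)" "i < n" for i l c
  proof -
    let ?p = "Poly_Mapping.single l c"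
    from that obtain M where M:
      "shift ?p = Const (evq ?p) + (\<Sum>i<n. M i * Var i)" "\<forall>k<n. eps (M k) = peval x (partial_deriv k ?p)"
      unfolding T_def by blast
    \<comment> \<open>Read off from (x_i + U_i) (p(x) + sum_k M_k U_k): the product of U_i and p(x)
      contributes to the coefficient of U_i alone.\<close>
    define M' where "M' k = shift (Var i) * M k + (if i = k then Const (evq ?p) else 0)" for k
    have xi: "peval x (Var i) = x i"
      by (simp add: peval_eq eval_Var[OF ring_map_sc])
    have "(\<Sum>k<n. M' k * Var k) = shift (Var i) * (\<Sum>k<n. M k * Var k) + Const (evq ?p) * Var i"
    proof -
      have "M' k * Var k = shift (Var i) * (M k * Var k) + (if k = i then Const (evq ?p) * Var i else 0)"
        for k by (simp add: M'_def distrib_right mult.assoc del: shift_simps)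
      then have "(\<Sum>k<n. M' k * Var k) = (\<Sum>k<n. shift (Var i) * (M k * Var k)) +
          (\<Sum>k<n. if k = i then Const (evq ?p) * Var i else 0)"
        by (simp only: sum.distrib)
      then show ?thesis using that(2) by (simp add: sum_distrib_left del: shift_simps)
    qed
    moreover have "shift (Var i * ?p) = Const (evq (Var i * ?p)) +
        (shift (Var i) * (\<Sum>k<n. M k * Var k) + Const (evq ?p) * Var i)"
      by (simp add: shift.mult evq.mult Const_mult M(1) algebra_simps)
    moreover have "eps (M' k) = peval x (partial_deriv k (Var i * ?p))" if "k < n" for k
    proof -
      have "eps (M' k) = x i * peval x (partial_deriv k ?p) + (if i = k then peval x ?p else 0)"
        using M(2) that
        by (simp add: M'_def eps.add eps.mult eps_shift xi ka_evq eps.zero del: shift_simps)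
      then show ?thesis
        by (simp add: partial_deriv_Var_mult ev.add ev.mult xi ev.zero)
    qed
    ultimately show ?thesis unfolding T_def by (intro exI[of _ M']) simp
  qed
  have T_Const: "T (Const c)" for c
    unfolding T_def
    by (intro exI[of _ "\<lambda>_. 0"])
      (simp add: cc_def eps.zero partial_deriv_single ev.zero)
  \<comment> \<open>The second factor \<open>l\<close> stays arbitrary so that the two summands of
    an exponent can be treated one after the other.\<close>
  have "T (Poly_Mapping.single l c) \<longrightarrow> T (Poly_Mapping.single (m + l) c)"
    if "Poly_Mapping.keys m \<subseteq> {..<n}" for m l c
    using that
  proof (induction m arbitrary: l rule: poly_mapping_add_induct)
    case (single i d)
    have "T (Poly_Mapping.single l c) \<longrightarrow> T (Poly_Mapping.single (Poly_Mapping.single i d + l) c)"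
      if "i < n" for l
    proof (induction d)
      case (Suc d)
      have "Poly_Mapping.single (Poly_Mapping.single i (Suc d) + l) c =
          Var i * Poly_Mapping.single (Poly_Mapping.single i d + l) c"
        by (simp add: Var_def mult_single add.assoc[symmetric] flip: single_add)
      then show ?case using Suc.IH T_Var[OF _ that] by simp
    qed simp
    then show ?case using single by (cases "d = 0") auto
  next
    case (add f g)
    have "Poly_Mapping.keys f \<subseteq> Poly_Mapping.keys (f + g)" "Poly_Mapping.keys g \<subseteq> Poly_Mapping.keys (f + g)"
      by (auto simp: in_keys_iff lookup_add)
    with add show ?case by (metis add.assoc subset_trans)
  qed simp
  from this[of _ 0] T_Const have T_single: "T (Poly_Mapping.single m c)"
    if "Poly_Mapping.keys m \<subseteq> {..<n}" for m c
    using that by simp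
  have T_0: "T 0" using T_Const[of 0] by simp
  have "T (\<Sum>m\<in>A. Poly_Mapping.single m (Poly_Mapping.lookup p m))"
    if "finite A" "A \<subseteq> Poly_Mapping.keys p" for A
    using that
  proof induction
    case (insert m A)
    then show ?case using T_add T_single assms by (simp add: polys_in_def)
  qed (simp add: T_0)
  from this[of "Poly_Mapping.keys p"]
  have "T (\<Sum>m\<in>Poly_Mapping.keys p. Poly_Mapping.single m (Poly_Mapping.lookup p m))" by simp
  also have "(\<Sum>m\<in>Poly_Mapping.keys p. Poly_Mapping.single m (Poly_Mapping.lookup p m)) = p"
    by (rule poly_mapping_eqI) (auto simp: lookup_sum lookup_single when_def in_keys_iff)
  finally show ?thesis unfolding T_def .
qed

section \<open>The tensor square as a quotient of the polynomials in \<open>U\<close>\<close>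

definition lift :: "'r \<Rightarrow> 'v mpoly" where
  "lift r = (SOME p. p \<in> polys_in n \<and> peval x p = r)"

lemma lift: "lift r \<in> polys_in n" "peval x (lift r) = r"
proof -
  have "r \<in> peval x ` polys_in n" using gen by (simp add: generates_def)
  then have "\<exists>p. p \<in> polys_in n \<and> peval x p = r" by auto
  from someI_ex[OF this] show "lift r \<in> polys_in n" "peval x (lift r) = r"
    by (simp_all add: lift_def)
qed

text \<open>An inverse of \<open>spec\<close> up to congruence. As \<open>lift\<close> chooses
  representatives arbitrarily, this is an additive map that becomes multiplicative only modulo
  \<open>graph_ideal\<close>.\<close>

definition sect :: "('v, 'r) tens \<Rightarrow> (nat \<Rightarrow>\<^sub>0 nat) \<Rightarrow>\<^sub>0 'r mult_mon \<Rightarrow>\<^sub>0 'v" where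
  "sect = alg_ext cc (\<lambda>k. Const (br (of_mm (fst k))) * shift (lift (of_mm (snd k))))"

sublocale sect: additive sect
  unfolding sect_def by (rule additive_alg_ext[OF ring_map_cc])

lemma sect_single:
  "sect (Poly_Mapping.single k c) =
    cc c * (Const (br (of_mm (fst k))) * shift (lift (of_mm (snd k))))"
  by (simp add: sect_def alg_ext_single[OF ring_map_cc])

lemma sect_tn: "sect (tn a b) = Const (br a) * shift (lift b)"
  by (simp add: tn_def sect_single cc_def)

lemma sect_Const_mult: "sect (Const v * f) = cc v * sect f"
proof (induction f rule: poly_mapping_add_induct)
  case (single k c)
  then show ?case
    by (simp add: mult_single sect_single cc.mult mult.assoc)
qed (simp_all add: sect.zero sect.add distrib_left)

text \<open>The quotient by this ideal is the tensor square: the first generators turn coefficients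
  into elements of R, the second impose the relations of R on the second copy \<open>x + U\<close>
  of the generators.\<close>

definition graph_ideal :: "((nat \<Rightarrow>\<^sub>0 nat) \<Rightarrow>\<^sub>0 'r mult_mon \<Rightarrow>\<^sub>0 'v) set" where
  "graph_ideal = ri.span (vars_null ka 0 \<union> shift ` relations)"

lemma graph_ideal: "ri.subspace graph_ideal"
  by (simp add: graph_ideal_def)

lemma shift_relations: "p \<in> relations \<Longrightarrow> shift p \<in> graph_ideal"
  by (simp add: graph_ideal_def ri.span_base)

lemma Const_graph_ideal: "ka c = 0 \<Longrightarrow> Const c \<in> graph_ideal"
  using Const_vars_null[OF ring_map_ka, of c 0] by (simp add: graph_ideal_def ri.span_base)

lemma spec_graph_ideal: "f \<in> graph_ideal \<Longrightarrow> spec f \<in> tensor_null"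
  unfolding graph_ideal_def
proof (induction rule: ri.span_induct_alt)
  case base
  show ?case by (simp add: spec.zero ri.subspace_0[OF tensor_null_ideal])
next
  case (step c y z)
  have "spec y \<in> tensor_null"
    using step(1)
  proof
    assume "y \<in> shift ` relations"
    then obtain p where p: "y = shift p" "peval x p = 0" by (auto simp: relations_def)
    with spec_shift_eqt[of p] have "spec y \<simeq> tn 1 0" by simp
    then have "spec y \<simeq> 0" using eqt_trans tn_zero(2) by blast
    then show ?thesis by (simp add: eqmod_def)
  qed (rule spec_vars_null)
  then show ?case
    using step(2) by (simp add: spec.add spec.mult ri.subspace_add[OF tensor_null_ideal]
        ri.subspace_scale[OF tensor_null_ideal])
qed

text \<open>A bilinearity relation in the left factor becomes a multiple of a constant killed by
  \<open>ka\<close>; one in the right factor becomes a multiple of a shifted relation between the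
  chosen representatives.\<close>

lemma sect_null: "f \<in> tensor_null \<Longrightarrow> sect f \<in> graph_ideal"
proof (induction rule: tensor_null_induct)
  case zero
  show ?case by (simp add: sect.zero ri.subspace_0[OF graph_ideal])
next
  case (add f g)
  then show ?case by (simp add: sect.add ri.subspace_add[OF graph_ideal])
next
  case (rel v r)
  have "sect r \<in> graph_ideal"
  proof -
    from rel consider a b c where "r = tn (a + b) c - tn a c - tn b c"
      | a b c where "r = tn a (b + c) - tn a b - tn a c"
      | w a b where "r = tn (w *s a) b - Const w * tn a b"
      | w a b where "r = tn a (w *s b) - Const w * tn a b"
      unfolding tensor_rel_def by (elim UnE CollectE exE conjE) (erule that)+
    then show ?thesis
    proof cases
      case 1
      have "sect r = shift (lift c) * Const (br (a + b) - br a - br b)"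
        by (simp add: 1 sect.diff sect_tn) (simp add: single_diff single_add algebra_simps)
      moreover have "ka (br (a + b) - br a - br b) = 0" by (simp add: ka.diff)
      ultimately show ?thesis
        by (simp only:) (intro ri.subspace_scale[OF graph_ideal] Const_graph_ideal)
    next
      case 2
      have "sect r = Const (br a) * shift (lift (b + c) - lift b - lift c)"
        by (simp add: 2 sect.diff sect_tn) (simp add: shift.diff shift.add algebra_simps)
      moreover have "lift (b + c) - lift b - lift c \<in> relations"
        by (simp add: relations_def ev.diff lift polys_in_intros)
      ultimately show ?thesis
        by (simp only:) (intro ri.subspace_scale[OF graph_ideal] shift_relations)
    next
      case 3
      have "sect r = shift (lift b) * Const (br (w *s a) - Const w * br a)"
        by (simp add: 3 sect.diff sect_tn sect_Const_mult) (simp add: cc_def single_diff Const_mult algebra_simps)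
      moreover have "ka (br (w *s a) - Const w * br a) = 0" by (simp add: ka.diff ka.mult sc_mult)
      ultimately show ?thesis
        by (simp only:) (intro ri.subspace_scale[OF graph_ideal] Const_graph_ideal)
    next
      case 4
      have "sect r = Const (br a) * shift (lift (w *s b) - Const w * lift b)"
        by (simp add: 4 sect.diff sect_tn sect_Const_mult) (simp add: shift.diff shift.mult algebra_simps)
      moreover have "peval x (Const w) = sc w"
        by (simp add: peval_eq eval_Const[OF ring_map_sc])
      then have "lift (w *s b) - Const w * lift b \<in> relations"
        by (simp add: relations_def ev.diff ev.mult lift polys_in_intros sc_mult)
      ultimately show ?thesis
        by (simp only:) (intro ri.subspace_scale[OF graph_ideal] shift_relations)
    qed
  qed
  then show ?case by (simp add: sect_Const_mult ri.subspace_scale[OF graph_ideal])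
qed

abbreviation eqg (infix \<open>\<approx>\<close> 50) where
  "f \<approx> g \<equiv> eqmod graph_ideal f g"

text \<open>On pure tensors the error comes from \<open>lift (b * d) - lift b * lift d\<close>,
  which is a relation.\<close>

lemma sect_mult: "sect (f * g) \<approx> sect f * sect g"
proof -
  note refl = eqmod_refl[OF graph_ideal] and add' = eqmod_add[OF graph_ideal]
    and mult' = eqmod_mult[OF graph_ideal]
  have tn: "sect (tn a b * tn c d) \<approx> sect (tn a b) * sect (tn c d)" for a b c d
  proof -
    have "shift (lift (b * d) - lift b * lift d) \<in> graph_ideal"
      by (intro shift_relations) (simp add: relations_def ev.diff ev.mult lift polys_in_intros)
    then have "shift (lift (b * d)) \<approx> shift (lift b) * shift (lift d)"
      by (simp add: eqmod_def shift.diff shift.mult)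
    from mult'[OF refl[of "Const (br (a * c))"] this]
    have "sect (tn a b * tn c d) \<approx> Const (br (a * c)) * (shift (lift b) * shift (lift d))"
      by (simp add: tn_mult sect_tn)
    also have "Const (br (a * c)) * (shift (lift b) * shift (lift d)) = sect (tn a b) * sect (tn c d)"
      by (simp add: sect_tn br_mult[symmetric] Const_mult ac_simps)
    finally show ?thesis .
  qed
  show ?thesis
  proof (induction f rule: poly_mapping_add_induct)
    case zero
    show ?case by (simp add: sect.zero refl)
  next
    case (add f f')
    then show ?case using add'[OF add] by (simp add: sect.add distrib_right)
  next
    case (single k c)
    show ?case
    proof (induction g rule: poly_mapping_add_induct)
      case zero
      show ?case by (simp add: sect.zero refl)
    next
      case (add g g')
      then show ?case using add'[OF add] by (simp add: sect.add distrib_left)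
    next
      case (single l d)
      let ?k = "tn (of_mm (fst k)) (of_mm (snd k))" and ?l = "tn (of_mm (fst l)) (of_mm (snd l))"
      have "Poly_Mapping.single k c * Poly_Mapping.single l d = Const c * (Const d * (?k * ?l))"
        by (simp only: single_eq_tn[of k] single_eq_tn[of l] ac_simps)
      moreover have "sect (Poly_Mapping.single k c) = cc c * sect ?k"
        "sect (Poly_Mapping.single l d) = cc d * sect ?l"
        by (simp_all only: single_eq_tn[of k] single_eq_tn[of l] sect_Const_mult)
      moreover have "cc c * (cc d * sect (?k * ?l)) \<approx> cc c * (cc d * (sect ?k * sect ?l))"
        by (intro mult' refl tn)
      ultimately show ?case by (simp only: sect_Const_mult ac_simps)
    qed
  qed
qed

lemma spec_sect: "spec (sect f) \<simeq> f"
proof (induction f rule: poly_mapping_add_induct)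
  case zero
  show ?case by (simp add: sect.zero spec.zero)
next
  case (add f g)
  then show ?case using eqt_add[OF add] by (simp add: sect.add spec.add)
next
  case (single k c)
  let ?a = "of_mm (fst k)" and ?b = "of_mm (snd k)"
  have "spec (sect (Poly_Mapping.single k c)) = Const c * (tn ?a 1 * spec (shift (lift ?b)))"
    by (simp add: sect_single spec.mult spec_cc)
  also have "Const c * (tn ?a 1 * spec (shift (lift ?b))) \<simeq> Const c * (tn ?a 1 * tn 1 ?b)"
    using spec_shift_eqt[of "lift ?b"] by (intro eqt_mult eqt_refl) (simp add: lift)
  also have "Const c * (tn ?a 1 * tn 1 ?b) = Poly_Mapping.single k c"
    by (simp add: tn_mult single_eq_tn[of k])
  finally show ?case .
qed

lemma sect_Delta:
  assumes "k < n"
  shows "sect (Delta (x k)) \<approx> Var k"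
proof -
  have xi: "peval x (Var i) = x i" for i
    by (simp add: peval_eq eval_Var[OF ring_map_sc])
  have "shift (lift (x k) - Var k) \<in> graph_ideal" "shift (lift 1 - 1) \<in> graph_ideal"
    using assms by (intro shift_relations; simp add: relations_def ev.diff lift xi ev.one polys_in_intros)+
  then have "shift (lift (x k)) \<approx> shift (Var k)" "shift (lift 1) \<approx> 1"
    by (simp_all add: eqmod_def shift.diff shift.one)
  then have "Const (br 1) * shift (lift (x k)) - Const (br (x k)) * shift (lift 1) \<approx>
      Const (br 1) * shift (Var k) - Const (br (x k)) * 1"
    by (intro eqmod_diff[OF graph_ideal] eqmod_mult[OF graph_ideal] eqmod_refl[OF graph_ideal])
  then show ?thesis
    by (simp add: Delta_def sect.diff sect_tn br_one)
qed

section \<open>Denominators and local generators of the diagonal ideal\<close>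

lemma uniform_denominator:
  assumes noeth: "noetherian (polys_in n :: 'v mpoly set)"
    and q: "ring_prime_ideal q"
    and loc: "\<forall>h\<in>relations. \<exists>s\<in>polys_in n. peval x s \<notin> q \<and>
      (\<exists>b. (\<forall>j<c. b j \<in> polys_in n) \<and> s * h = (\<Sum>j<c. b j * g j))"
  shows "\<exists>s. peval x s \<notin> q \<and> (\<forall>h\<in>relations. \<exists>b. s * h = (\<Sum>j<c. b j * g j))"
proof -
  have "ideal_of (polys_in n) relations"
    by (auto simp: ideal_of_def relations_def ev.zero ev.add ev.mult intro: polys_in_intros)
  with noeth obtain G where G: "finite G" "G \<subseteq> relations" "relations \<subseteq> lcomb (polys_in n) G"
    unfolding noetherian_def by blast
  define sol where "sol s h \<longleftrightarrow> (\<exists>b. s * h = (\<Sum>j<c. b j * g j))" for s h :: "'v mpoly"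
  have sol_mult: "sol (t * s) h" "sol s (t * h)" if "sol s h" for s t h
  proof -
    from that obtain b where b: "s * h = (\<Sum>j<c. b j * g j)" by (auto simp: sol_def)
    have "t * (s * h) = (\<Sum>j<c. (t * b j) * g j)" by (simp add: b sum_distrib_left mult.assoc)
    then have eq: "t * s * h = (\<Sum>j<c. (t * b j) * g j)" "s * (t * h) = (\<Sum>j<c. (t * b j) * g j)"
      by (simp_all add: ac_simps)
    show "sol (t * s) h" "sol s (t * h)"
      unfolding sol_def by (rule exI[of _ "\<lambda>j. t * b j"], rule eq)+
  qed
  have "\<exists>s. peval x s \<notin> q \<and> (\<forall>h\<in>G. sol s h)"
    using G(1,2)
  proof induction
    case empty
    have "1 \<notin> q" using q by (simp add: ring_prime_ideal_def)
    then show ?case using ev.one by (intro exI[of _ 1]) simp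
  next
    case (insert h G)
    then obtain s where s: "peval x s \<notin> q" "\<forall>h\<in>G. sol s h" by auto
    from insert.prems loc obtain t where t: "peval x t \<notin> q" "sol t h"
      unfolding sol_def by blast
    have "peval x (s * t) \<notin> q"
      using q s(1) t(1) unfolding ring_prime_ideal_def ev.mult by blast
    moreover have "sol (s * t) h'" if "h' \<in> insert h G" for h'
      using that sol_mult(1)[OF t(2), of s] s(2) sol_mult(1)[of s h' t] by (auto simp: mult.commute)
    ultimately show ?case by blast
  qed
  then obtain s where s: "peval x s \<notin> q" "\<forall>h\<in>G. sol s h" by blast
  have sol_all: "sol s h" if "h \<in> lcomb (polys_in n) G" for h
    using that
  proof induction
    case zero
    show ?case unfolding sol_def by (rule exI[of _ "\<lambda>_. 0"]) simp
  next
    case (step t k h)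
    from sol_mult(2)[of s k t] s(2) step.hyps obtain b where b: "s * (t * k) = (\<Sum>j<c. b j * g j)"
      unfolding sol_def by blast
    from step.IH obtain b' where b': "s * h = (\<Sum>j<c. b' j * g j)" unfolding sol_def by blast
    show ?case
      unfolding sol_def
      by (rule exI[of _ "\<lambda>j. b j + b' j"]) (simp add: distrib_left distrib_right b b' sum.distrib)
  qed
  show ?thesis
  proof (intro exI[of _ s] conjI ballI)
    fix h assume "h \<in> relations"
    then have "sol s h" using G(3) by (intro sol_all) (rule subsetD)
    then show "\<exists>b. s * h = (\<Sum>j<c. b j * g j)" by (simp only: sol_def)
  qed (rule s(1))
qed

text \<open>Taylor expansion of a polynomial representing \<open>f\<close>, mapped to the tensor
  square, where its constant term is congruent to \<open>tn f 1\<close>.\<close>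

lemma Delta_combination:
  "\<exists>a. Delta f \<simeq> (\<Sum>i<n. a i * Delta (x i))"
proof -
  from taylor[OF lift(1)[of f]] obtain M where
    M: "shift (lift f) = Const (evq (lift f)) + (\<Sum>i<n. M i * Var i)" by blast
  have "emb (evq (lift f)) \<simeq> tn f 1"
    using emb_ka[of "evq (lift f)"] by (simp add: ka_evq lift)
  then have "spec (shift (lift f)) - emb (evq (lift f)) \<simeq> tn 1 f - tn f 1"
    using spec_shift_eqt[of "lift f"] by (intro eqt_diff) (simp_all add: lift)
  moreover have "spec (shift (lift f)) - emb (evq (lift f)) = (\<Sum>i<n. spec (M i) * Delta (x i))"
    by (simp add: M spec.add spec.sum spec.mult)
  ultimately have "(\<Sum>i<n. spec (M i) * Delta (x i)) \<simeq> Delta f" by (simp add: Delta_def)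
  then show ?thesis by (intro exI[of _ "\<lambda>i. spec (M i)"]) (rule eqt_sym)
qed

text \<open>Near \<open>q\<close> the diagonal ideal is generated by one of the \<open>Delta (x k)\<close>, which is not a zero
  divisor there. Both follow from the Koszul relations of the variables \<open>U\<close>, because an invertible
  matrix relates them to the relations \<open>g\<close> and the one remaining variable.\<close>

lemma diagonal_locally_principal:
  assumes n: "n = Suc c" and q: "ring_prime_ideal q"
    and g: "\<forall>j<c. g j \<in> relations"
    and s: "peval x s \<notin> q" "\<forall>h\<in>relations. \<exists>b. s * h = (\<Sum>j<c. b j * g j)"
    and jac: "\<forall>r. (\<forall>k<n. (\<Sum>j<c. r j * peval x (partial_deriv k (g j))) \<in> q) \<longrightarrow> (\<forall>j<c. r j \<in> q)"
  shows "\<exists>z d. mu d \<notin> q \<and> (\<forall>f. \<exists>a. d * Delta f \<simeq> a * Delta z) \<and>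
    (\<forall>a. a * Delta z \<in> tensor_null \<longrightarrow> d * a \<in> tensor_null)"
proof -
  note q' = q[unfolded ring_prime_ideal_def ring_ideal_def]
  \<comment> \<open>The preimage of \<open>q\<close> under evaluation at \<open>U = 0\<close>. By
    the Taylor expansion \<open>M\<close> becomes the Jacobian matrix under this evaluation, so its
    rows are independent modulo \<open>Q\<close>.\<close>
  define Q where "Q = {f. eps f \<in> q}"
  note Z = vars_null_ideal[OF ring_map_ka, of 0]
  have "\<forall>j. \<exists>M. j < c \<longrightarrow> shift (g j) = Const (evq (g j)) + (\<Sum>i<n. M i * Var i) \<and>
      (\<forall>k<n. eps (M k) = peval x (partial_deriv k (g j)))"
    using g taylor by (auto simp: relations_def)
  from choice[OF this] obtain M where
    M': "\<forall>j. j < c \<longrightarrow> shift (g j) = Const (evq (g j)) + (\<Sum>i<n. M j i * Var i) \<and>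
      (\<forall>k<n. eps (M j k) = peval x (partial_deriv k (g j)))" ..
  have M: "shift (g j) = Const (evq (g j)) + (\<Sum>i<n. M j i * Var i)"
    "k < n \<Longrightarrow> eps (M j k) = peval x (partial_deriv k (g j))" if "j < c" for j k
    using M' that by simp_all
  have Q1: "ri.subspace Q"
    using q' by (auto intro!: ri.subspaceI simp: Q_def eps.zero eps.add eps.mult)
  have Q2: "1 \<notin> Q" using q' by (simp add: Q_def eps.one)
  have Q3: "a \<in> Q \<or> b \<in> Q" if "a * b \<in> Q" for a b
    using q' that by (simp add: Q_def eps.mult)
  have Q4: "\<forall>r. (\<forall>k<n. (\<Sum>j<c. r j * M j k) \<in> Q) \<longrightarrow> (\<forall>j<c. r j \<in> Q)"
  proof (intro allI impI)
    fix r j assume r: "\<forall>k<n. (\<Sum>j<c. r j * M j k) \<in> Q" and j: "j < c"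
    have "(\<Sum>j<c. eps (r j) * peval x (partial_deriv k (g j))) \<in> q" if k: "k < n" for k
    proof -
      have "(\<Sum>j<c. eps (r j) * peval x (partial_deriv k (g j))) = eps (\<Sum>j<c. r j * M j k)"
        using k by (simp add: eps.sum eps.mult M(2))
      then show ?thesis using r k by (simp add: Q_def)
    qed
    with jac[rule_format, of "\<lambda>j. eps (r j)" j] j show "r j \<in> Q" by (simp add: Q_def)
  qed
  obtain p W L d where
    p: "inj_on p {..<c}" "p ` {..<c} \<subseteq> {..<n}" and d: "d \<notin> Q" and Wp: "\<forall>j<c. W (p j) = M j"
    and We: "\<forall>i<n. i \<notin> p ` {..<c} \<longrightarrow> W i = (\<lambda>k. if i = k then 1 else 0)"
    and WL: "\<forall>i<n. \<forall>k<n. (\<Sum>l<n. W i l * L l k) = (if i = k then d else 0)"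
    and LW: "\<forall>i<n. \<forall>k<n. (\<Sum>l<n. L i l * W l k) = (if i = k then d else 0)"
    by (rule exchange_rows[OF Q1 Q2 _ Q4, elim_format]) (erule Q3, elim exE conjE, rule that)
  \<comment> \<open>Relative dimension 1 leaves exactly one unit row in \<open>W\<close>, with index
    \<open>k\<close>.\<close>
  have "card (p ` {..<c}) = c" using card_image[OF p(1)] by simp
  then have "card ({..<n} - p ` {..<c}) = 1"
    using p(2) n by (simp add: card_Diff_subset)
  then obtain k where k: "{..<n} - p ` {..<c} = {k}" by (rule card_1_singletonE)
  have kn: "k < n" and kp: "k \<notin> p ` {..<c}" using k by auto
  have split: "(\<Sum>i<n. f i) = f k + (\<Sum>j<c. f (p j))" for f :: "nat \<Rightarrow> (nat \<Rightarrow>\<^sub>0 nat) \<Rightarrow>\<^sub>0 'r mult_mon \<Rightarrow>\<^sub>0 'v"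
  proof -
    have "{..<n} = insert k (p ` {..<c})" using k p(2) by blast
    then show ?thesis using kp by (simp add: sum.reindex[OF p(1)])
  qed
  \<comment> \<open>New coordinates \<open>w = W U\<close>: the shifted relations, up to constants
    that vanish in R, together with the single variable \<open>Var k\<close>.\<close>
  define w where "w i = (\<Sum>l<n. W i l * Var l)" for i
  have wk: "w k = Var k"
  proof -
    have "w k = (\<Sum>l<n. if k = l then Var l else 0)"
      using We kn kp unfolding w_def by (intro sum.cong refl) simp
    then show ?thesis using kn by simp
  qed
  have wp: "shift (g j) - w (p j) \<in> vars_null ka 0" if j: "j < c" for j
  proof -
    have "shift (g j) - w (p j) = Const (evq (g j))"
      using M(1)[OF j] Wp j by (simp add: w_def)
    moreover have "ka (evq (g j)) = 0" using g j by (simp add: ka_evq relations_def)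
    ultimately show ?thesis using Const_vars_null[OF ring_map_ka] by simp
  qed
  have spec_wp: "spec (w (p j)) \<in> tensor_null" if j: "j < c" for j
  proof -
    have "w (p j) \<in> graph_ideal"
      using ri.subspace_diff[OF graph_ideal shift_relations[of "g j"], of "shift (g j) - w (p j)"]
        wp[OF j] g j by (simp add: graph_ideal_def ri.span_base)
    then show ?thesis by (rule spec_graph_ideal)
  qed
  have Lw: "(\<Sum>i<n. L j i * w i) = d * Var j" if j: "j < n" for j
  proof -
    have "(\<Sum>i<n. L j i * w i) = (\<Sum>i<n. \<Sum>l<n. L j i * W i l * Var l)"
      by (simp add: w_def sum_distrib_left mult.assoc)
    also have "\<dots> = (\<Sum>l<n. \<Sum>i<n. L j i * W i l * Var l)" by (rule sum.swap)
    also have "\<dots> = (\<Sum>l<n. (\<Sum>i<n. L j i * W i l) * Var l)" by (simp add: sum_distrib_right)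
    also have "\<dots> = (\<Sum>l<n. if j = l then d * Var l else 0)"
      using LW j by (intro sum.cong refl) simp
    also have "\<dots> = d * Var j" using j by simp
    finally show ?thesis .
  qed
  \<comment> \<open>The regularity argument below uses the inverse \<open>L\<close> of
    \<open>W\<close> twice, which costs two factors \<open>d\<close>; the factor
    \<open>shift s\<close> pays for expressing all relations by the \<open>g j\<close>.\<close>
  define e where "e = d * d * shift s"
  have "\<exists>a. spec e * Delta f \<simeq> a * Delta (x k)" for f
  proof -
    have Dx: "spec d * Delta (x j) \<simeq> spec (L j k) * Delta (x k)" if j: "j < n" for j
    proof -
      have "spec d * Delta (x j) = spec (d * Var j)" by (simp add: spec.mult)
      also have "\<dots> = spec (L j k) * Delta (x k) + (\<Sum>i<c. spec (L j (p i)) * spec (w (p i)))"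
        by (simp add: Lw[OF j, symmetric] split wk spec.add spec.mult spec.sum)
      finally have "spec d * Delta (x j) - spec (L j k) * Delta (x k) =
          (\<Sum>i<c. spec (L j (p i)) * spec (w (p i)))" by simp
      also have "\<dots> \<in> tensor_null"
        using spec_wp by (intro ri.subspace_sum[OF tensor_null_ideal] ri.subspace_scale[OF tensor_null_ideal]) simp
      finally show ?thesis by (simp add: eqmod_def)
    qed
    from Delta_combination obtain a where "Delta f \<simeq> (\<Sum>i<n. a i * Delta (x i))" by blast
    then have "spec e * Delta f \<simeq> spec e * (\<Sum>i<n. a i * Delta (x i))"
      by (intro eqt_mult eqt_refl)
    also have "spec e * (\<Sum>i<n. a i * Delta (x i)) =
        (\<Sum>i<n. spec d * spec (shift s) * a i * (spec d * Delta (x i)))"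
      by (simp add: e_def spec.mult sum_distrib_left ac_simps)
    also have "\<dots> \<simeq> (\<Sum>i<n. spec d * spec (shift s) * a i * (spec (L i k) * Delta (x k)))"
      by (intro eqt_sum eqt_mult eqt_refl Dx) simp
    also have "\<dots> = (\<Sum>i<n. spec d * spec (shift s) * a i * spec (L i k)) * Delta (x k)"
      by (simp add: sum_distrib_right mult.assoc)
    finally show ?thesis by blast
  qed
  \<comment> \<open>If \<open>a * Delta (x k)\<close> is null, then after multiplication by
    \<open>shift s\<close> there is a relation between the \<open>w i\<close> with coefficient
    \<open>shift s * sect a\<close> at \<open>w k\<close>. In the variables it is a Koszul relation.
    Translated back, its coefficient at \<open>w k\<close> cancels by alternation, and the other
    \<open>w i\<close> vanish in the tensor square.\<close>
  moreover have "spec e * a \<in> tensor_null" if a: "a * Delta (x k) \<in> tensor_null" for a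
  proof -
    have "sect a * Var k \<in> graph_ideal"
    proof -
      have "sect (a * Delta (x k)) \<approx> sect a * sect (Delta (x k))" by (rule sect_mult)
      moreover have "sect a * sect (Delta (x k)) \<approx> sect a * Var k"
        by (intro eqmod_mult[OF graph_ideal] eqmod_refl[OF graph_ideal] sect_Delta kn)
      ultimately have "sect (a * Delta (x k)) \<approx> sect a * Var k"
        by (rule eqmod_trans[OF graph_ideal])
      from eqmod_mem[OF graph_ideal this] sect_null[OF a] show ?thesis by blast
    qed
    moreover have "\<exists>b. shift s * f - (\<Sum>j<c. b j * shift (g j)) \<in> vars_null ka 0"
      if "f \<in> graph_ideal" for f
      using that unfolding graph_ideal_def
    proof (induction rule: ri.span_induct_alt)
      case base
      show ?case by (rule exI[of _ "\<lambda>_. 0"]) (simp add: ri.subspace_0[OF Z])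
    next
      case (step r y f)
      from step.IH obtain b where b: "shift s * f - (\<Sum>j<c. b j * shift (g j)) \<in> vars_null ka 0" by blast
      have "\<exists>b. shift s * y - (\<Sum>j<c. b j * shift (g j)) \<in> vars_null ka 0"
        using step.hyps
      proof
        assume "y \<in> vars_null ka 0"
        then have "shift s * y - (\<Sum>j<c. 0 * shift (g j)) \<in> vars_null ka 0"
          by (simp add: ri.subspace_scale[OF Z])
        then show ?thesis by (intro exI[of _ "\<lambda>_. 0"])
      next
        assume "y \<in> shift ` relations"
        then obtain h where h: "h \<in> relations" "y = shift h" by blast
        with s(2) obtain b where "s * h = (\<Sum>j<c. b j * g j)" by blast
        then have "shift s * y = (\<Sum>j<c. shift (b j) * shift (g j))"
          by (simp add: h(2) shift.sum shift.mult flip: shift.mult[of s h])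
        then have "shift s * y - (\<Sum>j<c. shift (b j) * shift (g j)) \<in> vars_null ka 0"
          by (simp add: ri.subspace_0[OF Z])
        then show ?thesis by (intro exI[of _ "\<lambda>j. shift (b j)"])
      qed
      then obtain b' where b': "shift s * y - (\<Sum>j<c. b' j * shift (g j)) \<in> vars_null ka 0" by blast
      have "shift s * (r * y + f) - (\<Sum>j<c. (r * b' j + b j) * shift (g j)) =
          r * (shift s * y - (\<Sum>j<c. b' j * shift (g j))) + (shift s * f - (\<Sum>j<c. b j * shift (g j)))"
        by (simp add: algebra_simps sum.distrib sum_distrib_left)
      also have "\<dots> \<in> vars_null ka 0"
        by (intro ri.subspace_add[OF Z] ri.subspace_scale[OF Z] b b')
      finally show ?case by (intro exI[of _ "\<lambda>j. r * b' j + b j"])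
    qed
    ultimately obtain b where
      b: "shift s * (sect a * Var k) - (\<Sum>j<c. b j * shift (g j)) \<in> vars_null ka 0" by blast
    define al where "al i = (if i = k then shift s * sect a else - b (the_inv_into {..<c} p i))" for i
    have alp: "al (p j) = - b j" if "j < c" for j
      using that kp the_inv_into_f_f[OF p(1)] by (auto simp: al_def)
    have "(\<Sum>i<n. al i * w i) = shift s * sect a * Var k - (\<Sum>j<c. b j * w (p j))"
      by (simp add: split alp wk sum_negf) (simp add: al_def)
    also have "\<dots> = (shift s * (sect a * Var k) - (\<Sum>j<c. b j * shift (g j))) +
        (\<Sum>j<c. b j * (shift (g j) - w (p j)))"
      by (simp add: right_diff_distrib sum_subtractf mult.assoc)
    also have "\<dots> \<in> vars_null ka 0"
      using wp by (intro ri.subspace_add[OF Z] b ri.subspace_sum[OF Z] ri.subspace_scale[OF Z]) simp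
    finally have rel: "(\<Sum>i<n. al i * w i) \<in> vars_null ka 0" .
    \<comment> \<open>The same relation in the variables themselves, where \<open>koszul\<close>
      applies.\<close>
    define be where "be l = (\<Sum>i<n. al i * W i l)" for l
    have "(\<Sum>l<n. be l * Var l) = (\<Sum>l<n. \<Sum>i<n. al i * W i l * Var l)"
      by (simp add: be_def sum_distrib_right)
    also have "\<dots> = (\<Sum>i<n. \<Sum>l<n. al i * W i l * Var l)" by (rule sum.swap)
    also have "\<dots> = (\<Sum>i<n. al i * w i)" by (simp add: w_def sum_distrib_left mult.assoc)
    finally have "(\<Sum>l<n. be l * Var l) \<in> vars_null ka 0" using rel by simp
    from koszul[OF ring_map_ka this] obtain S where
      S: "\<forall>i j. S i j = - S j i" "\<forall>i. S i i = 0"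
        "\<forall>i<n. be i - (\<Sum>j<n. S i j * Var j) \<in> vars_null ka 0"
      by (elim exE conjE) (rule that)
    have beL: "(\<Sum>l<n. be l * L l k) = d * al k"
    proof -
      have "(\<Sum>l<n. be l * L l k) = (\<Sum>l<n. \<Sum>i<n. al i * W i l * L l k)"
        by (simp add: be_def sum_distrib_right)
      also have "\<dots> = (\<Sum>i<n. \<Sum>l<n. al i * W i l * L l k)" by (rule sum.swap)
      also have "\<dots> = (\<Sum>i<n. al i * (\<Sum>l<n. W i l * L l k))"
        by (simp add: sum_distrib_left mult.assoc)
      also have "\<dots> = (\<Sum>i<n. if i = k then al i * d else 0)"
        using WL kn by (intro sum.cong refl) simp
      also have "\<dots> = d * al k" using kn by (simp add: mult.commute)
      finally show ?thesis .
    qed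
    \<comment> \<open>Row \<open>k\<close> of the matrix transpose(L) S L, which is alternating
      because \<open>S\<close> is; hence the entry at \<open>k\<close> is 0.\<close>
    define cf where "cf i = (\<Sum>l<n. \<Sum>j<n. L l k * S l j * L j i)" for i
    have cfk: "cf k = 0"
    proof -
      have "L l k * S l j * L j k = - (L j k * S j l * L l k)" for l j
      proof -
        have "L l k * S l j * L j k = L l k * (- S j l) * L j k"
          by (subst S(1)[rule_format, of l j]) (rule refl)
        then show ?thesis by (simp add: ac_simps)
      qed
      then show ?thesis
        unfolding cf_def by (rule sum_alternating) (simp add: S(2))
    qed
    have "d * (\<Sum>l<n. L l k * (\<Sum>j<n. S l j * Var j)) = (\<Sum>l<n. \<Sum>j<n. L l k * S l j * (d * Var j))"
      by (simp add: sum_distrib_left ac_simps)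
    also have "\<dots> = (\<Sum>l<n. \<Sum>j<n. \<Sum>i<n. L l k * S l j * L j i * w i)"
      by (intro sum.cong refl) (simp add: Lw[symmetric] sum_distrib_left mult.assoc)
    also have "\<dots> = (\<Sum>l<n. \<Sum>i<n. \<Sum>j<n. L l k * S l j * L j i * w i)"
      by (intro sum.cong refl sum.swap)
    also have "\<dots> = (\<Sum>i<n. \<Sum>l<n. \<Sum>j<n. L l k * S l j * L j i * w i)"
      by (rule sum.swap)
    also have "\<dots> = (\<Sum>i<n. cf i * w i)" by (simp add: cf_def sum_distrib_right)
    also have "\<dots> = (\<Sum>j<c. cf (p j) * w (p j))" by (simp add: split cfk)
    finally have Sw: "d * (\<Sum>l<n. L l k * (\<Sum>j<n. S l j * Var j)) = (\<Sum>j<c. cf (p j) * w (p j))" .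
    have "e * sect a = d * (\<Sum>l<n. be l * L l k)"
      by (simp add: beL e_def al_def ac_simps)
    also have "\<dots> = d * (\<Sum>l<n. L l k * (be l - (\<Sum>j<n. S l j * Var j))) +
        d * (\<Sum>l<n. L l k * (\<Sum>j<n. S l j * Var j))"
      by (simp add: right_diff_distrib sum_subtractf mult.commute)
    finally have ea: "e * sect a = d * (\<Sum>l<n. L l k * (be l - (\<Sum>j<n. S l j * Var j))) +
        (\<Sum>j<c. cf (p j) * w (p j))"
      unfolding Sw .
    have "d * (\<Sum>l<n. L l k * (be l - (\<Sum>j<n. S l j * Var j))) \<in> vars_null ka 0"
      using S(3) by (intro ri.subspace_scale[OF Z] ri.subspace_sum[OF Z]) simp
    then have "spec (d * (\<Sum>l<n. L l k * (be l - (\<Sum>j<n. S l j * Var j)))) \<in> tensor_null"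
      by (rule spec_vars_null)
    moreover have "spec (\<Sum>j<c. cf (p j) * w (p j)) \<in> tensor_null"
      unfolding spec.sum spec.mult using spec_wp
      by (intro ri.subspace_sum[OF tensor_null_ideal] ri.subspace_scale[OF tensor_null_ideal]) simp
    ultimately have "spec (e * sect a) \<in> tensor_null"
      unfolding ea spec.add[of "d * _"] by (rule ri.subspace_add[OF tensor_null_ideal])
    moreover have "spec (e * sect a) \<simeq> spec e * a"
      unfolding spec.mult by (intro eqt_mult eqt_refl spec_sect)
    ultimately show ?thesis using eqt_mem by blast
  qed
  moreover have "mu (spec e) \<notin> q"
  proof -
    have "eps d \<notin> q" using d by (simp add: Q_def)
    then have "eps d * eps d * peval x s \<notin> q" using q' s(1) by blast
    then show ?thesis by (simp add: e_def eps.mult eps_shift flip: eps_def)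
  qed
  ultimately show ?thesis by blast
qed

end

section \<open>Double derivations\<close>

context comm_algebra
begin

text \<open>A derivation of R into the tensor square as a bimodule. Such maps correspond to linear
  functionals on the diagonal ideal, given by their values on the \<open>Delta a\<close>.\<close>

definition tderiv :: "('r \<Rightarrow> ('v, 'r) tens) \<Rightarrow> bool" where
  "tderiv G \<longleftrightarrow> (\<forall>a b. G (a + b) \<simeq> G a + G b) \<and> (\<forall>v a. G (v *s a) \<simeq> Const v * G a) \<and>
     (\<forall>a b. G (a * b) \<simeq> tn a 1 * G b + tn 1 b * G a)"

lemma Delta_linear: "Delta (a + b) \<simeq> Delta a + Delta b" "Delta (v *s a) \<simeq> Const v * Delta a"
proof -
  have "Delta (a + b) \<simeq> (tn 1 a + tn 1 b) - (tn a 1 + tn b 1)"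
    unfolding Delta_def by (intro eqt_diff tn_linear)
  then show "Delta (a + b) \<simeq> Delta a + Delta b" by (simp add: Delta_def algebra_simps)
  have "Delta (v *s a) \<simeq> Const v * tn 1 a - Const v * tn a 1"
    unfolding Delta_def by (intro eqt_diff tn_linear)
  then show "Delta (v *s a) \<simeq> Const v * Delta a" by (simp add: Delta_def right_diff_distrib)
qed

lemma tderiv_Delta: "tderiv Delta"
  by (simp add: tderiv_def Delta_linear Delta_mult)

lemma tderiv_scale:
  assumes "tderiv G"
  shows "tderiv (\<lambda>a. f * G a)"
proof -
  have "f * G (a + b) \<simeq> f * (G a + G b)" "f * G (v *s a) \<simeq> f * (Const v * G a)"
    "f * G (a * b) \<simeq> f * (tn a 1 * G b + tn 1 b * G a)" for a b v
    using assms by (auto simp: tderiv_def intro!: eqt_mult)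
  then show ?thesis by (simp add: tderiv_def distrib_left mult.left_commute)
qed

text \<open>The elements \<open>f\<close> such that multiplication by \<open>f\<close> on the diagonal ideal factors through a free
  module; they form an ideal.\<close>

definition splits :: "('v, 'r) tens \<Rightarrow> bool" where
  "splits f \<longleftrightarrow> (\<exists>Gs. (\<forall>p\<in>set Gs. tderiv (snd p)) \<and>
     (\<forall>a. (\<Sum>p\<leftarrow>Gs. snd p a * Delta (fst p)) \<simeq> f * Delta a))"

lemma splits_cong:
  assumes "splits f" "f \<simeq> g"
  shows "splits g"
proof -
  have "f * Delta a \<simeq> g * Delta a" for a by (intro eqt_mult assms eqt_refl)
  with assms(1) show ?thesis unfolding splits_def by (meson eqt_trans)
qed

lemma splits_zero: "splits 0"
  unfolding splits_def by (rule exI[of _ "[]"]) simp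

text \<open>The inclusion of the diagonal ideal is itself a functional, with derivation
  \<open>Delta\<close>; commutativity of the tensor square lets \<open>Delta a\<close> and
  \<open>Delta b\<close> exchange their roles.\<close>

lemma splits_Delta: "splits (Delta b)"
  unfolding splits_def by (rule exI[of _ "[(b, Delta)]"]) (simp add: tderiv_Delta mult.commute)

lemma splits_add:
  assumes "splits f" "splits g"
  shows "splits (f + g)"
proof -
  from assms obtain Gs Hs where
    "\<forall>p\<in>set Gs. tderiv (snd p)" "\<forall>a. (\<Sum>p\<leftarrow>Gs. snd p a * Delta (fst p)) \<simeq> f * Delta a"
    "\<forall>p\<in>set Hs. tderiv (snd p)" "\<forall>a. (\<Sum>p\<leftarrow>Hs. snd p a * Delta (fst p)) \<simeq> g * Delta a"
    unfolding splits_def by (elim exE conjE) (rule that)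
  then show ?thesis
    unfolding splits_def
    by (intro exI[of _ "Gs @ Hs"]) (auto simp: distrib_right intro: eqt_add)
qed

lemma splits_mult:
  assumes "splits f"
  shows "splits (g * f)"
proof -
  from assms obtain Gs where
    Gs: "\<forall>p\<in>set Gs. tderiv (snd p)" "\<forall>a. (\<Sum>p\<leftarrow>Gs. snd p a * Delta (fst p)) \<simeq> f * Delta a"
    unfolding splits_def by (elim exE conjE) (rule that)
  define Hs where "Hs = map (\<lambda>p. (fst p, \<lambda>a. g * snd p a)) Gs"
  have "(\<Sum>p\<leftarrow>Hs. snd p a * Delta (fst p)) = g * (\<Sum>p\<leftarrow>Gs. snd p a * Delta (fst p))" for a
    by (simp add: Hs_def sum_list_const_mult[symmetric] o_def mult.assoc)
  then have "(\<Sum>p\<leftarrow>Hs. snd p a * Delta (fst p)) \<simeq> g * f * Delta a" for a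
    using Gs(2) by (simp add: mult.assoc eqt_mult)
  moreover have "\<forall>p\<in>set Hs. tderiv (snd p)"
    using Gs(1) tderiv_scale by (auto simp: Hs_def)
  ultimately show ?thesis unfolding splits_def by blast
qed

text \<open>The difference lies in the diagonal ideal, hence is a combination of the
  \<open>Delta b\<close>: on pure tensors, a (x) b - ab (x) 1 = (a (x) 1) Delta b.\<close>

lemma splits_diff_mu: "splits (f - tn (mu f) 1)"
proof (induction f rule: poly_mapping_add_induct)
  case zero
  show ?case
    using eqt_diff[OF eqt_refl[of 0] eqt_sym[OF tn_zero(1)[of 1]]] splits_zero splits_cong
    by (simp add: mu.zero)
next
  case (single k c)
  let ?a = "of_mm (fst k)" and ?b = "of_mm (snd k)"
  have "mu (Poly_Mapping.single k c) = c *s (?a * ?b)"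
    by (subst single_eq_tn) (simp only: mu.mult mu_Const mu_tn sc_mult)
  then have "Poly_Mapping.single k c - tn (mu (Poly_Mapping.single k c)) 1 \<simeq>
      Const c * tn ?a ?b - Const c * tn (?a * ?b) 1"
    by (subst single_eq_tn) (simp only: eqt_diff eqt_refl tn_linear)
  moreover have "Const c * tn ?a ?b - Const c * tn (?a * ?b) 1 = Const c * tn ?a 1 * Delta ?b"
    by (simp add: Delta_def right_diff_distrib mult.assoc tn_mult)
  ultimately have "Const c * tn ?a 1 * Delta ?b \<simeq>
      Poly_Mapping.single k c - tn (mu (Poly_Mapping.single k c)) 1"
    using eqt_sym by simp
  then show ?case by (rule splits_cong[OF splits_mult[OF splits_Delta]])
next
  case (add f g)
  have "(f + g) - (tn (mu f) 1 + tn (mu g) 1) \<simeq> (f + g) - tn (mu (f + g)) 1"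
    unfolding mu.add by (intro eqt_diff eqt_refl eqt_sym[OF tn_linear(1)])
  with splits_add[OF add] show ?case
    using splits_cong by (simp add: algebra_simps)
qed

text \<open>The quotient \<open>a f\<close> of \<open>d * Delta f\<close> by \<open>Delta z\<close>
  is determined only up to elements killed by \<open>d\<close>. A second factor \<open>d\<close>
  removes the ambiguity and turns the quotient into a derivation.\<close>

lemma splits_square:
  assumes gen: "\<forall>f. \<exists>a. d * Delta f \<simeq> a * Delta z"
    and reg: "\<forall>a. a * Delta z \<in> tensor_null \<longrightarrow> d * a \<in> tensor_null"
  shows "splits (d * d)"
proof -
  from choice[OF gen] obtain a where a: "\<forall>f. d * Delta f \<simeq> a f * Delta z" ..
  note aa = a[rule_format]
  note a' = eqt_sym[OF aa]
  have cancel: "d * u \<simeq> d * w" if "u * Delta z \<simeq> w * Delta z" for u w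
    using reg that by (simp add: eqmod_def flip: left_diff_distrib right_diff_distrib)
  have "d * a (f + g) \<simeq> d * (a f + a g)" for f g
  proof (rule cancel)
    have "a (f + g) * Delta z \<simeq> d * Delta (f + g)" by (rule a')
    also have "d * Delta (f + g) \<simeq> d * (Delta f + Delta g)"
      by (intro eqt_mult eqt_refl Delta_linear)
    also have "d * (Delta f + Delta g) = d * Delta f + d * Delta g" by (rule distrib_left)
    also have "\<dots> \<simeq> a f * Delta z + a g * Delta z" by (rule eqt_add[OF aa aa])
    finally show "a (f + g) * Delta z \<simeq> (a f + a g) * Delta z" by (simp only: distrib_right)
  qed
  moreover have "d * a (v *s f) \<simeq> d * (Const v * a f)" for v f
  proof (rule cancel)
    have "a (v *s f) * Delta z \<simeq> d * Delta (v *s f)" by (rule a')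
    also have "d * Delta (v *s f) \<simeq> d * (Const v * Delta f)"
      by (intro eqt_mult eqt_refl Delta_linear)
    also have "d * (Const v * Delta f) = Const v * (d * Delta f)" by (rule mult.left_commute)
    also have "\<dots> \<simeq> Const v * (a f * Delta z)" by (rule eqt_mult[OF eqt_refl aa])
    finally show "a (v *s f) * Delta z \<simeq> Const v * a f * Delta z" by (simp only: mult.assoc)
  qed
  moreover have "d * a (f * g) \<simeq> d * (tn f 1 * a g + tn 1 g * a f)" for f g
  proof (rule cancel)
    have "a (f * g) * Delta z \<simeq> d * Delta (f * g)" by (rule a')
    also have "d * Delta (f * g) = tn f 1 * (d * Delta g) + tn 1 g * (d * Delta f)"
      by (simp only: Delta_mult distrib_left mult.left_commute)
    also have "\<dots> \<simeq> tn f 1 * (a g * Delta z) + tn 1 g * (a f * Delta z)"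
      by (rule eqt_add[OF eqt_mult[OF eqt_refl aa] eqt_mult[OF eqt_refl aa]])
    finally show "a (f * g) * Delta z \<simeq> (tn f 1 * a g + tn 1 g * a f) * Delta z"
      by (simp only: distrib_right mult.assoc)
  qed
  ultimately have "tderiv (\<lambda>f. d * a f)"
    by (simp add: tderiv_def distrib_left mult.left_commute)
  moreover have "d * a f * Delta z \<simeq> d * d * Delta f" for f
    using eqt_mult[OF eqt_refl[of d] a'[of f]] by (simp only: mult.assoc)
  ultimately show ?thesis
    unfolding splits_def by (intro exI[of _ "[(z, \<lambda>f. d * a f)]"]) simp
qed

lemma double_derivations:
  assumes noeth: "\<And>n. noetherian (polys_in n :: 'v mpoly set)"
    and smooth: "smooth_of_relative_dimension 1"
  shows "\<exists>Gs. (\<forall>p\<in>set Gs. tderiv (snd p)) \<and> (\<forall>a. (\<Sum>p\<leftarrow>Gs. snd p a * Delta (fst p)) \<simeq> Delta a)"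
proof -
  have local: "\<exists>d. mu d \<notin> q \<and> splits (d * d)" if q: "ring_prime_ideal q" for q
  proof -
    have "smooth_at 1 q" using smooth q by (simp add: smooth_of_relative_dimension_def)
    then obtain c x and g :: "nat \<Rightarrow> 'v mpoly" where
      gen: "generates (c + 1) x"
      and g: "\<forall>j<c. g j \<in> polys_in (c + 1) \<and> peval x (g j) = 0"
      and loc: "\<forall>h\<in>polys_in (c + 1). peval x h = 0 \<longrightarrow>
        (\<exists>s\<in>polys_in (c + 1). peval x s \<notin> q \<and>
          (\<exists>b. (\<forall>j<c. b j \<in> polys_in (c + 1)) \<and> s * h = (\<Sum>j<c. b j * g j)))"
      and jac: "\<forall>r. (\<forall>k<c + 1. (\<Sum>j<c. r j * peval x (partial_deriv k (g j))) \<in> q) \<longrightarrow>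
        (\<forall>j<c. r j \<in> q)"
      unfolding smooth_at_def by (elim exE conjE) (rule that)
    \<comment> \<open>The presentation varies with \<open>q\<close>; the tensor square,
      \<open>mu\<close> and \<open>splits\<close> do not depend on it.\<close>
    interpret pr: presentation scale "c + 1" x
      by unfold_locales (rule gen)
    have loc': "\<forall>h\<in>pr.relations. \<exists>s\<in>polys_in (c + 1). peval x s \<notin> q \<and>
      (\<exists>b. (\<forall>j<c. b j \<in> polys_in (c + 1)) \<and> s * h = (\<Sum>j<c. b j * g j))"
      using loc unfolding pr.relations_def by simp
    from pr.uniform_denominator[OF noeth q loc'] obtain s where
      s: "peval x s \<notin> q" "\<forall>h\<in>pr.relations. \<exists>b. s * h = (\<Sum>j<c. b j * g j)" by (elim exE conjE)
    have g': "\<forall>j<c. g j \<in> pr.relations" using g unfolding pr.relations_def by simp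
    have "c + 1 = Suc c" by simp
    from pr.diagonal_locally_principal[OF this q g' s jac] obtain z d where
      "mu d \<notin> q" "\<forall>f. \<exists>a. d * Delta f \<simeq> a * Delta z"
      "\<forall>a. a * Delta z \<in> tensor_null \<longrightarrow> d * a \<in> tensor_null" by (elim exE conjE)
    then show ?thesis using splits_square by (intro exI[of _ d] conjI)
  qed
  define I where "I = mu ` {f. splits f}"
  have "ring_ideal I"
    unfolding ring_ideal_def
  proof (intro conjI ballI allI)
    show "0 \<in> I" using splits_zero mu.zero unfolding I_def by (metis image_eqI mem_Collect_eq)
    fix a assume "a \<in> I"
    then obtain f where f: "splits f" "a = mu f" by (auto simp: I_def)
    show "a + b \<in> I" if "b \<in> I" for b
    proof -
      from that obtain g where "splits g" "b = mu g" by (auto simp: I_def)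
      then have "a + b = mu (f + g)" "splits (f + g)" using f splits_add by (auto simp: mu.add)
      then show ?thesis by (simp add: I_def)
    qed
    show "b * a \<in> I" for b
    proof -
      have "b * a = mu (tn b 1 * f)" "splits (tn b 1 * f)" using f splits_mult by (auto simp: mu.mult)
      then show ?thesis by (simp add: I_def)
    qed
  qed
  have "1 \<in> I"
  proof (rule ccontr)
    assume "1 \<notin> I"
    from prime_ideal_supset[OF \<open>ring_ideal I\<close> this] obtain q where q: "ring_prime_ideal q" "I \<subseteq> q" .
    from local[OF q(1)] obtain d where "mu d \<notin> q" "splits (d * d)" by blast
    then have "mu d * mu d \<in> q" using q(2) by (auto simp: I_def mu.mult[symmetric])
    then show False using q(1) \<open>mu d \<notin> q\<close> unfolding ring_prime_ideal_def by blast
  qed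
  \<comment> \<open>An element over 1 in R is enough: \<open>f - 1\<close> comes from the diagonal
    ideal, so it splits as well, and 1 is the difference of the two.\<close>
  then obtain f where "splits f" "mu f = 1" unfolding I_def by auto
  with splits_diff_mu[of f] have "splits (f - 1)" by (simp add: tn_one)
  from splits_add[OF \<open>splits f\<close> splits_mult[OF this, of "- 1"]] have "splits 1" by simp
  then show ?thesis by (simp add: splits_def)
qed

section \<open>The connection\<close>

definition eqf :: "('v, 'r) preform \<Rightarrow> ('v, 'r) preform \<Rightarrow> bool" (infix \<open>\<doteq>\<close> 50) where
  "f \<doteq> g \<longleftrightarrow> cls f = cls g"

lemma eqf_refl [simp]: "f \<doteq> f"
  by (simp add: eqf_def)

lemma eqf_sym: "f \<doteq> g \<Longrightarrow> g \<doteq> f"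
  by (simp add: eqf_def)

lemma eqf_trans [trans]: "f \<doteq> g \<Longrightarrow> g \<doteq> h \<Longrightarrow> f \<doteq> h"
  by (simp add: eqf_def)

lemma eqf_add: "f \<doteq> f' \<Longrightarrow> g \<doteq> g' \<Longrightarrow> f + g \<doteq> f' + g'"
  by (simp add: eqf_def flip: form_add_cls)

lemma eqf_scale: "f \<doteq> f' \<Longrightarrow> fscale c f \<doteq> fscale c f'"
  by (simp add: eqf_def flip: form_scale_cls)

lemma eqf_diff:
  assumes "f \<doteq> f'" "g \<doteq> g'"
  shows "f - g \<doteq> f' - g'"
proof -
  have minus: "f - g = f + fscale (- 1) g" for f g :: "('v, 'r) preform"
    by (rule poly_mapping_eqI) (simp add: lookup_add lookup_minus)
  show ?thesis unfolding minus by (intro eqf_add eqf_scale assms)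
qed

lemma eqf_lmul: "f \<doteq> f' \<Longrightarrow> pre_lmul a f \<doteq> pre_lmul a f'"
  by (simp add: eqf_def flip: form_lmul_cls)

lemma eqf_rmul: "f \<doteq> f' \<Longrightarrow> pre_rmul a f \<doteq> pre_rmul a f'"
  by (simp add: eqf_def flip: form_rmul_cls)

lemma eqf_sum_list: "(\<And>p. p \<in> set ps \<Longrightarrow> f p \<doteq> g p) \<Longrightarrow> (\<Sum>p\<leftarrow>ps. f p) \<doteq> (\<Sum>p\<leftarrow>ps. g p)"
  by (induction ps) (simp_all add: eqf_add)

lemma bas_linear:
  "bas (z + w) xs \<doteq> bas z xs + bas w xs"
  "bas (unital_scale c z) xs \<doteq> fscale c (bas z xs)"
  "bas z (us @ (x + y) # vs) \<doteq> bas z (us @ x # vs) + bas z (us @ y # vs)"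
  "bas z (us @ (c *s x) # vs) \<doteq> fscale c (bas z (us @ x # vs))"
  unfolding eqf_def cls_eq_iff using tensor_relations.intros[THEN null_forms_base]
  by (simp_all flip: diff_diff_eq)

lemma bas_linear0:
  "bas (a + b, 0) xs \<doteq> bas (a, 0) xs + bas (b, 0) xs"
  "bas (c *s a, 0) xs \<doteq> fscale c (bas (a, 0) xs)"
  using bas_linear(1)[of "(a, 0)" "(b, 0)"] bas_linear(2)[of c "(a, 0)"]
  by (simp_all add: unital_scale_def)

lemma bas_linear12:
  "bas z [x + x', y] \<doteq> bas z [x, y] + bas z [x', y]"
  "bas z [c *s x, y] \<doteq> fscale c (bas z [x, y])"
  "bas z [x, y + y'] \<doteq> bas z [x, y] + bas z [x, y']"
  "bas z [x, c *s y] \<doteq> fscale c (bas z [x, y])"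
  using bas_linear(3)[of z "[]" x x' "[y]"] bas_linear(4)[of z "[]" c x "[y]"]
    bas_linear(3)[of z "[x]" y y' "[]"] bas_linear(4)[of z "[x]" c y "[]"] by simp_all

lemma bas_split: "bas z xs \<doteq> bas (fst z, 0) xs + fscale (snd z) (bas (0, 1) xs)"
proof -
  have "bas z xs = bas ((fst z, 0) + unital_scale (snd z) (0, 1)) xs"
    by (simp add: unital_scale_def)
  also have "\<dots> \<doteq> bas (fst z, 0) xs + bas (unital_scale (snd z) (0, 1)) xs"
    by (rule bas_linear(1))
  also have "\<dots> \<doteq> bas (fst z, 0) xs + fscale (snd z) (bas (0, 1) xs)"
    by (intro eqf_add eqf_refl bas_linear(2))
  finally show ?thesis .
qed

lemma preform_induct [case_names zero basis add]:
  assumes "P 0" and "\<And>c z xs. P (fscale c (bas z xs))" and "\<And>f g. P f \<Longrightarrow> P g \<Longrightarrow> P (f + g)"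
  shows "P (f :: ('v, 'r) preform)"
proof (induction f rule: poly_mapping_add_induct)
  case (single k c)
  have "Poly_Mapping.single k c = fscale c (bas (fst k) (snd k))"
    by (rule poly_mapping_eqI) (simp add: bas_def lookup_single when_def)
  then show ?case using assms(2) by simp
qed (use assms in auto)

sublocale lmul: module_hom fscale fscale "pre_lmul a" for a
  unfolding pre_lmul_def by (rule lin_ext_hom)

sublocale rmul: module_hom fscale fscale "pre_rmul a" for a
  unfolding pre_rmul_def by (rule lin_ext_hom)

sublocale muld: module_hom fscale fscale "pre_mul_d a" for a
  unfolding pre_mul_d_def by (rule lin_ext_hom)

lemma pre_lmul_bas [simp]: "pre_lmul a (bas z xs) = bas (unital_mult (a, 0) z) xs"
  by (simp add: pre_lmul_def)

lemma pre_mul_d_bas [simp]: "pre_mul_d a (bas z xs) = bas z (xs @ [a])"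
  by (simp add: pre_mul_d_def)

lemma pre_rmul_bas [simp]:
  "pre_rmul a (bas z [x]) = bas z [x * a] - bas (unital_mult z (x, 0)) [a]"
  "pre_rmul a (bas z [x, y]) =
    bas z [x, y * a] - bas z [x * y, a] + bas (unital_mult z (x, 0)) [y, a]"
  by (simp_all add: pre_rmul_def muld.diff)

lemma unital_mult_simps [simp]:
  "unital_mult (a, 0) (b, 0) = (a * b, 0)" "unital_mult (a, 0) (0, 1) = (a, 0)"
  "unital_mult (0, 1) (a, 0) = (a, 0)"
  by (simp_all add: unital_mult_def)

lemma unital_mult_assoc: "unital_mult (unital_mult z w) u = unital_mult z (unital_mult w u)"
  by (simp add: unital_mult_def algebra_simps scale_mult mult_scale)

text \<open>Linearity in the acting element holds only up to null forms, since \<open>bas\<close> is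
  not additive in its first entry. Associativity holds on preforms exactly.\<close>

lemma lmul_linear:
  "pre_lmul (a + b) f \<doteq> pre_lmul a f + pre_lmul b f"
  "pre_lmul (c *s a) f \<doteq> fscale c (pre_lmul a f)"
  "pre_lmul (a * b) f = pre_lmul a (pre_lmul b f)"
proof -
  have z: "unital_mult (a + b, 0) z = unital_mult (a, 0) z + unital_mult (b, 0) z"
    "unital_mult (c *s a, 0) z = unital_scale c (unital_mult (a, 0) z)" for z
    by (simp_all add: unital_mult_def unital_scale_def algebra_simps scale_mult mult_scale)
  have "pre_lmul (a + b) (bas z xs) \<doteq> pre_lmul a (bas z xs) + pre_lmul b (bas z xs)"
    "pre_lmul (c *s a) (bas z xs) \<doteq> fscale c (pre_lmul a (bas z xs))" for z xs
    by (simp_all only: pre_lmul_bas z bas_linear)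
  note bas = this
  show "pre_lmul (a + b) f \<doteq> pre_lmul a f + pre_lmul b f"
  proof (induction f rule: preform_induct)
    case (basis k z xs)
    show ?case using eqf_scale[OF bas(1)] by (simp add: lmul.scale free.scale_right_distrib)
  next
    case (add f g)
    then show ?case using eqf_add[OF add] by (simp add: lmul.add algebra_simps)
  qed (simp add: lmul.zero)
  show "pre_lmul (c *s a) f \<doteq> fscale c (pre_lmul a f)"
  proof (induction f rule: preform_induct)
    case (basis k z xs)
    show ?case using eqf_scale[OF bas(2), of k] by (simp add: lmul.scale mult.commute)
  next
    case (add f g)
    then show ?case using eqf_add[OF add] by (simp add: lmul.add free.scale_right_distrib)
  qed (simp add: lmul.zero)
  show "pre_lmul (a * b) f = pre_lmul a (pre_lmul b f)"
    by (induction f rule: preform_induct)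
      (simp_all add: lmul.zero lmul.scale lmul.add unital_mult_assoc[symmetric])
qed

definition homogeneous :: "nat \<Rightarrow> ('v, 'r) preform \<Rightarrow> bool" where
  "homogeneous n f \<longleftrightarrow> (\<forall>k\<in>Poly_Mapping.keys f. length (snd k) = n)"

lemma homogeneous_intros:
  "homogeneous n 0" "length xs = n \<Longrightarrow> homogeneous n (bas z xs)"
  "homogeneous n f \<Longrightarrow> homogeneous n g \<Longrightarrow> homogeneous n (f + g)"
  "homogeneous n f \<Longrightarrow> homogeneous n g \<Longrightarrow> homogeneous n (f - g)"
  "homogeneous n f \<Longrightarrow> homogeneous n (fscale c f)"
  using keys_add[of f g] keys_diff[of f g]
  by (auto simp: homogeneous_def bas_def in_keys_iff lookup_add lookup_minus lookup_single when_def
      split: if_splits)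

lemma homogeneous_sum: "(\<And>i. i \<in> A \<Longrightarrow> homogeneous n (f i)) \<Longrightarrow> homogeneous n (sum f A)"
  by (induction A rule: infinite_finite_induct) (auto intro: homogeneous_intros)

lemma homogeneous_sum_list: "(\<And>i. i \<in> set A \<Longrightarrow> homogeneous n (f i)) \<Longrightarrow> homogeneous n (\<Sum>i\<leftarrow>A. f i)"
  by (induction A) (auto intro: homogeneous_intros)

lemma homogeneous_lin_ext:
  "(\<And>k. k \<in> Poly_Mapping.keys f \<Longrightarrow> homogeneous n (h k)) \<Longrightarrow> homogeneous n (lin_ext h f)"
  unfolding lin_ext_def by (intro homogeneous_sum homogeneous_intros)

lemma homogeneous_induct [consumes 1, case_names zero basis add]:
  assumes "homogeneous n f" and "P 0" and basis: "\<And>c z xs. length xs = n \<Longrightarrow> P (fscale c (bas z xs))"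
    and add: "\<And>f g. P f \<Longrightarrow> P g \<Longrightarrow> P (f + g)"
  shows "P f"
proof -
  have single: "Poly_Mapping.single k c = fscale c (bas (fst k) (snd k))" for k and c :: 'v
    by (rule poly_mapping_eqI) (simp add: bas_def lookup_single when_def)
  have "P (\<Sum>k\<in>A. Poly_Mapping.single k (Poly_Mapping.lookup f k))"
    if "finite A" "A \<subseteq> Poly_Mapping.keys f" for A
    using that
  proof induction
    case (insert k A)
    then have "length (snd k) = n" using assms(1) by (auto simp: homogeneous_def)
    with insert show ?case by (auto simp: single intro!: add basis)
  qed (simp add: assms(2))
  moreover have "(\<Sum>k\<in>Poly_Mapping.keys f. Poly_Mapping.single k (Poly_Mapping.lookup f k)) = f"
    by (rule poly_mapping_eqI) (auto simp: lookup_sum lookup_single when_def in_keys_iff)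
  ultimately show ?thesis by (metis finite_keys order_refl)
qed

lemma Omega_iff: "A \<in> Omega n \<longleftrightarrow> (\<exists>f. homogeneous n f \<and> A = cls f)"
  by (auto simp: Omega_def homogeneous_def case_prod_beta)

lemma lmul_rmul:
  assumes "homogeneous 2 f"
  shows "pre_lmul a (pre_rmul b f) = pre_rmul b (pre_lmul a f)"
  using assms
proof (induction rule: homogeneous_induct)
  case (basis c z xs)
  then obtain x y where "xs = [x, y]" by (auto simp: length_Suc_conv numeral_2_eq_2)
  then show ?case
    by (simp add: lmul.scale rmul.scale lmul.diff lmul.add unital_mult_assoc)
qed (simp_all add: lmul.zero rmul.zero lmul.add rmul.add)

text \<open>Writing \<open>e\<close> for the unit of the algebra and \<open>D x = e dx - x de\<close>, the map \<open>cut z\<close> takes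
  \<open>a \<otimes> b\<close> to \<open>a Dz Db\<close> and \<open>tail y\<close> takes \<open>\<Sum>i. a\<^sub>i \<otimes> b\<^sub>i\<close> in the diagonal ideal to
  \<open>(\<Sum>i. a\<^sub>i Db\<^sub>i) Dy\<close>.\<close>

definition cut :: "'r \<Rightarrow> ('v, 'r) tens \<Rightarrow> ('v, 'r) preform" where
  "cut z = lin_ext (\<lambda>k. let a = of_mm (fst k); b = of_mm (snd k) in
     bas (a, 0) [z, b] - bas (a * z, 0) [1, b] - bas (a, 0) [z * b, 1] + bas (a * z, 0) [b, 1])"

definition tail :: "'r \<Rightarrow> ('v, 'r) tens \<Rightarrow> ('v, 'r) preform" where
  "tail y = lin_ext (\<lambda>k. let a = of_mm (fst k); b = of_mm (snd k) in
     bas (a, 0) [b, y] - bas (a, 0) [b * y, 1])"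

sublocale cut: module_hom fscale fscale "cut z" for z
  unfolding cut_def by (rule lin_ext_hom)

sublocale tail: module_hom fscale fscale "tail y" for y
  unfolding tail_def by (rule lin_ext_hom)

lemma lin_ext_tn: "lin_ext h (tn a b) = h (to_mm a, to_mm b)"
  by (simp add: lin_ext_def tn_def)

lemma cut_tn: "cut z (tn a b) =
    bas (a, 0) [z, b] - bas (a * z, 0) [1, b] - bas (a, 0) [z * b, 1] + bas (a * z, 0) [b, 1]"
  by (simp add: cut_def lin_ext_tn)

lemma tail_tn: "tail y (tn a b) = bas (a, 0) [b, y] - bas (a, 0) [b * y, 1]"
  by (simp add: tail_def lin_ext_tn)

text \<open>\<open>cut z\<close> and \<open>tail y\<close> are linear over the base ring only; this
  suffices because \<open>tensor_null\<close> is already the span of the bilinearity relations over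
  the base ring.\<close>

lemma linear_tensor_null:
  assumes h: "module_hom fscale fscale h" and f: "f \<in> tensor_null"
    and lin: "\<And>a b c. h (tn (a + b) c) \<doteq> h (tn a c) + h (tn b c)"
      "\<And>a b c. h (tn a (b + c)) \<doteq> h (tn a b) + h (tn a c)"
      "\<And>v a b. h (tn (v *s a) b) \<doteq> fscale v (h (tn a b))"
      "\<And>v a b. h (tn a (v *s b)) \<doteq> fscale v (h (tn a b))"
  shows "h f \<doteq> 0"
proof -
  interpret h: module_hom fscale fscale h by (rule h)
  from f show ?thesis
  proof (induction rule: tensor_null_induct)
    case (add f g)
    then show ?case using eqf_add[of "h f" 0 "h g" 0] by (simp add: h.add)
  next
    case (rel v r)
    have "h r \<doteq> 0"
    proof -
      from rel consider a b c where "r = tn (a + b) c - (tn a c + tn b c)"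
        | a b c where "r = tn a (b + c) - (tn a b + tn a c)"
        | w a b where "r = tn (w *s a) b - fscale w (tn a b)"
        | w a b where "r = tn a (w *s b) - fscale w (tn a b)"
        unfolding tensor_rel_def fscale_eq_mult
        by (elim UnE CollectE exE conjE) (simp_all only: diff_diff_eq)
      then show ?thesis
      proof cases
        case 1
        show ?thesis using eqf_diff[OF lin(1) eqf_refl, of a b c "h (tn a c) + h (tn b c)"]
          by (simp add: 1 h.diff h.add)
      next
        case 2
        show ?thesis using eqf_diff[OF lin(2) eqf_refl, of a b c "h (tn a b) + h (tn a c)"]
          by (simp add: 2 h.diff h.add)
      next
        case 3
        show ?thesis using eqf_diff[OF lin(3) eqf_refl, of w a b "fscale w (h (tn a b))"]
          by (simp add: 3 h.diff h.scale)
      next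
        case 4
        show ?thesis using eqf_diff[OF lin(4) eqf_refl, of a w b "fscale w (h (tn a b))"]
          by (simp add: 4 h.diff h.scale)
      qed
    qed
    from eqf_scale[OF this, of v] show ?case by (simp add: h.scale flip: fscale_eq_mult)
  qed (simp add: h.zero)
qed

lemma cut_null: "f \<in> tensor_null \<Longrightarrow> cut z f \<doteq> 0"
proof (rule linear_tensor_null[OF cut.module_hom_axioms])
  fix a b c v
  have "cut z (tn (a + b) c) \<doteq>
      (bas (a, 0) [z, c] + bas (b, 0) [z, c]) - (bas (a * z, 0) [1, c] + bas (b * z, 0) [1, c]) -
      (bas (a, 0) [z * c, 1] + bas (b, 0) [z * c, 1]) + (bas (a * z, 0) [c, 1] + bas (b * z, 0) [c, 1])"
    unfolding cut_tn distrib_right by (intro eqf_add eqf_diff bas_linear0)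
  then show "cut z (tn (a + b) c) \<doteq> cut z (tn a c) + cut z (tn b c)"
    by (simp add: cut_tn algebra_simps)
  have "cut z (tn a (b + c)) \<doteq>
      (bas (a, 0) [z, b] + bas (a, 0) [z, c]) - (bas (a * z, 0) [1, b] + bas (a * z, 0) [1, c]) -
      (bas (a, 0) [z * b, 1] + bas (a, 0) [z * c, 1]) + (bas (a * z, 0) [b, 1] + bas (a * z, 0) [c, 1])"
    unfolding cut_tn distrib_left by (intro eqf_add eqf_diff bas_linear12)
  then show "cut z (tn a (b + c)) \<doteq> cut z (tn a b) + cut z (tn a c)"
    by (simp add: cut_tn algebra_simps)
  have "cut z (tn (v *s a) b) \<doteq>
      fscale v (bas (a, 0) [z, b]) - fscale v (bas (a * z, 0) [1, b]) -
      fscale v (bas (a, 0) [z * b, 1]) + fscale v (bas (a * z, 0) [b, 1])"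
    unfolding cut_tn scale_mult by (intro eqf_add eqf_diff bas_linear0)
  then show "cut z (tn (v *s a) b) \<doteq> fscale v (cut z (tn a b))"
    by (simp add: cut_tn free.scale_right_diff_distrib free.scale_right_distrib)
  have "cut z (tn a (v *s b)) \<doteq>
      fscale v (bas (a, 0) [z, b]) - fscale v (bas (a * z, 0) [1, b]) -
      fscale v (bas (a, 0) [z * b, 1]) + fscale v (bas (a * z, 0) [b, 1])"
    unfolding cut_tn mult_scale by (intro eqf_add eqf_diff bas_linear12)
  then show "cut z (tn a (v *s b)) \<doteq> fscale v (cut z (tn a b))"
    by (simp add: cut_tn free.scale_right_diff_distrib free.scale_right_distrib)
qed

lemma tail_null: "f \<in> tensor_null \<Longrightarrow> tail y f \<doteq> 0"
proof (rule linear_tensor_null[OF tail.module_hom_axioms])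
  fix a b c v
  have "tail y (tn (a + b) c) \<doteq>
      (bas (a, 0) [c, y] + bas (b, 0) [c, y]) - (bas (a, 0) [c * y, 1] + bas (b, 0) [c * y, 1])"
    unfolding tail_tn by (intro eqf_diff bas_linear0)
  then show "tail y (tn (a + b) c) \<doteq> tail y (tn a c) + tail y (tn b c)"
    by (simp add: tail_tn algebra_simps)
  have "tail y (tn a (b + c)) \<doteq>
      (bas (a, 0) [b, y] + bas (a, 0) [c, y]) - (bas (a, 0) [b * y, 1] + bas (a, 0) [c * y, 1])"
    unfolding tail_tn distrib_right by (intro eqf_diff bas_linear12)
  then show "tail y (tn a (b + c)) \<doteq> tail y (tn a b) + tail y (tn a c)"
    by (simp add: tail_tn algebra_simps)
  have "tail y (tn (v *s a) b) \<doteq> fscale v (bas (a, 0) [b, y]) - fscale v (bas (a, 0) [b * y, 1])"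
    unfolding tail_tn by (intro eqf_diff bas_linear0)
  then show "tail y (tn (v *s a) b) \<doteq> fscale v (tail y (tn a b))"
    by (simp add: tail_tn free.scale_right_diff_distrib)
  have "tail y (tn a (v *s b)) \<doteq> fscale v (bas (a, 0) [b, y]) - fscale v (bas (a, 0) [b * y, 1])"
    unfolding tail_tn scale_mult by (intro eqf_diff bas_linear12)
  then show "tail y (tn a (v *s b)) \<doteq> fscale v (tail y (tn a b))"
    by (simp add: tail_tn free.scale_right_diff_distrib)
qed

lemma cut_eqt: "f \<simeq> g \<Longrightarrow> cut z f \<doteq> cut z g"
  using eqf_add[OF cut_null[of "f - g" z] eqf_refl, of "cut z g"] by (simp add: eqmod_def cut.diff)

lemma tail_eqt: "f \<simeq> g \<Longrightarrow> tail y f \<doteq> tail y g"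
  using eqf_add[OF tail_null[of "f - g" y] eqf_refl, of "tail y g"] by (simp add: eqmod_def tail.diff)

lemma cut_lmul: "cut z (tn x 1 * f) = pre_lmul x (cut z f)"
proof (induction f rule: poly_mapping_add_induct)
  case (single k c)
  let ?t = "tn (of_mm (fst k)) (of_mm (snd k))"
  have "cut z (tn x 1 * ?t) = pre_lmul x (cut z ?t)"
    by (simp add: tn_mult cut_tn lmul.diff lmul.add mult.assoc)
  moreover have "Poly_Mapping.single k c = fscale c ?t"
    by (subst single_eq_tn) (simp add: fscale_eq_mult)
  moreover have "tn x 1 * fscale c ?t = fscale c (tn x 1 * ?t)"
    by (simp only: fscale_eq_mult mult.left_commute)
  ultimately show ?case by (simp only: cut.scale lmul.scale)
qed (simp_all add: cut.zero cut.add lmul.zero lmul.add distrib_left)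

text \<open>The Leibniz rule in the last factor: a Dz D(b y) = (a Dz Db) y + a (Dz) b Dy. The last
  form is \<open>tail y\<close> of (a (x) b) Delta z, because (Dz) b = D(z b) - z Db.\<close>

lemma cut_rmul: "cut z (tn 1 y * f) = pre_rmul y (cut z f) + tail y (f * Delta z)"
proof (induction f rule: poly_mapping_add_induct)
  case (single k c)
  let ?a = "of_mm (fst k)" and ?b = "of_mm (snd k)"
  let ?t = "tn ?a ?b :: ('v, 'r) tens"
  have "?t * Delta z = tn ?a (z * ?b) - tn (?a * z) ?b"
    by (simp add: Delta_def right_diff_distrib tn_mult mult.commute[of ?b z])
  then have tail: "tail y (?t * Delta z) = tail y (tn ?a (z * ?b)) - tail y (tn (?a * z) ?b)"
    by (simp only: tail.diff)
  have "cut z (tn 1 y * ?t) = pre_rmul y (cut z ?t) + tail y (?t * Delta z)"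
    unfolding tail
    by (simp add: tn_mult cut_tn tail_tn rmul.diff rmul.add mult.assoc mult.commute[of y])
  moreover have "Poly_Mapping.single k c = fscale c ?t"
    by (subst single_eq_tn) (simp add: fscale_eq_mult)
  moreover have "tn 1 y * fscale c ?t = fscale c (tn 1 y * ?t)"
    "fscale c ?t * Delta z = fscale c (?t * Delta z)"
    by (simp_all only: fscale_eq_mult mult.left_commute mult.assoc)
  ultimately show ?case by (simp only: cut.scale rmul.scale tail.scale free.scale_right_distrib)
qed (simp_all add: cut.zero cut.add rmul.zero rmul.add tail.zero tail.add distrib_left distrib_right)

text \<open>The difference between \<open>dx\<close> and \<open>D x\<close> is made of \<open>x de\<close> and \<open>de x\<close>; this term compensates for
  it, the algebra having a unit \<open>e\<close> that differs from that of its unitalisation.\<close>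

definition unit_part :: "'r \<Rightarrow> ('v, 'r) preform" where
  "unit_part x = bas (1, 0) [x, 1] - bas (x, 0) [1, 1] - bas (x, 0) [1, 1] +
     bas (0, 1) [1, x] - bas (1, 0) [1, x]"

text \<open>The term \<open>tail y (Delta x)\<close> is Dx Dy, so \<open>unit_part\<close> fails to
  be a derivation by exactly dx dy - Dx Dy.\<close>

lemma unit_part_mult:
  "unit_part (x * y) = pre_lmul x (unit_part y) + pre_rmul y (unit_part x) +
     bas (0, 1) [x, y] - tail y (Delta x)"
  by (simp add: unit_part_def Delta_def tail.diff tail_tn lmul.diff lmul.add rmul.diff rmul.add)

lemma unit_part_linear:
  "unit_part (x + y) \<doteq> unit_part x + unit_part y" "unit_part (c *s x) \<doteq> fscale c (unit_part x)"
proof -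
  have "unit_part (x + y) \<doteq> (bas (1, 0) [x, 1] + bas (1, 0) [y, 1]) - (bas (x, 0) [1, 1] + bas (y, 0) [1, 1]) -
      (bas (x, 0) [1, 1] + bas (y, 0) [1, 1]) + (bas (0, 1) [1, x] + bas (0, 1) [1, y]) -
      (bas (1, 0) [1, x] + bas (1, 0) [1, y])"
    unfolding unit_part_def by (intro eqf_add eqf_diff bas_linear0 bas_linear12)
  then show "unit_part (x + y) \<doteq> unit_part x + unit_part y"
    by (simp add: unit_part_def algebra_simps)
  have "unit_part (c *s x) \<doteq> fscale c (bas (1, 0) [x, 1]) - fscale c (bas (x, 0) [1, 1]) -
      fscale c (bas (x, 0) [1, 1]) + fscale c (bas (0, 1) [1, x]) - fscale c (bas (1, 0) [1, x])"
    unfolding unit_part_def by (intro eqf_add eqf_diff bas_linear0 bas_linear12)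
  then show "unit_part (c *s x) \<doteq> fscale c (unit_part x)"
    by (simp add: unit_part_def free.scale_right_diff_distrib free.scale_right_distrib)
qed

definition connection_form :: "('r \<times> ('r \<Rightarrow> ('v, 'r) tens)) list \<Rightarrow> 'r \<Rightarrow> ('v, 'r) preform" where
  "connection_form Gs x = (\<Sum>p\<leftarrow>Gs. cut (fst p) (snd p x)) + unit_part x"

lemma homogeneous_connection_form: "homogeneous 2 (connection_form Gs x)"
  unfolding connection_form_def unit_part_def cut_def Let_def
  by (intro homogeneous_intros homogeneous_sum_list homogeneous_lin_ext) simp_all

lemma connection_form_linear:
  assumes "\<forall>p\<in>set Gs. tderiv (snd p)"
  shows "connection_form Gs (x + y) \<doteq> connection_form Gs x + connection_form Gs y"
    and "connection_form Gs (c *s x) \<doteq> fscale c (connection_form Gs x)"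
proof -
  have p: "cut (fst p) (snd p (x + y)) \<doteq> cut (fst p) (snd p x) + cut (fst p) (snd p y)"
    "cut (fst p) (snd p (c *s x)) \<doteq> fscale c (cut (fst p) (snd p x))" if "p \<in> set Gs" for p
  proof -
    have "snd p (x + y) \<simeq> snd p x + snd p y" "snd p (c *s x) \<simeq> fscale c (snd p x)"
      using assms that by (auto simp: tderiv_def fscale_eq_mult)
    from this[THEN cut_eqt] show
      "cut (fst p) (snd p (x + y)) \<doteq> cut (fst p) (snd p x) + cut (fst p) (snd p y)"
      "cut (fst p) (snd p (c *s x)) \<doteq> fscale c (cut (fst p) (snd p x))"
      by (simp_all add: cut.add cut.scale)
  qed
  have "connection_form Gs (x + y) \<doteq>
      (\<Sum>p\<leftarrow>Gs. cut (fst p) (snd p x) + cut (fst p) (snd p y)) + (unit_part x + unit_part y)"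
    unfolding connection_form_def by (intro eqf_add eqf_sum_list p unit_part_linear)
  then show "connection_form Gs (x + y) \<doteq> connection_form Gs x + connection_form Gs y"
    by (simp add: connection_form_def sum_list_addf algebra_simps)
  have fs: "(\<Sum>p\<leftarrow>ps. fscale c (f p)) = fscale c (\<Sum>p\<leftarrow>ps. f p)"
    for ps and f :: "'r \<times> ('r \<Rightarrow> ('v, 'r) tens) \<Rightarrow> ('v, 'r) preform"
    by (induction ps) (simp_all add: free.scale_right_distrib)
  have "connection_form Gs (c *s x) \<doteq>
      (\<Sum>p\<leftarrow>Gs. fscale c (cut (fst p) (snd p x))) + fscale c (unit_part x)"
    unfolding connection_form_def by (intro eqf_add eqf_sum_list p unit_part_linear)
  then show "connection_form Gs (c *s x) \<doteq> fscale c (connection_form Gs x)"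
    by (simp add: connection_form_def fs free.scale_right_distrib)
qed

text \<open>The defects of the summands are values of the linear map \<open>tail y\<close>; the dual
  basis identity sums them to Dx Dy, which \<open>unit_part\<close> exchanges for dx dy.\<close>

lemma connection_form_mult:
  assumes G: "\<forall>p\<in>set Gs. tderiv (snd p)"
    and sum: "\<forall>a. (\<Sum>p\<leftarrow>Gs. snd p a * Delta (fst p)) \<simeq> Delta a"
  shows "connection_form Gs (x * y) \<doteq>
    pre_lmul x (connection_form Gs y) + pre_rmul y (connection_form Gs x) + bas (0, 1) [x, y]"
proof -
  have "cut (fst p) (snd p (x * y)) \<doteq> pre_lmul x (cut (fst p) (snd p y)) +
      pre_rmul y (cut (fst p) (snd p x)) + tail y (snd p x * Delta (fst p))" if "p \<in> set Gs" for p
  proof -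
    have "snd p (x * y) \<simeq> tn x 1 * snd p y + tn 1 y * snd p x"
      using G that by (auto simp: tderiv_def)
    from cut_eqt[OF this] show ?thesis
      by (simp add: cut.add cut_lmul cut_rmul add.assoc)
  qed
  then have "(\<Sum>p\<leftarrow>Gs. cut (fst p) (snd p (x * y))) \<doteq> (\<Sum>p\<leftarrow>Gs. pre_lmul x (cut (fst p) (snd p y)) +
      pre_rmul y (cut (fst p) (snd p x)) + tail y (snd p x * Delta (fst p)))"
    by (rule eqf_sum_list)
  also have "(\<Sum>p\<leftarrow>Gs. pre_lmul x (cut (fst p) (snd p y)) +
      pre_rmul y (cut (fst p) (snd p x)) + tail y (snd p x * Delta (fst p))) =
      pre_lmul x (\<Sum>p\<leftarrow>Gs. cut (fst p) (snd p y)) + pre_rmul y (\<Sum>p\<leftarrow>Gs. cut (fst p) (snd p x)) +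
      tail y (\<Sum>p\<leftarrow>Gs. snd p x * Delta (fst p))"
    by (induction Gs) (simp_all add: lmul.zero lmul.add rmul.zero rmul.add tail.zero tail.add algebra_simps)
  also have "\<dots> \<doteq> pre_lmul x (\<Sum>p\<leftarrow>Gs. cut (fst p) (snd p y)) +
      pre_rmul y (\<Sum>p\<leftarrow>Gs. cut (fst p) (snd p x)) + tail y (Delta x)"
    using sum by (intro eqf_add eqf_refl tail_eqt) blast
  finally have "connection_form Gs (x * y) \<doteq> pre_lmul x (\<Sum>p\<leftarrow>Gs. cut (fst p) (snd p y)) +
      pre_rmul y (\<Sum>p\<leftarrow>Gs. cut (fst p) (snd p x)) + tail y (Delta x) + unit_part (x * y)"
    unfolding connection_form_def by (rule eqf_add) (rule eqf_refl)
  then show ?thesis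
    by (simp add: connection_form_def lmul.add rmul.add unit_part_mult algebra_simps)
qed

section \<open>The connection determined by \<open>ph\<close>\<close>

definition lact :: "'r \<times> 'v \<Rightarrow> ('v, 'r) preform \<Rightarrow> ('v, 'r) preform" where
  "lact z f = pre_lmul (fst z) f + fscale (snd z) f"

lemma eqf_lact: "f \<doteq> g \<Longrightarrow> lact z f \<doteq> lact z g"
  unfolding lact_def by (intro eqf_add eqf_lmul eqf_scale)

lemma lact_add: "lact z (f + g) = lact z f + lact z g"
  by (simp add: lact_def lmul.add free.scale_right_distrib algebra_simps)

lemma lact_scale: "lact z (fscale c f) = fscale c (lact z f)"
  by (simp add: lact_def lmul.scale free.scale_right_distrib mult.commute)

lemma lact_linear:
  "lact (z + w) f \<doteq> lact z f + lact w f" "lact (unital_scale c z) f \<doteq> fscale c (lact z f)"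
proof -
  have "lact (z + w) f \<doteq> (pre_lmul (fst z) f + pre_lmul (fst w) f) + (fscale (snd z) f + fscale (snd w) f)"
    unfolding lact_def fst_add snd_add free.scale_left_distrib
    by (intro eqf_add eqf_refl lmul_linear)
  then show "lact (z + w) f \<doteq> lact z f + lact w f" by (simp add: lact_def algebra_simps)
  have "lact (unital_scale c z) f \<doteq> fscale c (pre_lmul (fst z) f) + fscale (c * snd z) f"
    unfolding lact_def unital_scale_def fst_conv snd_conv by (intro eqf_add eqf_refl lmul_linear)
  then show "lact (unital_scale c z) f \<doteq> fscale c (lact z f)"
    by (simp add: lact_def free.scale_right_distrib)
qed

lemma lact_mult:
  "lact (unital_mult (a, 0) z) f \<doteq> pre_lmul a (lact z f)"
  "lact (unital_mult z (a, 0)) f \<doteq> lact z (pre_lmul a f)"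
proof -
  have 1: "lact (unital_mult (a, 0) z) f \<doteq> pre_lmul (a * fst z) f + fscale (snd z) (pre_lmul a f)"
  proof -
    have "lact (unital_mult (a, 0) z) f = pre_lmul (a * fst z + snd z *s a) f"
      by (simp add: lact_def unital_mult_def)
    also have "\<dots> \<doteq> pre_lmul (a * fst z) f + pre_lmul (snd z *s a) f" by (rule lmul_linear)
    also have "\<dots> \<doteq> pre_lmul (a * fst z) f + fscale (snd z) (pre_lmul a f)"
      by (intro eqf_add eqf_refl lmul_linear)
    finally show ?thesis .
  qed
  then show "lact (unital_mult (a, 0) z) f \<doteq> pre_lmul a (lact z f)"
    by (simp add: lact_def lmul.add lmul.scale lmul_linear(3))
  have "unital_mult z (a, 0) = unital_mult (a, 0) z"
    by (simp add: unital_mult_def mult.commute add.commute)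
  with 1 show "lact (unital_mult z (a, 0)) f \<doteq> lact z (pre_lmul a f)"
    by (simp add: lact_def mult.commute[of a] lmul_linear(3))
qed

lemma lact_bas: "lact z (bas (0, 1) xs) \<doteq> bas z xs"
  using eqf_sym[OF bas_split[of z xs]] by (simp add: lact_def)

lemma lact_rmul: "homogeneous 2 f \<Longrightarrow> lact z (pre_rmul a f) = pre_rmul a (lact z f)"
  by (simp add: lact_def lmul_rmul rmul.add rmul.scale)

text \<open>The 1-form z dx goes to z ph(x). The value 0 in other degrees makes the map total on
  preforms.\<close>

definition nabla :: "('r \<Rightarrow> ('v, 'r) preform) \<Rightarrow> ('v, 'r) preform \<Rightarrow> ('v, 'r) preform" where
  "nabla ph = lin_ext (\<lambda>k. if length (snd k) = 1 then lact (fst k) (ph (hd (snd k))) else 0)"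

sublocale nabla: module_hom fscale fscale "nabla ph" for ph
  unfolding nabla_def by (rule lin_ext_hom)

lemma nabla_bas:
  "nabla ph (bas z [x]) = lact z (ph x)" "length xs \<noteq> 1 \<Longrightarrow> nabla ph (bas z xs) = 0"
  by (simp_all add: nabla_def)

context
  fixes ph :: "'r \<Rightarrow> ('v, 'r) preform"
  assumes ph_add: "\<And>x y. ph (x + y) \<doteq> ph x + ph y"
    and ph_scale: "\<And>c x. ph (c *s x) \<doteq> fscale c (ph x)"
    and ph_mult: "\<And>x y. ph (x * y) \<doteq> pre_lmul x (ph y) + pre_rmul y (ph x) + bas (0, 1) [x, y]"
    and ph_homogeneous: "\<And>x. homogeneous 2 (ph x)"
begin

lemma nabla_null:
  assumes "f \<in> tensor_relations"
  shows "nabla ph f \<in> null_forms"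
proof -
  have "nabla ph f \<doteq> 0"
    using assms
  proof cases
    case (add0 z w xs)
    show ?thesis
    proof (cases "length xs = 1")
      case True
      then obtain x where "xs = [x]" by (auto simp: length_Suc_conv)
      then show ?thesis
        using eqf_diff[OF lact_linear(1) eqf_refl, of z w "ph x" "lact z (ph x) + lact w (ph x)"]
        by (simp add: add0 nabla.diff nabla_bas flip: diff_diff_eq)
    qed (simp add: add0 nabla.diff nabla_bas)
  next
    case (scale0 c z xs)
    show ?thesis
    proof (cases "length xs = 1")
      case True
      then obtain x where "xs = [x]" by (auto simp: length_Suc_conv)
      then show ?thesis
        using eqf_diff[OF lact_linear(2) eqf_refl, of c z "ph x" "fscale c (lact z (ph x))"]
        by (simp add: scale0 nabla.diff nabla.scale nabla_bas)
    qed (simp add: scale0 nabla.diff nabla.scale nabla_bas)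
  next
    case (add z us x y vs)
    show ?thesis
    proof (cases "us = [] \<and> vs = []")
      case True
      have "lact z (ph (x + y)) \<doteq> lact z (ph x) + lact z (ph y)"
        using eqf_lact[OF ph_add] by (simp add: lact_add)
      from eqf_diff[OF this eqf_refl, of "lact z (ph x) + lact z (ph y)"] show ?thesis
        using True by (simp add: add nabla.diff nabla_bas flip: diff_diff_eq)
    next
      case False
      then have "nabla ph (bas z (us @ w # vs)) = 0" for w by (intro nabla_bas) auto
      then show ?thesis by (simp add: add nabla.diff)
    qed
  next
    case (scale z us c x vs)
    show ?thesis
    proof (cases "us = [] \<and> vs = []")
      case True
      have "lact z (ph (c *s x)) \<doteq> fscale c (lact z (ph x))"
        using eqf_lact[OF ph_scale] by (simp add: lact_scale)
      from eqf_diff[OF this eqf_refl, of "fscale c (lact z (ph x))"] show ?thesis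
        using True by (simp add: scale nabla.diff nabla.scale nabla_bas)
    next
      case False
      then have "nabla ph (bas z (us @ w # vs)) = 0" for w by (intro nabla_bas) auto
      then show ?thesis by (simp add: scale nabla.diff nabla.scale)
    qed
  qed
  then show ?thesis by (simp add: eqf_def cls_eq_iff)
qed

lemma lift_nabla: "lift_form (nabla ph) (cls f) = cls (nabla ph f)"
  by (rule lift_form_cls[OF nabla.module_hom_axioms nabla_null])

lemma homogeneous_nabla:
  assumes "homogeneous 1 f"
  shows "homogeneous 2 (nabla ph f)"
proof -
  have "homogeneous 2 (pre_lmul a (ph x))" for a x
    unfolding pre_lmul_def
  proof (rule homogeneous_lin_ext)
    fix k assume "k \<in> Poly_Mapping.keys (ph x)"
    then have "length (snd k) = 2" using ph_homogeneous[of x] by (simp add: homogeneous_def)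
    then show "homogeneous 2 (case k of (z, xs) \<Rightarrow> bas (unital_mult (a, 0) z) xs)"
      by (simp add: case_prod_beta homogeneous_intros)
  qed
  then have "homogeneous 2 (lact z (ph x))" for z x
    unfolding lact_def by (intro homogeneous_intros ph_homogeneous)
  then show ?thesis
    unfolding nabla_def by (intro homogeneous_lin_ext) (simp add: homogeneous_intros)
qed

lemma nabla_lmul: "homogeneous 1 f \<Longrightarrow> nabla ph (pre_lmul a f) \<doteq> pre_lmul a (nabla ph f)"
proof (induction rule: homogeneous_induct)
  case (basis c z xs)
  then obtain x where "xs = [x]" by (auto simp: length_Suc_conv)
  then show ?case
    using eqf_scale[OF lact_mult(1)] by (simp add: lmul.scale nabla.scale nabla_bas)
next
  case (add f g)
  then show ?case by (simp add: lmul.add nabla.add eqf_add)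
qed (simp add: lmul.zero nabla.zero)

text \<open>Since (dx) a = d(x a) - x da, the term x ph(a) of the product rule cancels and ph(x) a +
  dx da remains.\<close>

lemma nabla_rmul:
  "homogeneous 1 f \<Longrightarrow> nabla ph (pre_rmul a f) \<doteq> pre_rmul a (nabla ph f) + pre_mul_d a f"
proof (induction rule: homogeneous_induct)
  case (basis c z xs)
  then obtain x where x: "xs = [x]" by (auto simp: length_Suc_conv)
  have "nabla ph (pre_rmul a (bas z [x])) = lact z (ph (x * a)) - lact (unital_mult z (x, 0)) (ph a)"
    by (simp add: nabla.diff nabla_bas)
  also have "\<dots> \<doteq> lact z (pre_lmul x (ph a) + pre_rmul a (ph x) + bas (0, 1) [x, a]) -
      lact z (pre_lmul x (ph a))"
    by (intro eqf_diff eqf_lact ph_mult lact_mult)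
  also have "\<dots> = pre_rmul a (lact z (ph x)) + lact z (bas (0, 1) [x, a])"
    by (simp add: lact_add lact_rmul ph_homogeneous)
  also have "\<dots> \<doteq> pre_rmul a (lact z (ph x)) + bas z [x, a]"
    by (intro eqf_add eqf_refl lact_bas)
  finally have "nabla ph (pre_rmul a (bas z [x])) \<doteq>
      pre_rmul a (nabla ph (bas z [x])) + pre_mul_d a (bas z [x])"
    by (simp add: nabla_bas)
  from eqf_scale[OF this, of c] show ?case
    by (simp only: x rmul.scale nabla.scale muld.scale free.scale_right_distrib)
next
  case (add f g)
  then show ?case
    using eqf_add[OF add] by (simp add: rmul.add nabla.add muld.add algebra_simps)
qed (simp add: rmul.zero nabla.zero muld.zero)

lemma connection_nabla: "connection (lift_form (nabla ph))"
  unfolding connection_def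
proof (intro conjI ballI allI)
  show "lift_form (nabla ph) \<in> Omega 1 \<rightarrow> Omega 2"
    using homogeneous_nabla by (fastforce simp: Omega_iff lift_nabla)
  fix A assume "A \<in> Omega 1"
  then obtain f where f: "homogeneous 1 f" "A = cls f" by (auto simp: Omega_iff)
  show "lift_form (nabla ph) (A \<oplus> B) = lift_form (nabla ph) A \<oplus> lift_form (nabla ph) B"
    if "B \<in> Omega 1" for B
    using that f by (auto simp: Omega_iff form_add_cls lift_nabla nabla.add)
  show "lift_form (nabla ph) (form_scale a A) = form_scale a (lift_form (nabla ph) A)" for a
    by (simp add: f form_scale_cls lift_nabla nabla.scale)
  show "lift_form (nabla ph) (form_lmul a A) = form_lmul a (lift_form (nabla ph) A)" for a
    using nabla_lmul[OF f(1)] by (simp add: f form_lmul_cls lift_nabla eqf_def)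
  show "lift_form (nabla ph) (form_rmul A a) = form_rmul (lift_form (nabla ph) A) a \<oplus> form_mul_d A a" for a
    using nabla_rmul[OF f(1)]
    by (simp add: f form_rmul_cls form_mul_d_cls form_add_cls lift_nabla eqf_def)
qed

end

section \<open>Finite degree\<close>

lemma prod_filt_subspace: "subspace (prod_filt M i)"
  by (simp add: prod_filt_def)

lemma prod_filt_mono: "i \<le> j \<Longrightarrow> prod_filt M i \<subseteq> prod_filt M j"
  unfolding prod_filt_def by (intro span_mono) fastforce

lemma prod_filt_list:
  "xs \<noteq> [] \<Longrightarrow> length xs \<le> i \<Longrightarrow> set xs \<subseteq> M \<Longrightarrow> prod_list xs \<in> prod_filt M i"
  unfolding prod_filt_def
  by (intro span_base UN_I[of "length xs"]) (auto simp: prod_span_def Suc_le_eq intro!: span_base)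

text \<open>There is no case for the empty product: \<open>prod_filt M 0\<close> is \<open>0\<close>, not the scalars.\<close>

lemma prod_filt_induct [consumes 1, case_names zero add scale list]:
  assumes "a \<in> prod_filt M i" and "P 0" and "\<And>a b. P a \<Longrightarrow> P b \<Longrightarrow> P (a + b)"
    and "\<And>c a. P a \<Longrightarrow> P (c *s a)"
    and "\<And>xs. xs \<noteq> [] \<Longrightarrow> length xs \<le> i \<Longrightarrow> set xs \<subseteq> M \<Longrightarrow> P (prod_list xs)"
  shows "P a"
proof -
  have P: "subspace {a. P a}" using assms(2-4) by (auto intro!: subspaceI)
  have "prod_span M k \<subseteq> {a. P a}" if "k \<in> {1..i}" for k
    unfolding prod_span_def
  proof (rule span_minimal[OF _ P], rule subsetI)
    fix a assume "a \<in> {prod_list xs |xs. length xs = k \<and> set xs \<subseteq> M}"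
    then obtain xs where "a = prod_list xs" "length xs = k" "set xs \<subseteq> M" by blast
    moreover from this that have "xs \<noteq> []" by auto
    ultimately show "a \<in> {a. P a}" using that assms(5)[of xs] by auto
  qed
  then have "prod_filt M i \<subseteq> {a. P a}"
    unfolding prod_filt_def by (intro span_minimal[OF _ P]) blast
  with assms(1) show ?thesis by blast
qed

lemma prod_filt_mult:
  assumes a: "a \<in> prod_filt M i" and b: "b \<in> prod_filt M j"
  shows "a * b \<in> prod_filt M (i + j)"
  using a
proof (induction rule: prod_filt_induct)
  case (list xs)
  from b show ?case
  proof (induction rule: prod_filt_induct)
    case (list ys)
    have "prod_list (xs @ ys) \<in> prod_filt M (i + j)"
      using list \<open>xs \<noteq> []\<close> \<open>length xs \<le> i\<close> \<open>set xs \<subseteq> M\<close> by (intro prod_filt_list) auto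
    then show ?case by simp
  qed (simp_all add: subspace_0[OF prod_filt_subspace] subspace_add[OF prod_filt_subspace]
      subspace_scale[OF prod_filt_subspace] distrib_left mult_scale)
qed (simp_all add: subspace_0[OF prod_filt_subspace] subspace_add[OF prod_filt_subspace]
      subspace_scale[OF prod_filt_subspace] distrib_right scale_mult)

text \<open>Defined through classes, so that membership is invariant under
  \<open>\<doteq>\<close>.\<close>

definition filt2 :: "'r set \<Rightarrow> nat \<Rightarrow> ('v, 'r) preform set" where
  "filt2 M r = {f. cls f \<in> form_filt M r 2}"

lemma filt2_cong: "f \<doteq> g \<Longrightarrow> f \<in> filt2 M r \<longleftrightarrow> g \<in> filt2 M r"
  by (simp add: filt2_def eqf_def)

lemma filt2_closed:
  "0 \<in> filt2 M r" "f \<in> filt2 M r \<Longrightarrow> g \<in> filt2 M r \<Longrightarrow> f + g \<in> filt2 M r"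
  "f \<in> filt2 M r \<Longrightarrow> fscale c f \<in> filt2 M r"
  "f \<in> filt2 M r \<Longrightarrow> g \<in> filt2 M r \<Longrightarrow> f - g \<in> filt2 M r"
proof -
  show "0 \<in> filt2 M r" unfolding filt2_def form_filt_def by (auto intro: free.span_zero)
  show add: "f + g \<in> filt2 M r" if "f \<in> filt2 M r" "g \<in> filt2 M r" for f g
    using that unfolding filt2_def form_filt_def
    by (auto simp flip: form_add_cls) (auto simp: form_add_cls intro!: imageI free.span_add)
  show sc: "fscale c f \<in> filt2 M r" if "f \<in> filt2 M r" for c f
    using that unfolding filt2_def form_filt_def
    by (auto simp flip: form_scale_cls) (auto simp: form_scale_cls intro!: imageI free.span_scale)
  have minus: "f - g = f + fscale (- 1) g"
    by (rule poly_mapping_eqI) (simp add: lookup_add lookup_minus)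
  show "f - g \<in> filt2 M r" if "f \<in> filt2 M r" "g \<in> filt2 M r"
    unfolding minus using that by (intro add sc)
qed

lemma filt2_bas0:
  assumes "a \<in> prod_filt M i" "x \<in> prod_filt M j" "y \<in> prod_filt M k" "i + j + k \<le> r"
  shows "bas (a, 0) [x, y] \<in> filt2 M r"
proof -
  define idx where "idx = (\<lambda>l::nat. if l = 0 then i else if l = 1 then j else k)"
  have "(\<Sum>l\<le>2. idx l) \<le> r" using assms(4) by (simp add: idx_def numeral_2_eq_2)
  moreover have "\<forall>l<2. [x, y] ! l \<in> prod_filt M (idx (Suc l))"
    using assms by (auto simp: idx_def less_2_cases_iff)
  moreover have "a \<in> prod_filt M (idx 0)" using assms by (simp add: idx_def)
  ultimately show ?thesis
    unfolding filt2_def form_filt_def mem_Collect_eq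
    by (intro imageI free.span_base UnI1 CollectI exI[of _ a] exI[of _ "[x, y]"] conjI exI[of _ idx]) simp_all
qed

lemma filt2_bas1:
  assumes "x \<in> prod_filt M j" "y \<in> prod_filt M k" "j + k \<le> r"
  shows "bas (0, 1) [x, y] \<in> filt2 M r"
proof -
  define idx where "idx = (\<lambda>l::nat. if l = 0 then j else k)"
  have "(\<Sum>l<2. idx l) \<le> r" using assms(3) by (simp add: idx_def numeral_2_eq_2)
  moreover have "\<forall>l<2. [x, y] ! l \<in> prod_filt M (idx l)"
    using assms by (auto simp: idx_def less_2_cases_iff)
  ultimately show ?thesis
    unfolding filt2_def form_filt_def mem_Collect_eq
    by (intro imageI free.span_base UnI2 CollectI exI[of _ "[x, y]"] conjI exI[of _ idx]) simp_all
qed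

lemma filt2_induct [consumes 1, case_names cong zero add scale bas0 bas1]:
  assumes "f \<in> filt2 M r"
    and cong: "\<And>f g. f \<doteq> g \<Longrightarrow> P f \<Longrightarrow> P g"
    and zero: "P 0" and add: "\<And>f g. P f \<Longrightarrow> P g \<Longrightarrow> P (f + g)" and scale: "\<And>c f. P f \<Longrightarrow> P (fscale c f)"
    and bas0: "\<And>a x y i j k. a \<in> prod_filt M i \<Longrightarrow> x \<in> prod_filt M j \<Longrightarrow> y \<in> prod_filt M k \<Longrightarrow>
      i + j + k \<le> r \<Longrightarrow> P (bas (a, 0) [x, y])"
    and bas1: "\<And>x y j k. x \<in> prod_filt M j \<Longrightarrow> y \<in> prod_filt M k \<Longrightarrow> j + k \<le> r \<Longrightarrow> P (bas (0, 1) [x, y])"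
  shows "P f"
proof -
  let ?B0 = "{bas (m, 0) ms | m ms. length ms = 2 \<and>
         (\<exists>i. (\<Sum>k\<le>2. i k) \<le> r \<and> m \<in> prod_filt M (i 0) \<and>
              (\<forall>k<2. ms ! k \<in> prod_filt M (i (Suc k))))}"
  let ?B1 = "{bas (0, 1) ms | ms. length ms = 2 \<and>
         (\<exists>i. (\<Sum>k<2. i k) \<le> r \<and> (\<forall>k<2. ms ! k \<in> prod_filt M (i k)))}"
  have "cls f \<in> cls ` free.span (?B0 \<union> ?B1)"
    using assms(1) by (simp add: filt2_def form_filt_def)
  then obtain g where g: "g \<in> free.span (?B0 \<union> ?B1)" "g \<doteq> f" by (auto simp: eqf_def)
  have gen: "P b" if "b \<in> ?B0 \<union> ?B1" for b
    using that
  proof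
    assume "b \<in> ?B0"
    then obtain m ms i where b: "b = bas (m, 0) ms" "length ms = 2" "(\<Sum>k\<le>2. i k) \<le> r"
      "m \<in> prod_filt M (i 0)" "\<forall>k<2. ms ! k \<in> prod_filt M (i (Suc k))" by blast
    then obtain x y where "ms = [x, y]" by (auto simp: length_Suc_conv numeral_2_eq_2)
    with b bas0[of m "i 0" x "i 1" y "i 2"] show ?thesis
      by (simp add: numeral_2_eq_2 less_Suc_eq all_conj_distrib)
  next
    assume "b \<in> ?B1"
    then obtain ms i where b: "b = bas (0, 1) ms" "length ms = 2" "(\<Sum>k<2. i k) \<le> r"
      "\<forall>k<2. ms ! k \<in> prod_filt M (i k)" by blast
    then obtain x y where "ms = [x, y]" by (auto simp: length_Suc_conv numeral_2_eq_2)
    with b bas1[of x "i 0" y "i 1"] show ?thesis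
      by (simp add: numeral_2_eq_2 less_Suc_eq all_conj_distrib)
  qed
  from g(1) have "P g"
  proof (induction rule: free.span_induct_alt)
    case (step c b f)
    show ?case by (rule add[OF scale[OF gen[OF step(1)]] step(2)])
  qed (rule zero)
  then show ?thesis by (rule cong[OF g(2)])
qed

lemma filt2_mono:
  assumes "f \<in> filt2 M r" "r \<le> s"
  shows "f \<in> filt2 M s"
  using assms(1)
proof (induction rule: filt2_induct)
  case (bas0 a x y i j k)
  then show ?case using assms(2) by (intro filt2_bas0) auto
next
  case (bas1 x y j k)
  then show ?case using assms(2) by (intro filt2_bas1) auto
qed (auto simp: filt2_cong filt2_closed)

lemma filt2_lmul:
  assumes a: "a \<in> prod_filt M i" and f: "f \<in> filt2 M r"
  shows "pre_lmul a f \<in> filt2 M (i + r)"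
  using f
proof (induction rule: filt2_induct)
  case (cong f g)
  then show ?case using filt2_cong[OF eqf_lmul] by blast
next
  case (bas0 b x y j k l)
  show ?case
    using prod_filt_mult[OF a bas0(1)] bas0 by (simp only: pre_lmul_bas unital_mult_simps) (rule filt2_bas0, auto)
next
  case (bas1 x y j k)
  then show ?case using a by (simp only: pre_lmul_bas unital_mult_simps) (rule filt2_bas0, auto)
qed (simp_all add: lmul.zero lmul.add lmul.scale filt2_closed)

text \<open>Right multiplication by the Leibniz rule only multiplies neighbouring entries, so each
  resulting term has total degree at most the old one plus \<open>i\<close>.\<close>

lemma filt2_rmul:
  assumes b: "b \<in> prod_filt M i" and f: "f \<in> filt2 M r"
  shows "pre_rmul b f \<in> filt2 M (r + i)"
  using f
proof (induction rule: filt2_induct)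
  case (cong f g)
  then show ?case using filt2_cong[OF eqf_rmul] by blast
next
  case (bas0 a x y j k l)
  note m = prod_filt_mult[OF bas0(3) b] prod_filt_mult[OF bas0(2,3)] prod_filt_mult[OF bas0(1,2)]
  have "bas (a, 0) [x, y * b] \<in> filt2 M (r + i)" by (rule filt2_bas0[OF bas0(1,2) m(1)]) (use bas0 in simp)
  moreover have "bas (a, 0) [x * y, b] \<in> filt2 M (r + i)" by (rule filt2_bas0[OF bas0(1) m(2) b]) (use bas0 in simp)
  moreover have "bas (a * x, 0) [y, b] \<in> filt2 M (r + i)" by (rule filt2_bas0[OF m(3) bas0(3) b]) (use bas0 in simp)
  ultimately show ?case by (simp add: filt2_closed)
next
  case (bas1 x y k l)
  note m = prod_filt_mult[OF bas1(2) b] prod_filt_mult[OF bas1(1,2)]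
  have "bas (0, 1) [x, y * b] \<in> filt2 M (r + i)" by (rule filt2_bas1[OF bas1(1) m(1)]) (use bas1 in simp)
  moreover have "bas (0, 1) [x * y, b] \<in> filt2 M (r + i)" by (rule filt2_bas1[OF m(2) b]) (use bas1 in simp)
  moreover have "bas (x, 0) [y, b] \<in> filt2 M (r + i)" by (rule filt2_bas0[OF bas1(1,2) b]) (use bas1 in simp)
  ultimately show ?case by (simp add: filt2_closed)
qed (simp_all add: rmul.zero rmul.add rmul.scale filt2_closed)

text \<open>Supplies a degree for each single value of \<open>ph\<close>; a common bound follows on
  a finite set of arguments.\<close>

lemma filt2_exhausts:
  assumes M: "\<And>a. \<exists>i. a \<in> prod_filt M i" and f: "homogeneous 2 f"
  shows "\<exists>r. f \<in> filt2 M r"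
  using f
proof (induction rule: homogeneous_induct)
  case zero
  show ?case using filt2_closed(1) by blast
next
  case (add f g)
  then obtain r s where "f \<in> filt2 M r" "g \<in> filt2 M s" by blast
  then have "f \<in> filt2 M (max r s)" "g \<in> filt2 M (max r s)" by (auto intro: filt2_mono)
  then show ?case using filt2_closed(2) by blast
next
  case (basis c z xs)
  then obtain x y where xs: "xs = [x, y]" by (auto simp: length_Suc_conv numeral_2_eq_2)
  obtain i j k where ijk: "fst z \<in> prod_filt M i" "x \<in> prod_filt M j" "y \<in> prod_filt M k"
    using M by metis
  have "bas (fst z, 0) xs + fscale (snd z) (bas (0, 1) xs) \<in> filt2 M (i + j + k)"
    unfolding xs by (intro filt2_closed filt2_bas0[OF ijk] filt2_bas1[OF ijk(2,3)]) simp_all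
  then have "bas z xs \<in> filt2 M (i + j + k)" by (simp only: filt2_cong[OF bas_split[of z xs]])
  then show ?case using filt2_closed(3) by blast
qed

text \<open>As \<open>prod_filt\<close> contains no empty products, the constant terms of
  polynomials are reached through \<open>1 \<in> M\<close>.\<close>

lemma prod_filt_exhausts:
  assumes gen: "generates n x" and M: "1 \<in> M" "\<And>i. i < n \<Longrightarrow> x i \<in> M"
  shows "\<exists>i. a \<in> prod_filt M i"
proof -
  let ?W = "\<Union>i. prod_filt M i"
  have M': "y \<in> prod_filt M 1" if "y \<in> M" for y
    using prod_filt_list[of "[y]" 1 M] that by simp
  have add: "a + b \<in> ?W" if "a \<in> ?W" "b \<in> ?W" for a b
  proof -
    from that obtain i j where "a \<in> prod_filt M i" "b \<in> prod_filt M j" by blast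
    then have "a \<in> prod_filt M (max i j)" "b \<in> prod_filt M (max i j)"
      using prod_filt_mono[of i "max i j" M] prod_filt_mono[of j "max i j" M] by auto
    then show ?thesis using subspace_add[OF prod_filt_subspace] by blast
  qed
  have mult: "a * b \<in> ?W" if "a \<in> ?W" "b \<in> ?W" for a b
    using that prod_filt_mult by blast
  have scale: "c *s a \<in> ?W" if "a \<in> ?W" for c a
    using that subspace_scale[OF prod_filt_subspace] by blast
  have one: "1 \<in> ?W" using M'[OF M(1)] by blast
  have zero: "0 \<in> ?W" using subspace_0[OF prod_filt_subspace] by blast
  have power: "y ^ d \<in> ?W" if "y \<in> ?W" for y d
    by (induction d) (use one mult that in auto)
  have prod: "(\<Prod>i\<in>A. f i) \<in> ?W" if "finite A" "\<And>i. i \<in> A \<Longrightarrow> f i \<in> ?W" for A and f :: "nat \<Rightarrow> 'r"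
    using that by (induction rule: finite_induct) (use one mult in auto)
  have sum: "(\<Sum>m\<in>A. f m) \<in> ?W" if "finite A" "\<And>m. m \<in> A \<Longrightarrow> f m \<in> ?W" for A and f :: "(nat \<Rightarrow>\<^sub>0 nat) \<Rightarrow> 'r"
    using that by (induction rule: finite_induct) (use zero add in auto)
  have "a \<in> peval x ` polys_in n" using gen by (simp add: generates_def)
  then obtain p where p: "p \<in> polys_in n" "a = peval x p" by blast
  have "a \<in> ?W"
    unfolding p(2) peval_def
  proof (intro sum scale prod power)
    fix m i assume "m \<in> Poly_Mapping.keys p" "i \<in> Poly_Mapping.keys m"
    then have "x i \<in> M" using p(1) M(2) by (auto simp: polys_in_def)
    then show "x i \<in> ?W" using M' by blast
  qed simp_all
  then show ?thesis by blast
qed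

text \<open>On a generating module \<open>M\<close> the Leibniz rule for \<open>ph\<close> bounds its degree by the degree on the
  finitely many generators of \<open>M\<close>.\<close>

lemma finite_degree_nabla:
  fixes ph :: "'r \<Rightarrow> ('v, 'r) preform"
  assumes fg: "finitely_generated"
    and ph_add: "\<And>x y. ph (x + y) \<doteq> ph x + ph y"
    and ph_scale: "\<And>c x. ph (c *s x) \<doteq> fscale c (ph x)"
    and ph_mult: "\<And>x y. ph (x * y) \<doteq> pre_lmul x (ph y) + pre_rmul y (ph x) + bas (0, 1) [x, y]"
    and ph_homogeneous: "\<And>x. homogeneous 2 (ph x)"
  shows "finite_degree (lift_form (nabla ph))"
  unfolding finite_degree_def
proof (intro allI impI)
  note lift = lift_nabla[OF ph_add ph_scale ph_mult ph_homogeneous]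
  fix S assume "fine_bounded S"
  then obtain S0 where S0: "finite S0" "S \<subseteq> span S0" by (auto simp: fine_bounded_def)
  from fg obtain n x where gen: "generates n x" by (auto simp: finitely_generated_def)
  \<comment> \<open>\<open>S0\<close> takes care of the given bounded set; 1 and the
    \<open>x i\<close> make \<open>M\<close> generate R through \<open>prod_filt\<close>.\<close>
  define B where "B = insert 1 (S0 \<union> x ` {..<n})"
  define M where "M = span B"
  have finB: "finite B" using S0(1) by (simp add: B_def)
  have BM: "B \<subseteq> M" by (simp add: M_def span_superset)
  have exh: "\<exists>i. a \<in> prod_filt M i" for a
    by (rule prod_filt_exhausts[OF gen]) (use BM in \<open>auto simp: B_def\<close>)
  have ph_0: "ph 0 \<in> filt2 M r" for r
    using ph_scale[of 0 0] by (simp add: filt2_cong filt2_closed)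
  have ph_closed: "ph (a + b) \<in> filt2 M r" "ph (c *s a) \<in> filt2 M r"
    if "ph a \<in> filt2 M r" "ph b \<in> filt2 M r" for a b c r
    using that by (simp_all add: filt2_cong[OF ph_add] filt2_cong[OF ph_scale] filt2_closed)
  have "\<exists>d. \<forall>y\<in>B. ph y \<in> filt2 M d"
    using finB
  proof induction
    case (insert y B)
    then obtain d where d: "\<forall>y\<in>B. ph y \<in> filt2 M d" by blast
    obtain e where "ph y \<in> filt2 M e" using filt2_exhausts[OF exh ph_homogeneous] by blast
    then have "\<forall>y\<in>insert y B. ph y \<in> filt2 M (max d e)"
      using d by (auto intro: filt2_mono)
    then show ?case by blast
  qed simp
  then obtain d where d: "\<forall>y\<in>B. ph y \<in> filt2 M d" by blast
  have dM: "ph y \<in> filt2 M d" if "y \<in> M" for y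
  proof -
    have "subspace {y. ph y \<in> filt2 M d}" using ph_0 ph_closed by (auto intro!: subspaceI)
    from span_minimal[OF _ this, of B] d that show ?thesis by (auto simp: M_def)
  qed
  \<comment> \<open>Each of the three terms of the product rule stays within the number of factors
    plus \<open>d\<close>: the constant \<open>d\<close> enters once and does not
    accumulate.\<close>
  have ph_list: "ph (prod_list xs) \<in> filt2 M (length xs + d)" if "xs \<noteq> []" "set xs \<subseteq> M" for xs
    using that
  proof (induction xs)
    case (Cons y ys)
    then have y: "y \<in> M" "ph y \<in> filt2 M d" "y \<in> prod_filt M 1"
      using dM prod_filt_list[of "[y]" 1 M] by auto
    show ?case
    proof (cases "ys = []")
      case True
      then show ?thesis using filt2_mono[OF y(2)] by simp
    next
      case False
      let ?l = "length ys"
      have ys: "prod_list ys \<in> prod_filt M ?l" using False Cons.prems by (intro prod_filt_list) auto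
      have "pre_lmul y (ph (prod_list ys)) \<in> filt2 M (1 + (?l + d))"
        using Cons False by (intro filt2_lmul y) auto
      moreover have "pre_rmul (prod_list ys) (ph y) \<in> filt2 M (1 + (?l + d))"
        using filt2_mono[OF filt2_rmul[OF ys y(2)]] by simp
      moreover have "bas (0, 1) [y, prod_list ys] \<in> filt2 M (1 + (?l + d))"
        by (rule filt2_bas1[OF y(3) ys]) simp
      ultimately show ?thesis by (simp add: filt2_cong[OF ph_mult] filt2_closed)
    qed
  qed simp
  have deg: "ph a \<in> filt2 M (i + d)" if "a \<in> prod_filt M i" for a i
    using that
  proof (induction rule: prod_filt_induct)
    case (list xs)
    then show ?case using filt2_mono[OF ph_list] by simp
  qed (simp_all add: ph_0 ph_closed)
  have "lift_form (nabla ph) ` form_filt M k 1 \<subseteq> form_filt M (k + d) 2" for k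
  proof
    let ?B0 = "{bas (m, 0) ms | m ms. length ms = 1 \<and>
         (\<exists>i. (\<Sum>l\<le>1. i l) \<le> k \<and> m \<in> prod_filt M (i 0) \<and>
              (\<forall>l<1. ms ! l \<in> prod_filt M (i (Suc l))))}"
    let ?B1 = "{bas (0, 1) ms | ms. length ms = 1 \<and>
         (\<exists>i. (\<Sum>l<1. i l) \<le> k \<and> (\<forall>l<1. ms ! l \<in> prod_filt M (i l)))}"
    fix A assume "A \<in> lift_form (nabla ph) ` form_filt M k 1"
    then obtain f where f: "f \<in> free.span (?B0 \<union> ?B1)" "A = cls (nabla ph f)"
      by (auto simp: form_filt_def lift)
    \<comment> \<open>\<open>pre_lmul 0 g\<close> is null without being the zero preform. It occurs
      because \<open>lact (0, 1)\<close> has this summand; as 0 lies in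
      \<open>prod_filt M 0\<close>, it adds no degree.\<close>
    have zero: "pre_lmul 0 g \<in> filt2 M r" if "g \<in> filt2 M r" for g r
      using filt2_lmul[OF subspace_0[OF prod_filt_subspace[of M 0]] that] by simp
    have gen: "nabla ph b \<in> filt2 M (k + d)" if "b \<in> ?B0 \<union> ?B1" for b
      using that
    proof
      assume "b \<in> ?B0"
      then obtain m ms i where b: "b = bas (m, 0) ms" "length ms = 1" "(\<Sum>l\<le>1. i l) \<le> k"
        "m \<in> prod_filt M (i 0)" "\<forall>l<1. ms ! l \<in> prod_filt M (i (Suc l))" by blast
      then obtain y where y: "ms = [y]" by (auto simp: length_Suc_conv)
      with b have "y \<in> prod_filt M (i 1)" "i 0 + i 1 \<le> k" by auto
      from filt2_mono[OF filt2_lmul[OF b(4) deg[OF this(1)]], of "k + d"] this(2)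
      show ?thesis by (simp add: b(1) y nabla_bas lact_def)
    next
      assume "b \<in> ?B1"
      then obtain ms i where b: "b = bas (0, 1) ms" "length ms = 1" "(\<Sum>l<1. i l) \<le> k"
        "\<forall>l<1. ms ! l \<in> prod_filt M (i l)" by blast
      then obtain y where y: "ms = [y]" by (auto simp: length_Suc_conv)
      with b have "y \<in> prod_filt M (i 0)" "i 0 \<le> k" by auto
      from filt2_mono[OF deg[OF this(1)], of "k + d"] this(2)
      have "ph y \<in> filt2 M (k + d)" by simp
      then show ?thesis by (simp add: b(1) y nabla_bas lact_def zero filt2_closed)
    qed
    from f(1) have "nabla ph f \<in> filt2 M (k + d)"
    proof (induction rule: free.span_induct_alt)
      case base
      show ?case by (simp add: nabla.zero filt2_closed)
    next
      case (step c b f)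
      then show ?case by (simp add: nabla.add nabla.scale filt2_closed gen)
    qed
    then show "A \<in> form_filt M (k + d) 2" by (simp add: f(2) filt2_def)
  qed
  then have "finite_degree_on M (lift_form (nabla ph))" unfolding finite_degree_on_def by blast
  moreover have "S \<subseteq> M" using S0(2) span_mono[of S0 B] by (auto simp: M_def B_def)
  moreover have "subspace M" by (simp add: M_def)
  moreover have "fine_bounded M" unfolding fine_bounded_def M_def using finB by blast
  ultimately show "\<exists>M. S \<subseteq> M \<and> subspace M \<and> fine_bounded M \<and> finite_degree_on M (lift_form (nabla ph))"
    by blast
qed

lemma exists_connection_of_finite_degree:
  assumes "\<And>n. noetherian (polys_in n :: 'v mpoly set)"
    and "finitely_generated" and "smooth_of_relative_dimension 1"
  shows "\<exists>D. connection D \<and> finite_degree D"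
proof -
  from double_derivations[OF assms(1,3)] obtain Gs where
    Gs: "\<forall>p\<in>set Gs. tderiv (snd p)" "\<forall>a. (\<Sum>p\<leftarrow>Gs. snd p a * Delta (fst p)) \<simeq> Delta a"
    by (elim exE conjE)
  note ph = connection_form_linear[OF Gs(1)] connection_form_mult[OF Gs] homogeneous_connection_form
  from connection_nabla[OF ph] finite_degree_nabla[OF assms(2) ph] show ?thesis by blast
qed

end

theorem proposition8p2p7:
  fixes scale :: "'v::complete_dvr \<Rightarrow> 'r::{comm_ring,comm_monoid_mult} \<Rightarrow> 'r"
  assumes "comm_algebra scale"
    and "comm_algebra.finitely_generated scale"
    and "comm_algebra.smooth_of_relative_dimension scale 1"
  shows "\<exists>D. comm_algebra.connection scale D \<and> comm_algebra.finite_degree scale D"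
  by (rule comm_algebra.exists_connection_of_finite_degree[OF assms(1) noetherian_polys_in assms(2,3)])

end
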